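(* Let $B$ be a graphic matroid. Then the splitting matroid $B_X$ is a binary gammoid for every $X \subseteq E(B)$ with $|X| \geq 2$ if and only if $B$ has no minor isomorphic to $M(Q_i)$ for any $i \in \{1,2,3,4\}$, where $Q_1,\dots,Q_4$ are the graphs described below.
   Context: Splitting: let $B$ be a binary matroid represented over $GF(2)$ by a matrix $A$, and let $X \subseteq E(B)$. Let $A_X$ be the matrix obtained from $A$ by appending a new last row with entry $1$ in the columns of the elements of $X$ and $0$ elsewhere. The splitting matroid is $B_X = M(A_X)$. A binary gammoid is a matroid that is both binary and a gammoid (equivalently, a matroid with no minor isomorphic to $U_{2,4}$ or $M(K_4)$). $M(G)$ denotes the cycle matroid of a graph $G$. The graphs: $Q_1 = K_4$. $Q_2$ has vertices $t,a,b$ and six edges: two parallel edges between $t$ and $a$, two parallel edges between $t$ and $b$, one edge between $a$ and $b$, and a loop at $t$. $Q_3$ has vertices $t,a,b$ and six edges: two parallel edges between $t$ and $a$, two parallel edges between $t$ and $b$, one edge between $a$ and $b$, and a loop at $b$. $Q_4$ has vertices $t,a,b$ and six edges: two parallel edges between each of the pairs $\{t,a\}$, $\{t,b\}$, $\{a,b\}$. *)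

theory Defs
  imports Main "HOL-Library.Z2" "Graph_Theory.Vertex_Walk"
begin

section \<open>Matroids\<close>

datatype 'a matroid = Matroid (ground: "'a set") (indeps: "'a set set")

definition is_matroid :: "'a matroid \<Rightarrow> bool" where
  "is_matroid M \<longleftrightarrow>
     finite (ground M) \<and>
     indeps M \<subseteq> Pow (ground M) \<and>
     {} \<in> indeps M \<and>
     (\<forall>I J. I \<in> indeps M \<longrightarrow> J \<subseteq> I \<longrightarrow> J \<in> indeps M) \<and>
     (\<forall>I J. I \<in> indeps M \<longrightarrow> J \<in> indeps M \<longrightarrow> card I < card J \<longrightarrow>
        (\<exists>x\<in>J - I. insert x I \<in> indeps M))"

definition isomorphic :: "'a matroid \<Rightarrow> 'b matroid \<Rightarrow> bool" where
  "isomorphic M N \<longleftrightarrow>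
     (\<exists>f. bij_betw f (ground M) (ground N) \<and>
          (\<forall>I. I \<subseteq> ground M \<longrightarrow> (I \<in> indeps M \<longleftrightarrow> f ` I \<in> indeps N)))"

definition restriction :: "'a matroid \<Rightarrow> 'a set \<Rightarrow> 'a matroid" where
  "restriction M U = Matroid U {I \<in> indeps M. I \<subseteq> U}"

definition deletion :: "'a matroid \<Rightarrow> 'a set \<Rightarrow> 'a matroid" where
  "deletion M D = restriction M (ground M - D)"

definition is_basis_of :: "'a matroid \<Rightarrow> 'a set \<Rightarrow> 'a set \<Rightarrow> bool" where
  "is_basis_of M J S \<longleftrightarrow>
     J \<in> indeps M \<and> J \<subseteq> S \<and> (\<forall>K. K \<in> indeps M \<longrightarrow> K \<subseteq> S \<longrightarrow> J \<subseteq> K \<longrightarrow> K = J)"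

definition contraction :: "'a matroid \<Rightarrow> 'a set \<Rightarrow> 'a matroid" where
  "contraction M C =
     Matroid (ground M - C)
       {I. I \<subseteq> ground M - C \<and> (\<exists>J. is_basis_of M J C \<and> I \<union> J \<in> indeps M)}"

definition has_minor :: "'a matroid \<Rightarrow> 'b matroid \<Rightarrow> bool" where
  "has_minor M N \<longleftrightarrow>
     (\<exists>C D. C \<subseteq> ground M \<and> D \<subseteq> ground M \<and> C \<inter> D = {} \<and>
            isomorphic (deletion (contraction M C) D) N)"


section \<open>Binary matroids and splitting\<close>

text \<open>
  A matrix over GF(2) whose columns are labelled by elements of \<^typ>\<open>'a\<close> is given as the list
  of its rows. Only the columns labelled by the ground set matter.
\<close>

type_synonym 'a gf2_matrix = "('a \<Rightarrow> bit) list"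

definition columns_independent :: "'a gf2_matrix \<Rightarrow> 'a set \<Rightarrow> bool" where
  "columns_independent A S \<longleftrightarrow>
     (\<forall>c :: 'a \<Rightarrow> bit. (\<forall>r\<in>set A. (\<Sum>e\<in>S. c e * r e) = 0) \<longrightarrow> (\<forall>e\<in>S. c e = 0))"

definition column_matroid :: "'a set \<Rightarrow> 'a gf2_matrix \<Rightarrow> 'a matroid" where
  "column_matroid E A = Matroid E {S. S \<subseteq> E \<and> columns_independent A S}"

definition represents :: "'a gf2_matrix \<Rightarrow> 'a matroid \<Rightarrow> bool" where
  "represents A M \<longleftrightarrow> M = column_matroid (ground M) A"

definition binary :: "'a matroid \<Rightarrow> bool" where
  "binary M \<longleftrightarrow> is_matroid M \<and> (\<exists>A. represents A M)"

definition append_row :: "'a gf2_matrix \<Rightarrow> 'a set \<Rightarrow> 'a gf2_matrix" where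
  "append_row A X = A @ [\<lambda>e. if e \<in> X then 1 else 0]"

definition splitting_matroid :: "'a matroid \<Rightarrow> 'a gf2_matrix \<Rightarrow> 'a set \<Rightarrow> 'a matroid" where
  "splitting_matroid B A X = column_matroid (ground B) (append_row A X)"


section \<open>Gammoids\<close>

text \<open>Paths may consist of a single vertex, so elements of \<open>I \<inter> T\<close> can be linked to themselves.\<close>

definition linked_into :: "('v, 'b) pre_digraph \<Rightarrow> 'v set \<Rightarrow> 'v set \<Rightarrow> bool" where
  "linked_into D I T \<longleftrightarrow>
     (\<exists>P. (\<forall>v\<in>I. vpath (P v) D \<and> hd (P v) = v \<and> last (P v) \<in> T) \<and>
          (\<forall>v\<in>I. \<forall>w\<in>I. v \<noteq> w \<longrightarrow> set (P v) \<inter> set (P w) = {}))"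

definition strict_gammoid :: "('v, 'b) pre_digraph \<Rightarrow> 'v set \<Rightarrow> 'v matroid" where
  "strict_gammoid D T = Matroid (verts D) {I. I \<subseteq> verts D \<and> linked_into D I T}"

text \<open>
  Every finite digraph is isomorphic to one with vertices in \<^typ>\<open>nat\<close> and arcs in
  \<^typ>\<open>nat \<times> nat\<close>, so fixing these types loses no generality.
\<close>

definition gammoid :: "'a matroid \<Rightarrow> bool" where
  "gammoid M \<longleftrightarrow> is_matroid M \<and>
     (\<exists>(D :: (nat, nat \<times> nat) pre_digraph) T U.
        fin_digraph D \<and> T \<subseteq> verts D \<and> U \<subseteq> verts D \<and>
        isomorphic M (restriction (strict_gammoid D T) U))"

definition binary_gammoid :: "'a matroid \<Rightarrow> bool" where
  "binary_gammoid M \<longleftrightarrow> binary M \<and> gammoid M"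


section \<open>Graphs and cycle matroids\<close>

text \<open>
  Undirected graphs with loops and parallel edges: a loop at \<open>v\<close> has \<open>{v}\<close> as its set of ends.
\<close>

datatype ('v, 'e) mgraph =
  MGraph (vertices: "'v set") (edges: "'e set") (ends: "'e \<Rightarrow> 'v set")

definition finite_mgraph :: "('v, 'e) mgraph \<Rightarrow> bool" where
  "finite_mgraph G \<longleftrightarrow>
     finite (vertices G) \<and> finite (edges G) \<and>
     (\<forall>e\<in>edges G. \<exists>u\<in>vertices G. \<exists>v\<in>vertices G. ends G e = {u, v})"

text \<open>
  Cycles as edge sets; cycles of length 1 are loops, those of length 2 are pairs of parallel edges.
\<close>

definition is_cycle :: "('v, 'e) mgraph \<Rightarrow> 'e set \<Rightarrow> bool" where
  "is_cycle G C \<longleftrightarrow>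
     (\<exists>vs es. vs \<noteq> [] \<and> length es = length vs \<and> distinct vs \<and> distinct es \<and>
        set vs \<subseteq> vertices G \<and> set es \<subseteq> edges G \<and> C = set es \<and>
        (\<forall>i<length vs. ends G (es ! i) = {vs ! i, vs ! (Suc i mod length vs)}))"

definition cycle_matroid :: "('v, 'e) mgraph \<Rightarrow> 'e matroid" where
  "cycle_matroid G = Matroid (edges G) {F. F \<subseteq> edges G \<and> \<not> (\<exists>C. C \<subseteq> F \<and> is_cycle G C)}"

text \<open>Again the types of vertices and edges are no restriction for finite graphs.\<close>

definition graphic :: "'a matroid \<Rightarrow> bool" where
  "graphic M \<longleftrightarrow> is_matroid M \<and>
     (\<exists>G :: (nat, nat) mgraph. finite_mgraph G \<and> isomorphic M (cycle_matroid G))"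

definition mgraph_of_list :: "nat \<Rightarrow> nat set list \<Rightarrow> (nat, nat) mgraph" where
  "mgraph_of_list n es = MGraph {..<n} {..<length es} (\<lambda>i. es ! i)"

definition Q1 :: "(nat, nat) mgraph" where
  "Q1 = mgraph_of_list 4 [{0, 1}, {0, 2}, {0, 3}, {1, 2}, {1, 3}, {2, 3}]"

text \<open>In the following three graphs the vertices \<open>t, a, b\<close> are \<open>0, 1, 2\<close>.\<close>

definition Q2 :: "(nat, nat) mgraph" where
  "Q2 = mgraph_of_list 3 [{0, 1}, {0, 1}, {0, 2}, {0, 2}, {1, 2}, {0}]"

definition Q3 :: "(nat, nat) mgraph" where
  "Q3 = mgraph_of_list 3 [{0, 1}, {0, 1}, {0, 2}, {0, 2}, {1, 2}, {2}]"

definition Q4 :: "(nat, nat) mgraph" where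
  "Q4 = mgraph_of_list 3 [{0, 1}, {0, 1}, {0, 2}, {0, 2}, {1, 2}, {1, 2}]"


section \<open>Graphic matroids are binary\<close>

text \<open>
  The vertex-edge incidence matrix represents the cycle matroid. In particular a representing
  matrix, on which the splitting operation depends, exists for every graphic matroid.
\<close>

definition inc :: "('v, 'e) mgraph \<Rightarrow> 'v \<Rightarrow> 'e \<Rightarrow> bit" where
  "inc G v e = (if v \<in> ends G e \<and> card (ends G e) = 2 then 1 else 0)"

lemma inc_eq:
  assumes "ends G e = {a, b}"
  shows "inc G v e = of_bool (v = a) + of_bool (v = b)"
  using assms by (cases "a = b") (auto simp: inc_def)

lemma bit_add_self: "(x::bit) + x = 0"
  by (cases x) auto

lemma cycle_inc_sum:
  assumes "is_cycle G C"
  shows "(\<Sum>e\<in>C. inc G v e) = 0"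
proof -
  obtain vs es where *: "vs \<noteq> []" "length es = length vs" "distinct vs" "distinct es"
      "C = set es"
      "\<And>i. i < length vs \<Longrightarrow> ends G (es ! i) = {vs ! i, vs ! (Suc i mod length vs)}"
    using assms unfolding is_cycle_def by blast
  let ?n = "length vs"
  let ?s = "\<lambda>i. Suc i mod ?n"
  have n: "?n > 0" using * by simp
  have "bij_betw ((!) es) {..<?n} C"
    using * by (intro bij_betw_nth) auto
  then have "(\<Sum>e\<in>C. inc G v e) = (\<Sum>i<?n. inc G v (es ! i))"
    by (simp add: sum.reindex_bij_betw)
  also have "\<dots> = (\<Sum>i<?n. of_bool (v = vs ! i) + of_bool (v = vs ! ?s i))"
    by (intro sum.cong refl inc_eq) (use * in auto)
  also have "\<dots> = (\<Sum>i<?n. of_bool (v = vs ! i)) + (\<Sum>i<?n. of_bool (v = vs ! ?s i))"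
    by (rule sum.distrib)
  also have "(\<Sum>i<?n. of_bool (v = vs ! ?s i)) = (\<Sum>i<?n. of_bool (v = vs ! i) :: bit)"
  proof (rule sum.reindex_bij_betw)
    have "inj_on ?s {..<?n}"
      by (auto simp: inj_on_def mod_Suc split: if_splits)
    moreover have "?s ` {..<?n} \<subseteq> {..<?n}" using n by auto
    ultimately show "bij_betw ?s {..<?n} {..<?n}"
      by (simp add: bij_betw_def endo_inj_surj)
  qed
  finally show ?thesis by (simp only: bit_add_self)
qed

lemma even_edge_set_has_cycle:
  assumes G: "finite_mgraph G" and S: "S \<subseteq> edges G" "S \<noteq> {}"
    and even: "\<And>v. v \<in> vertices G \<Longrightarrow> (\<Sum>e\<in>S. inc G v e) = 0"
  shows "\<exists>C\<subseteq>S. is_cycle G C"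
proof (cases "\<exists>e\<in>S. \<exists>v. ends G e = {v}")
  case True
  then obtain e v where ev: "e \<in> S" "ends G e = {v}" by blast
  then obtain x y where "x \<in> vertices G" "ends G e = {x, y}"
    using G S unfolding finite_mgraph_def by blast
  then have "v \<in> vertices G" using ev by auto
  then have "is_cycle G {e}" unfolding is_cycle_def
    using ev S by (intro exI[of _ "[v]"] exI[of _ "[e]"]) auto
  then show ?thesis using ev by blast
next
  case noloop: False
  have finS: "finite S" using G S finite_subset unfolding finite_mgraph_def by blast
  have finV: "finite (vertices G)" using G unfolding finite_mgraph_def by blast
  have ends: "\<exists>u\<in>vertices G. u \<noteq> v \<and> v \<in> vertices G \<and> ends G e = {v, u}"
    if "e \<in> S" "v \<in> ends G e" for e v
  proof -
    obtain x y where "x \<in> vertices G" "y \<in> vertices G" "ends G e = {x, y}"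
      using G S \<open>e \<in> S\<close> unfolding finite_mgraph_def by blast
    moreover have "x \<noteq> y" using calculation noloop that by fastforce
    moreover have "v = x \<or> v = y" using calculation that by auto
    ultimately show ?thesis by (metis insert_commute)
  qed
  have other: "\<exists>e'\<in>S. e' \<noteq> e \<and> v \<in> ends G e'" if e: "e \<in> S" "v \<in> ends G e" for e v
  proof (rule ccontr)
    assume "\<not> ?thesis"
    then have "(\<Sum>e'\<in>S - {e}. inc G v e') = 0" by (intro sum.neutral) (auto simp: inc_def)
    moreover have "inc G v e = 1"
      using ends[OF e] e by (auto simp: inc_def)
    ultimately have "(\<Sum>e'\<in>S. inc G v e') = 1"
      using finS e by (simp add: sum.remove)
    then show False using even ends[OF e] by auto
  qed
  define path where "path vs es \<longleftrightarrow> distinct vs \<and> length vs = Suc (length es) \<and> es \<noteq> [] \<and>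
     set vs \<subseteq> vertices G \<and> set es \<subseteq> S \<and> (\<forall>i<length es. ends G (es ! i) = {vs ! i, vs ! Suc i})"
    for vs es
  obtain e0 where e0: "e0 \<in> S" using S by blast
  obtain x y where "x \<in> vertices G" "y \<in> vertices G" "ends G e0 = {x, y}"
    using G S e0 unfolding finite_mgraph_def by blast
  then have start: "path [x, y] [e0]" using e0 noloop unfolding path_def by auto
  have bound: "length vs \<le> card (vertices G)" if "path vs es" for vs es
    using that finV unfolding path_def by (metis card_mono distinct_card)
  define P where "P m \<longleftrightarrow> (\<exists>vs es. path vs es \<and> length vs = m)" for m
  have P: "\<exists>m. P m" "\<And>m. P m \<Longrightarrow> m \<le> card (vertices G)"
    using start bound unfolding P_def by blast+
  define n where "n = (GREATEST m. P m)"
  have n1: "P n" unfolding n_def using P by (rule GreatestI_ex_nat)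
  have n2: "m \<le> n" if "P m" for m unfolding n_def using that P(2) by (rule Greatest_le_nat)
  from n1 obtain vs es where p: "path vs es" "length vs = n" unfolding P_def by blast
  have ne: "es \<noteq> []" "vs \<noteq> []" and len: "length vs = Suc (length es)"
    and dv: "distinct vs" and sv: "set vs \<subseteq> vertices G" and se: "set es \<subseteq> S"
    and en: "\<And>i. i < length es \<Longrightarrow> ends G (es ! i) = {vs ! i, vs ! Suc i}"
    using p unfolding path_def by auto
  have e: "es ! 0 \<in> S" "vs ! 0 \<in> ends G (es ! 0)"
    using se ne en[of 0] by auto
  then obtain e' where e': "e' \<in> S" "e' \<noteq> es ! 0" "vs ! 0 \<in> ends G e'" using other by blast
  then obtain u where u: "u \<in> vertices G" "u \<noteq> vs ! 0" "ends G e' = {vs ! 0, u}"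
    using ends by blast
  have "u \<in> set vs"
  proof (rule ccontr)
    assume "u \<notin> set vs"
    then have "path (u # vs) (e' # es)"
      using u e' dv len sv se en unfolding path_def
      by (auto simp: nth_Cons insert_commute split: nat.splits)
    then have "P (Suc n)" using p(2) unfolding P_def by fastforce
    then show False using n2 by fastforce
  qed
  then obtain j where j: "j < length vs" "vs ! j = u" by (auto simp: in_set_conv_nth)
  then have j0: "j > 0" "j \<le> length es" using u len by (auto intro: gr0I)
  have eu: "ends G e' = {vs ! j, vs ! 0}" using u j by auto
  have e'n: "e' \<notin> set es"
  proof
    assume "e' \<in> set es"
    then obtain i where i: "i < length es" "es ! i = e'" by (auto simp: in_set_conv_nth)
    then have "vs ! 0 \<in> {vs ! i, vs ! Suc i}" using en e' by blast
    then have "i = 0" using dv i len by (auto simp: nth_eq_iff_index_eq)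
    then show False using i e' by simp
  qed
  have de: "distinct es"
  proof (rule ccontr)
    assume "\<not> distinct es"
    then obtain i k where ik: "i < k" "k < length es" "es ! i = es ! k"
      by (metis distinct_conv_nth linorder_neqE_nat)
    then have "{vs ! i, vs ! Suc i} = {vs ! k, vs ! Suc k}" using en[of i] en[of k] by simp
    then have "vs ! i = vs ! k \<or> vs ! i = vs ! Suc k" by (auto simp: doubleton_eq_iff)
    then show False using dv ik len by (auto simp: nth_eq_iff_index_eq)
  qed
  let ?vs = "take (Suc j) vs" and ?es = "take j es @ [e']"
  have lv: "length ?vs = Suc j" using j by simp
  have "is_cycle G (set ?es)" unfolding is_cycle_def
  proof (intro exI conjI allI impI)
    show "?vs \<noteq> []" "length ?es = length ?vs" using ne j0 j by auto
    show "distinct ?vs" "distinct ?es" using dv de e'n by (auto dest: in_set_takeD)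
    show "set ?vs \<subseteq> vertices G" "set ?es \<subseteq> edges G"
      using sv se e' S by (auto dest: in_set_takeD)
    fix i assume i: "i < length ?vs"
    show "ends G (?es ! i) = {?vs ! i, ?vs ! (Suc i mod length ?vs)}"
    proof (cases "i = j")
      case True
      then show ?thesis using eu j0 lv by (simp add: nth_append)
    next
      case False
      then have "i < j" using i lv by simp
      then show ?thesis using en j0 lv by (simp add: nth_append)
    qed
  qed simp
  moreover have "set ?es \<subseteq> S" using se e' by (auto dest: in_set_takeD)
  ultimately show ?thesis by blast
qed

lemma graphic_imp_binary:
  assumes "graphic M"
  shows "binary M"
proof -
  have M: "is_matroid M" using assms unfolding graphic_def by blast
  obtain G :: "(nat, nat) mgraph" where G: "finite_mgraph G" "isomorphic M (cycle_matroid G)"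
    using assms unfolding graphic_def by blast
  have gr: "ground (cycle_matroid G) = edges G" by (simp add: cycle_matroid_def)
  obtain f where f: "bij_betw f (ground M) (edges G)"
    and iso: "\<And>I. I \<subseteq> ground M \<Longrightarrow> I \<in> indeps M \<longleftrightarrow> f ` I \<in> indeps (cycle_matroid G)"
    using G(2) unfolding isomorphic_def gr by (elim exE conjE) (rule that, assumption, simp)
  obtain xs where xs: "set xs = vertices G"
    using G(1) finite_list[of "vertices G"] unfolding finite_mgraph_def by (elim conjE) blast
  define A where "A = map (\<lambda>v e. inc G v (f e)) xs"
  have finE: "finite (ground M)" and ind: "indeps M \<subseteq> Pow (ground M)"
    using M unfolding is_matroid_def by blast+
  have key: "columns_independent A I \<longleftrightarrow> \<not> (\<exists>C\<subseteq>f ` I. is_cycle G C)" if I: "I \<subseteq> ground M" for I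
  proof -
    have fI: "finite I" using I finE finite_subset by blast
    have inj: "inj_on f I" using inj_on_subset[OF bij_betw_imp_inj_on[OF f] I] .
    show ?thesis
    proof
      assume ci: "columns_independent A I"
      show "\<not> (\<exists>C\<subseteq>f ` I. is_cycle G C)"
      proof
        assume "\<exists>C\<subseteq>f ` I. is_cycle G C"
        then obtain C where C: "C \<subseteq> f ` I" "is_cycle G C" by blast
        let ?c = "\<lambda>e. of_bool (f e \<in> C) :: bit"
        have "(\<Sum>e\<in>I. ?c e * inc G v (f e)) = 0" for v
        proof -
          have "(\<Sum>e\<in>I. ?c e * inc G v (f e)) = (\<Sum>e\<in>f ` I. of_bool (e \<in> C) * inc G v e)"
            using inj by (simp add: sum.reindex)
          also have "\<dots> = (\<Sum>e\<in>C. inc G v e)"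
            using C fI by (intro sum.mono_neutral_cong_right) auto
          finally show ?thesis using cycle_inc_sum[OF C(2)] by simp
        qed
        then have "\<forall>r\<in>set A. (\<Sum>e\<in>I. ?c e * r e) = 0"
          unfolding A_def set_map ball_simps by blast
        then have "\<forall>e\<in>I. ?c e = 0"
          by (rule mp[OF spec[OF ci[unfolded columns_independent_def], of ?c]])
        then have "C = {}" using C(1) by auto
        then show False using C(2) unfolding is_cycle_def by auto
      qed
    next
      assume nc: "\<not> (\<exists>C\<subseteq>f ` I. is_cycle G C)"
      show "columns_independent A I" unfolding columns_independent_def
      proof (intro allI impI, rule ccontr)
        fix c :: "_ \<Rightarrow> bit"
        assume c: "\<forall>r\<in>set A. (\<Sum>e\<in>I. c e * r e) = 0" and nz: "\<not> (\<forall>e\<in>I. c e = 0)"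
        let ?S = "{e\<in>I. c e \<noteq> 0}"
        have S: "f ` ?S \<noteq> {}" "f ` ?S \<subseteq> edges G"
          using nz I f by (auto simp: bij_betw_def)
        have "(\<Sum>e\<in>f ` ?S. inc G v e) = 0" if "v \<in> vertices G" for v
        proof -
          have "(\<Sum>e\<in>f ` ?S. inc G v e) = (\<Sum>e\<in>?S. inc G v (f e))"
            using inj by (subst sum.reindex) (auto simp: inj_on_def)
          also have "\<dots> = (\<Sum>e\<in>I. c e * inc G v (f e))"
            using fI by (intro sum.mono_neutral_cong_left) auto
          also have "\<dots> = 0" using c that unfolding A_def set_map ball_simps xs by blast
          finally show ?thesis .
        qed
        from even_edge_set_has_cycle[OF G(1) S(2,1) this] show False using nc by blast
      qed
    qed
  qed
  have "I \<in> indeps M \<longleftrightarrow> columns_independent A I" if I: "I \<subseteq> ground M" for I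
  proof -
    have "f ` I \<subseteq> edges G" using f I by (auto simp: bij_betw_def)
    then have "f ` I \<in> indeps (cycle_matroid G) \<longleftrightarrow> \<not> (\<exists>C\<subseteq>f ` I. is_cycle G C)"
      by (simp add: cycle_matroid_def)
    then show ?thesis using iso[OF I] key[OF I] by blast
  qed
  then have "indeps M = {S. S \<subseteq> ground M \<and> columns_independent A S}"
    using ind by blast
  then have "represents A M"
    unfolding represents_def column_matroid_def by (cases M) auto
  then show ?thesis using M unfolding binary_def by blast
qed

end

theory Submission
  imports Defs
begin

text \<open>
  A binary matroid is handled through its cycle space, a family of subsets of the ground set closed
  under symmetric difference. Deleting D and contracting C turns it into the family of all z - C with
  z disjoint from D, and splitting by X keeps the cycles that meet X in an even number of elements.
  Hence a minor of B isomorphic to M(K4) after splitting comes from a minor of B whose cycle space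
  contains that of K4 with index at most two; the eight possible extensions are K4 itself, six copies
  of M(Q2) = M(Q3) and one copy of M(Q4). Conversely, suitable three-element sets X split these
  minors into M(K4). It remains to see that a binary matroid is a gammoid iff it has no M(K4)-minor.

  Linkings in a digraph are encoded as partial successor functions: I is linked into T iff some
  injective choice, for every vertex outside T, of the vertex itself or an out-neighbour avoids I.
  Exchanging two such functions along alternating chains shows that gammoids are base-orderable,
  while M(K4) is not. In the other direction, absence of M(K4) forces the fundamental graph of the
  matroid to have no induced cycle of length at least six and no domino. Breadth-first levels
  then yield an isolated vertex, a pendant vertex or a pair of twins (Bandelt and Mulder), that is, a loop,
  a coloop, or a parallel or series pair, and gammoids are closed under the corresponding extensions.
\<close>

section \<open>Cycle spaces of binary matroids\<close>

text \<open>The two obstructions in a fundamental graph come from the two shapes of a spanning tree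
  of K4: a star gives a hexagon, a path gives a domino. A longer induced cycle is the fundamental
  graph of a larger wheel with respect to its spokes.

  The injective choice describing a linking is the Ingleton-Piff duality: the complement of I
  contains a transversal of the closed out-neighbourhoods of the vertices outside T. Two linkings
  thus become two matchings, whose alternating paths supply the exchanges. Base-orderability is
  proved for bases of an arbitrary subset S. A K4-minor with contracted set C and deleted set D is
  therefore refuted in the matroid itself: S is the complement of D, and a basis of C is adjoined to
  two spanning paths.

  The count 1 + 6 + 1 of extensions has a coset explanation: the edge sets of K4 modulo its cycle
  space form a group of order eight, the six edges represent six nonzero cosets, and the three
  perfect matchings share the seventh. Making an edge a cycle turns it into a loop; making a perfect
  matching a cycle makes opposite edges parallel.\<close>

definition cycle_space :: "'a set \<Rightarrow> 'a set set \<Rightarrow> bool" where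
  "cycle_space E Z \<longleftrightarrow>
     finite E \<and> Z \<subseteq> Pow E \<and> {} \<in> Z \<and> (\<forall>x\<in>Z. \<forall>y\<in>Z. sym_diff x y \<in> Z)"

definition acyclic_in :: "'a set set \<Rightarrow> 'a set \<Rightarrow> bool" where
  "acyclic_in Z S \<longleftrightarrow> (\<forall>z\<in>Z. z \<subseteq> S \<longrightarrow> z = {})"

definition space_matroid :: "'a set \<Rightarrow> 'a set set \<Rightarrow> 'a matroid" where
  "space_matroid E Z = Matroid E {S. S \<subseteq> E \<and> acyclic_in Z S}"

definition minor_space :: "'a set set \<Rightarrow> 'a set \<Rightarrow> 'a set \<Rightarrow> 'a set set" where
  "minor_space Z C D = {z - C | z. z \<in> Z \<and> z \<inter> D = {}}"

definition split_space :: "'a set set \<Rightarrow> 'a set \<Rightarrow> 'a set set" where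
  "split_space Z X = {z \<in> Z. even (card (z \<inter> X))}"

text \<open>A vector over GF(2) is determined by its support, so this is the null space of
  \<open>A\<close>, with symmetric difference as addition.\<close>

definition kernel_space :: "'a set \<Rightarrow> 'a gf2_matrix \<Rightarrow> 'a set set" where
  "kernel_space E A = {z. z \<subseteq> E \<and> (\<forall>r\<in>set A. sum r z = 0)}"

lemma ground_space_matroid [simp]: "ground (space_matroid E Z) = E"
  and indeps_space_matroid: "I \<in> indeps (space_matroid E Z) \<longleftrightarrow> I \<subseteq> E \<and> acyclic_in Z I"
  by (simp_all add: space_matroid_def)

lemma acyclic_inD: "acyclic_in Z S \<Longrightarrow> z \<in> Z \<Longrightarrow> z \<subseteq> S \<Longrightarrow> z = {}"
  unfolding acyclic_in_def by blast

lemma acyclic_in_mono: "acyclic_in Z S \<Longrightarrow> T \<subseteq> S \<Longrightarrow> acyclic_in Z T"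
  unfolding acyclic_in_def by blast

lemma cycle_spaceD:
  assumes "cycle_space E Z"
  shows "finite E" "{} \<in> Z" "z \<in> Z \<Longrightarrow> z \<subseteq> E" "x \<in> Z \<Longrightarrow> y \<in> Z \<Longrightarrow> sym_diff x y \<in> Z"
    "S \<subseteq> E \<Longrightarrow> finite S" "z \<in> Z \<Longrightarrow> finite z"
  using assms unfolding cycle_space_def by (auto intro: finite_subset)

section \<open>Null spaces of binary matrices and the effect of an appended row\<close>

lemma sum_sym_diff_bit:
  fixes r :: "'a \<Rightarrow> bit"
  assumes "finite x" "finite y"
  shows "sum r (sym_diff x y) = sum r x + sum r y"
proof -
  have a: "sum r x = sum r (x - y) + sum r (x \<inter> y)"
    using assms by (metis sum.Int_Diff add.commute)
  have b: "sum r y = sum r (y - x) + sum r (x \<inter> y)"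
    using assms by (metis inf_commute sum.Int_Diff add.commute)
  have "sum r (sym_diff x y) = sum r (x - y) + sum r (y - x)"
    using assms by (intro sum.union_disjoint) auto
  moreover have "(p + q) + (p' + q) = p + p'" for p p' q :: bit
    by (cases p; cases q; cases p') auto
  ultimately show ?thesis unfolding a b by presburger
qed

lemma cycle_space_kernel: "finite E \<Longrightarrow> cycle_space E (kernel_space E A)"
  unfolding cycle_space_def kernel_space_def
  by (auto simp: sum_sym_diff_bit[OF finite_subset finite_subset])

lemma columns_independent_iff:
  assumes "finite S" "S \<subseteq> E"
  shows "columns_independent A S \<longleftrightarrow> acyclic_in (kernel_space E A) S"
proof
  assume ci: "columns_independent A S"
  show "acyclic_in (kernel_space E A) S" unfolding acyclic_in_def
  proof (intro ballI impI)
    fix z assume z: "z \<in> kernel_space E A" "z \<subseteq> S"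
    have "(\<Sum>e\<in>S. of_bool (e \<in> z) * r e) = sum r z" for r :: "'a \<Rightarrow> bit"
      using z assms by (intro sum.mono_neutral_cong_right) auto
    then have "\<forall>r\<in>set A. (\<Sum>e\<in>S. of_bool (e \<in> z) * r e) = 0"
      using z by (simp add: kernel_space_def)
    then have "\<forall>e\<in>S. of_bool (e \<in> z) = (0::bit)"
      by (rule mp[OF spec[OF ci[unfolded columns_independent_def], of "\<lambda>e. of_bool (e \<in> z)"]])
    then show "z = {}" using z by auto
  qed
next
  assume ac: "acyclic_in (kernel_space E A) S"
  show "columns_independent A S" unfolding columns_independent_def
  proof (intro allI impI)
    fix c :: "'a \<Rightarrow> bit" assume c: "\<forall>r\<in>set A. (\<Sum>e\<in>S. c e * r e) = 0"
    let ?z = "{e\<in>S. c e \<noteq> 0}"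
    have "(\<Sum>e\<in>S. c e * r e) = sum r ?z" for r
      using assms by (intro sum.mono_neutral_cong_right) auto
    then have "?z \<in> kernel_space E A" using c assms by (auto simp: kernel_space_def)
    then have "?z = {}" by (rule acyclic_inD[OF ac]) auto
    then show "\<forall>e\<in>S. c e = 0" by blast
  qed
qed

lemma column_matroid_eq_space_matroid:
  assumes "finite E"
  shows "column_matroid E A = space_matroid E (kernel_space E A)"
  unfolding column_matroid_def space_matroid_def
  using assms columns_independent_iff by (metis (lifting) finite_subset)

lemma kernel_space_append_row:
  assumes "finite E"
  shows "kernel_space E (append_row A X) = split_space (kernel_space E A) X"
proof -
  have "(\<Sum>e\<in>z. if e \<in> X then 1 else 0) = (0::bit) \<longleftrightarrow> even (card (z \<inter> X))" if "z \<subseteq> E" for z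
  proof -
    have "finite z" using that assms finite_subset by blast
    then have "(\<Sum>e\<in>z. if e \<in> X then 1 else 0) = (of_nat (card (z \<inter> X)) :: bit)"
      by (simp add: sum.If_cases)
    moreover have "(of_nat n :: bit) = 0 \<longleftrightarrow> even n" for n
      by (induction n) auto
    ultimately show ?thesis by simp
  qed
  then show ?thesis
    unfolding kernel_space_def split_space_def append_row_def by auto
qed

lemma splitting_matroid_eq:
  assumes "finite (ground B)"
  shows "splitting_matroid B A X = space_matroid (ground B) (split_space (kernel_space (ground B) A) X)"
  unfolding splitting_matroid_def
  using assms by (simp add: column_matroid_eq_space_matroid kernel_space_append_row)

lemma odd_card_sym_diff:
  assumes "finite A" "finite B"
  shows "odd (card (sym_diff A B)) \<longleftrightarrow> odd (card A) \<noteq> odd (card B)"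
proof -
  have "card (sym_diff A B) = card (A - B) + card (B - A)"
    using assms by (intro card_Un_disjoint) auto
  moreover have "card A = card (A - B) + card (A \<inter> B)" "card B = card (B - A) + card (A \<inter> B)"
    using assms by (auto simp: card_Diff_subset_Int card_mono Int_commute)
  ultimately show ?thesis by presburger
qed

lemma cycle_space_split:
  assumes Z: "cycle_space E Z"
  shows "cycle_space E (split_space Z X)"
proof -
  have "even (card (sym_diff x y \<inter> X))"
    if "x \<in> Z" "y \<in> Z" "even (card (x \<inter> X))" "even (card (y \<inter> X))" for x y
  proof -
    have "sym_diff x y \<inter> X = sym_diff (x \<inter> X) (y \<inter> X)" by auto
    moreover have "finite (x \<inter> X)" "finite (y \<inter> X)" using that cycle_spaceD(6)[OF Z] by auto
    ultimately show ?thesis using odd_card_sym_diff[of "x \<inter> X" "y \<inter> X"] that(3,4) by simp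
  qed
  then show ?thesis using assms unfolding cycle_space_def split_space_def by auto
qed

text \<open>Pigeonhole takes the place of a dimension count. If no element of \<open>J - I\<close>
  can be added, each one closes a cycle with \<open>I\<close>, and sums of these realise every
  subset \<open>K\<close> of \<open>J - I\<close> as the trace of a cycle. There are more such
  \<open>K\<close> than subsets of \<open>I - J\<close>, so two of the cycles agree on
  \<open>I - J\<close>; their sum is a nonempty cycle inside \<open>J\<close>.\<close>

lemma acyclic_in_augment:
  assumes Z: "cycle_space E Z" and I: "I \<subseteq> E" "acyclic_in Z I" and J: "J \<subseteq> E" "acyclic_in Z J"
    and less: "card I < card J"
  shows "\<exists>x\<in>J - I. acyclic_in Z (insert x I)"
proof (rule ccontr)
  assume no: "\<not> ?thesis"
  have sd: "\<And>x y. x \<in> Z \<Longrightarrow> y \<in> Z \<Longrightarrow> sym_diff x y \<in> Z" and e0: "{} \<in> Z"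
    using Z unfolding cycle_space_def by blast+
  have fin: "finite I" "finite J" using I J cycle_spaceD(5)[OF Z] by auto
  have circ: "\<exists>z\<in>Z. z \<subseteq> insert x I \<and> x \<in> z" if "x \<in> J - I" for x
  proof -
    have "\<not> acyclic_in Z (insert x I)" using no that by auto
    then obtain z where z: "z \<in> Z" "z \<subseteq> insert x I" "z \<noteq> {}" unfolding acyclic_in_def by auto
    then have "x \<in> z" using acyclic_inD[OF I(2), of z] by auto
    then show ?thesis using z by auto
  qed
  have "\<exists>z\<in>Z. z \<subseteq> I \<union> K \<and> z \<inter> (J - I) = K" if "K \<subseteq> J - I" for K
  proof -
    have "finite K" using that fin by (meson finite_Diff finite_subset)
    then show ?thesis using that
    proof (induction K rule: finite_induct)
      case empty
      then show ?case using e0 by blast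
    next
      case (insert x K)
      then obtain z where z: "z \<in> Z" "z \<subseteq> I \<union> K" "z \<inter> (J - I) = K" by blast
      obtain y where y: "y \<in> Z" "y \<subseteq> insert x I" "x \<in> y" 
        using circ[of x] insert.prems by auto
      have "y \<inter> (J - I) = {x}" "x \<notin> K" using y insert by auto
      moreover have "sym_diff z y \<inter> (J - I) = sym_diff (z \<inter> (J - I)) (y \<inter> (J - I))" by blast
      ultimately have "sym_diff z y \<inter> (J - I) = insert x K" using z(3) by auto
      moreover have "sym_diff z y \<subseteq> I \<union> insert x K" using z(2) y(2) by auto
      ultimately show ?case using sd[OF z(1) y(1)] by (intro bexI[of _ "sym_diff z y"] conjI)
    qed
  qed
  then obtain f where f: "\<And>K. K \<subseteq> J - I \<Longrightarrow> f K \<in> Z \<and> f K \<subseteq> I \<union> K \<and> f K \<inter> (J - I) = K"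
    by metis
  let ?g = "\<lambda>K. f K \<inter> (I - J)"
  have "card (I - J) < card (J - I)"
    using less fin by (simp add: card_less_sym_Diff)
  then have "card (Pow (I - J)) < card (Pow (J - I))" using fin by (simp add: card_Pow)
  moreover have "?g ` Pow (J - I) \<subseteq> Pow (I - J)" by blast
  ultimately have "\<not> inj_on ?g (Pow (J - I))"
    using fin by (meson card_inj_on_le finite_Diff finite_Pow_iff leD)
  then obtain K L where KL: "K \<subseteq> J - I" "L \<subseteq> J - I" "K \<noteq> L" "?g K = ?g L"
    unfolding inj_on_def by blast
  let ?z = "sym_diff (f K) (f L)"
  have "?z \<in> Z" using sd f[OF KL(1)] f[OF KL(2)] by simp
  moreover have "?z \<subseteq> J"
  proof
    fix e assume e: "e \<in> ?z"
    then have "e \<in> I \<or> e \<in> J" using f[OF KL(1)] f[OF KL(2)] KL(1,2) by auto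
    moreover have "e \<notin> I - J" using e KL(4) by auto
    ultimately show "e \<in> J" by auto
  qed
  moreover have "f K \<noteq> f L" using f[OF KL(1)] f[OF KL(2)] KL(3) by metis
  then have "?z \<noteq> {}" by auto
  ultimately show False using acyclic_inD[OF J(2)] by blast
qed

lemma is_matroid_space_matroid:
  assumes "cycle_space E Z"
  shows "is_matroid (space_matroid E Z)"
  unfolding is_matroid_def indeps_space_matroid ground_space_matroid
proof (intro conjI allI impI)
  show "finite E" using assms unfolding cycle_space_def by blast
  show "indeps (space_matroid E Z) \<subseteq> Pow E" by (auto simp: space_matroid_def)
  show "{} \<subseteq> E" "acyclic_in Z {}" by (simp_all add: acyclic_in_def)
next
  fix I J assume "I \<subseteq> E \<and> acyclic_in Z I" "J \<subseteq> E \<and> acyclic_in Z J" "card I < card J"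
  then show "\<exists>x\<in>J - I. insert x I \<subseteq> E \<and> acyclic_in Z (insert x I)"
    using acyclic_in_augment[OF assms, of I J] by auto
next
  fix I J assume "I \<subseteq> E \<and> acyclic_in Z I" "J \<subseteq> I"
  then show "J \<subseteq> E" "acyclic_in Z J" by (auto intro: acyclic_in_mono)
qed

lemma binary_splitting_matroid:
  assumes "finite (ground B)"
  shows "binary (splitting_matroid B A X)"
  unfolding binary_def
proof
  show "is_matroid (splitting_matroid B A X)"
    unfolding splitting_matroid_eq[OF assms]
    by (intro is_matroid_space_matroid cycle_space_split cycle_space_kernel assms)
  show "\<exists>A'. represents A' (splitting_matroid B A X)"
    unfolding represents_def splitting_matroid_def by (auto simp: column_matroid_def)
qed

section \<open>Bases, contraction and deletion\<close>

lemma is_basis_of_space_matroid_iff: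
  "is_basis_of (space_matroid E Z) J S \<longleftrightarrow>
     J \<subseteq> E \<and> J \<subseteq> S \<and> acyclic_in Z J \<and> (\<forall>x\<in>S \<inter> E - J. \<not> acyclic_in Z (insert x J))"
  (is "?L \<longleftrightarrow> ?R")
proof
  assume ?L
  then have L: "J \<subseteq> E" "acyclic_in Z J" "J \<subseteq> S"
    "\<And>K. K \<subseteq> E \<Longrightarrow> acyclic_in Z K \<Longrightarrow> K \<subseteq> S \<Longrightarrow> J \<subseteq> K \<Longrightarrow> K = J"
    unfolding is_basis_of_def indeps_space_matroid by auto
  have "\<not> acyclic_in Z (insert x J)" if "x \<in> S \<inter> E - J" for x
    using L(4)[of "insert x J"] L(1,3) that by auto
  then show ?R using L by blast
next
  assume R: ?R
  have "K = J" if K: "K \<subseteq> E" "acyclic_in Z K" "K \<subseteq> S" "J \<subseteq> K" for K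
  proof (rule ccontr)
    assume "K \<noteq> J"
    then obtain x where "x \<in> K - J" using K by blast
    then show False using R K acyclic_in_mono[OF K(2), of "insert x J"] by blast
  qed
  then show ?L using R unfolding is_basis_of_def indeps_space_matroid by blast
qed

lemma ex_maximal_acyclic:
  assumes "cycle_space E Z" "C \<subseteq> E"
  obtains J where "J \<subseteq> C" "acyclic_in Z J" "\<And>x. x \<in> C - J \<Longrightarrow> \<exists>z\<in>Z. z \<subseteq> insert x J \<and> x \<in> z"
proof -
  have fin: "finite C" using assms cycle_spaceD(5) by auto
  let ?F = "{J. J \<subseteq> C \<and> acyclic_in Z J}"
  have "finite ?F" using fin by simp
  moreover have "{} \<in> ?F" by (simp add: acyclic_in_def)
  ultimately obtain J where J: "J \<in> ?F" "\<And>K. K \<in> ?F \<Longrightarrow> J \<subseteq> K \<Longrightarrow> J = K"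
    using finite_has_maximal2[of ?F "{}"] by (metis (no_types, lifting))
  have "\<exists>z\<in>Z. z \<subseteq> insert x J \<and> x \<in> z" if "x \<in> C - J" for x
  proof -
    have "\<not> acyclic_in Z (insert x J)" using J(2)[of "insert x J"] J(1) that by blast
    then obtain z where "z \<in> Z" "z \<subseteq> insert x J" "z \<noteq> {}" unfolding acyclic_in_def by blast
    moreover have "x \<in> z" using calculation J(1) unfolding acyclic_in_def by blast
    ultimately show ?thesis by blast
  qed
  then show ?thesis using that J(1) by blast
qed

lemma cycle_space_minor:
  assumes "cycle_space E Z"
  shows "cycle_space (E - C - D) (minor_space Z C D)"
  unfolding cycle_space_def
proof (intro conjI ballI)
  note Z = cycle_spaceD[OF assms]
  show "finite (E - C - D)" "minor_space Z C D \<subseteq> Pow (E - C - D)" "{} \<in> minor_space Z C D"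
    using Z(1,2,3) by (auto simp: minor_space_def)
  fix x y assume "x \<in> minor_space Z C D" "y \<in> minor_space Z C D"
  then obtain x' y' where "x = x' - C" "y = y' - C" "x' \<in> Z" "y' \<in> Z" "x' \<inter> D = {}" "y' \<inter> D = {}"
    unfolding minor_space_def by blast
  then have "sym_diff x y = sym_diff x' y' - C" "sym_diff x' y' \<in> Z" "sym_diff x' y' \<inter> D = {}"
    using Z(4) by auto
  then show "sym_diff x y \<in> minor_space Z C D"
    unfolding minor_space_def by (intro CollectI exI[of _ "sym_diff x' y'"] conjI)
qed

text \<open>For \<open>x\<close> in \<open>C - J\<close> there is a cycle through \<open>x\<close>
  in \<open>insert x J\<close>, hence inside \<open>C\<close>. Adding it removes \<open>x\<close>
  from a given cycle without changing that cycle outside \<open>C\<close>. In this way the part of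
  any cycle inside \<open>C\<close> can be pushed into \<open>J\<close> while its trace outside
  \<open>C\<close> is kept.\<close>

lemma acyclic_in_Un_basis_iff:
  assumes Z: "cycle_space E Z"
    and J: "J \<subseteq> C" "acyclic_in Z J" "\<And>x. x \<in> C - J \<Longrightarrow> \<exists>z\<in>Z. z \<subseteq> insert x J \<and> x \<in> z"
    and I: "I \<inter> C = {}"
  shows "acyclic_in Z (I \<union> J) \<longleftrightarrow> acyclic_in (minor_space Z C {}) I"
proof
  assume ac: "acyclic_in Z (I \<union> J)"
  have sd: "\<And>x y. x \<in> Z \<Longrightarrow> y \<in> Z \<Longrightarrow> sym_diff x y \<in> Z"
    using Z unfolding cycle_space_def by blast
  have reduce: "\<exists>z'\<in>Z. z' - C = z - C \<and> z' \<inter> C - J = z \<inter> C - J - K"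
    if "finite K" "K \<subseteq> z \<inter> C - J" "z \<in> Z" for K z
    using that
  proof (induction K rule: finite_induct)
    case empty
    then show ?case by auto
  next
    case (insert x K)
    then obtain y where y: "y \<in> Z" "y - C = z - C" "y \<inter> C - J = z \<inter> C - J - K" by auto
    obtain c where c: "c \<in> Z" "c \<subseteq> insert x J" "x \<in> c" using J(3)[of x] insert.prems by auto
    have "x \<in> y \<inter> C - J" using insert y(3) by auto
    then have c': "c \<subseteq> C" "c - J = {x}" "x \<in> y" using c J(1) by auto
    have "sym_diff y c - C = y - C" using c'(1) by blast
    moreover have "e \<in> sym_diff y c \<inter> C - J \<longleftrightarrow> e \<in> (y \<inter> C - J) - {x}" for e
      using c' by (cases "e \<in> J"; cases "e = x") auto
    then have "sym_diff y c \<inter> C - J = (y \<inter> C - J) - {x}" by (intro set_eqI)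
    ultimately have "sym_diff y c - C = z - C" "sym_diff y c \<inter> C - J = z \<inter> C - J - insert x K"
      using y(2,3) by auto
    then show ?case using sd[OF y(1) c(1)] by (intro bexI[of _ "sym_diff y c"] conjI)
  qed
  show "acyclic_in (minor_space Z C {}) I"
    unfolding acyclic_in_def
  proof (intro ballI impI)
    fix t assume "t \<in> minor_space Z C {}" and tI: "t \<subseteq> I"
    then obtain z where t: "t = z - C" and z: "z \<in> Z" "z - C \<subseteq> I" unfolding minor_space_def by blast
    have "finite (z \<inter> C - J)" using z cycle_spaceD(6)[OF Z] by auto
    from reduce[OF this subset_refl z(1)] obtain z' where z': "z' \<in> Z" "z' - C = z - C" "z' \<inter> C - J = {}"
      by auto
    then have "z' \<subseteq> I \<union> J" using z by blast
    then have "z' = {}" using ac z' unfolding acyclic_in_def by blast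
    then show "t = {}" using z'(2) t by simp
  qed
next
  assume ac: "acyclic_in (minor_space Z C {}) I"
  show "acyclic_in Z (I \<union> J)" unfolding acyclic_in_def
  proof (intro ballI impI)
    fix z assume z: "z \<in> Z" "z \<subseteq> I \<union> J"
    then have "z - C \<in> minor_space Z C {}" "z - C \<subseteq> I"
      using J(1) unfolding minor_space_def by auto
    then have "z - C = {}" using ac unfolding acyclic_in_def by blast
    then have "z \<subseteq> J" using z I by blast
    then show "z = {}" using z J(2) unfolding acyclic_in_def by blast
  qed
qed

text \<open>A cycle \<open>z\<close> with \<open>z - C\<close> inside \<open>I\<close> consists of
  elements of \<open>I\<close> and \<open>C\<close>, so it avoids \<open>D\<close> by
  itself.\<close>

lemma acyclic_in_minor_space_delete:
  assumes "I \<inter> D = {}" "C \<inter> D = {}"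
  shows "acyclic_in (minor_space Z C D) I \<longleftrightarrow> acyclic_in (minor_space Z C {}) I"
proof -
  have "t \<in> minor_space Z C D \<longleftrightarrow> t \<in> minor_space Z C {}" if "t \<subseteq> I" for t
  proof
    assume "t \<in> minor_space Z C {}"
    then obtain z where z: "z \<in> Z" "t = z - C" unfolding minor_space_def by blast
    then have "z \<inter> D = {}" using that assms by blast
    then show "t \<in> minor_space Z C D" using z unfolding minor_space_def by blast
  qed (auto simp: minor_space_def)
  then show ?thesis unfolding acyclic_in_def by blast
qed

lemma deletion_contraction_space_matroid:
  assumes Z: "cycle_space E Z" and C: "C \<subseteq> E" "C \<inter> D = {}"
  shows "deletion (contraction (space_matroid E Z) C) D = space_matroid (E - C - D) (minor_space Z C D)"
proof -
  have basis: "(\<exists>J. is_basis_of (space_matroid E Z) J C \<and> I \<union> J \<in> indeps (space_matroid E Z))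
     \<longleftrightarrow> acyclic_in (minor_space Z C {}) I" if I: "I \<subseteq> E - C" for I
  proof
    assume "\<exists>J. is_basis_of (space_matroid E Z) J C \<and> I \<union> J \<in> indeps (space_matroid E Z)"
    then obtain J where J: "J \<subseteq> C" "acyclic_in Z J" "acyclic_in Z (I \<union> J)"
      "\<And>x. x \<in> C - J \<Longrightarrow> \<not> acyclic_in Z (insert x J)"
      using C unfolding is_basis_of_space_matroid_iff indeps_space_matroid by blast
    have "\<exists>z\<in>Z. z \<subseteq> insert x J \<and> x \<in> z" if "x \<in> C - J" for x
      using J(4)[OF that] J(2) unfolding acyclic_in_def by blast
    then show "acyclic_in (minor_space Z C {}) I"
      using acyclic_in_Un_basis_iff[OF Z J(1,2)] J(3) I by blast
  next
    assume ac: "acyclic_in (minor_space Z C {}) I"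
    \<comment> \<open>The definition of contraction asks for one suitable basis of \<open>C\<close>;
      any maximal acyclic \<open>J\<close> serves, because \<open>acyclic_in_Un_basis_iff\<close>
      gives the same criterion for all of them.\<close>
    obtain J where J: "J \<subseteq> C" "acyclic_in Z J" "\<And>x. x \<in> C - J \<Longrightarrow> \<exists>z\<in>Z. z \<subseteq> insert x J \<and> x \<in> z"
      using ex_maximal_acyclic[OF Z C(1)] by blast
    have "acyclic_in Z (I \<union> J)" using acyclic_in_Un_basis_iff[OF Z J] ac I by blast
    moreover have "\<forall>x\<in>C \<inter> E - J. \<not> acyclic_in Z (insert x J)"
      using J(3) unfolding acyclic_in_def by blast
    ultimately show "\<exists>J. is_basis_of (space_matroid E Z) J C \<and> I \<union> J \<in> indeps (space_matroid E Z)"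
      using J(1,2) C I unfolding is_basis_of_space_matroid_iff indeps_space_matroid
      by (intro exI[of _ J] conjI) auto
  qed
  have "{I \<in> {I. I \<subseteq> E - C \<and> (\<exists>J. is_basis_of (space_matroid E Z) J C \<and> I \<union> J \<in> indeps (space_matroid E Z))}.
      I \<subseteq> E - C - D} = {I. I \<subseteq> E - C - D \<and> acyclic_in (minor_space Z C D) I}"
    (is "?L = ?R")
  proof (intro set_eqI)
    fix I show "I \<in> ?L \<longleftrightarrow> I \<in> ?R"
    proof (cases "I \<subseteq> E - C - D")
      case True
      then have "I \<subseteq> E - C" "I \<inter> D = {}" by auto
      then show ?thesis using basis acyclic_in_minor_space_delete[OF _ C(2)] True by simp
    qed simp
  qed
  then show ?thesis
    unfolding deletion_def contraction_def restriction_def by (simp add: space_matroid_def)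
qed

section \<open>Isomorphism of binary matroids\<close>

text \<open>A binary matroid determines its cycle space: the minimal nonempty cycles are its
  circuits, hence common to both families, and any cycle becomes smaller when a circuit inside it is
  split off.\<close>

lemma cycle_space_subset_if_same_acyclic:
  assumes Z: "cycle_space E Z" and Y: "cycle_space E Y"
    and same: "\<And>I. I \<subseteq> E \<Longrightarrow> acyclic_in Z I \<longleftrightarrow> acyclic_in Y I"
  shows "Z \<subseteq> Y"
proof
  fix z assume "z \<in> Z"
  then show "z \<in> Y"
  proof (induction "card z" arbitrary: z rule: less_induct)
    case less
    have zE: "z \<subseteq> E" and fz: "finite z"
      using less.prems cycle_spaceD(3,6)[OF Z] by auto
    show ?case
    proof (cases "z = {}")
      case True
      then show ?thesis using Y unfolding cycle_space_def by blast
    next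
      case False
      let ?F = "{c. c \<subseteq> z \<and> c \<noteq> {} \<and> c \<in> Z}"
      have "finite ?F" "z \<in> ?F" using fz less.prems False by auto
      then obtain c where c: "c \<in> ?F" "\<And>d. d \<in> ?F \<Longrightarrow> d \<subseteq> c \<Longrightarrow> d = c"
        using finite_has_minimal2[of ?F z] by (metis (no_types, lifting))
      \<comment> \<open>Being dependent for both spaces, \<open>c\<close> contains a nonempty
        \<open>y\<close> of \<open>Y\<close>, and \<open>y\<close> contains a nonempty
        \<open>x\<close> of \<open>Z\<close>. Minimality of \<open>c\<close> gives
        \<open>x = c\<close>, so \<open>c = y\<close> belongs to \<open>Y\<close>.\<close>
      have "\<not> acyclic_in Y c" using same[of c] c(1) zE unfolding acyclic_in_def by blast
      then obtain y where y: "y \<in> Y" "y \<subseteq> c" "y \<noteq> {}" unfolding acyclic_in_def by blast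
      have "\<not> acyclic_in Z y" using same[of y] y c(1) zE unfolding acyclic_in_def by blast
      then obtain x where x: "x \<in> Z" "x \<subseteq> y" "x \<noteq> {}" unfolding acyclic_in_def by blast
      have "x \<in> ?F" using x y(2) c(1) by auto
      then have "x = c" using c(2)[of x] x(2) y(2) by auto
      then have cY: "c \<in> Y" using x y by auto
      have "sym_diff z c \<in> Z" using cycle_spaceD(4)[OF Z] c(1) less.prems by auto
      moreover have "sym_diff z c = z - c" using c(1) by auto
      moreover have "card (z - c) < card z" using c(1) fz by (intro psubset_card_mono) auto
      ultimately have "z - c \<in> Y" using less.hyps by simp
      then have "sym_diff (z - c) c \<in> Y" using cycle_spaceD(4)[OF Y _ cY] by blast
      moreover have "sym_diff (z - c) c = z" using c(1) by auto
      ultimately show ?thesis by simp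
    qed
  qed
qed

lemma isomorphic_space_matroid_iff:
  assumes Z: "cycle_space E Z" and Y: "cycle_space F Y"
  shows "isomorphic (space_matroid E Z) (space_matroid F Y) \<longleftrightarrow>
    (\<exists>f. bij_betw f E F \<and> (\<forall>z. z \<subseteq> E \<longrightarrow> (z \<in> Z \<longleftrightarrow> f ` z \<in> Y)))"
proof -
  have "(\<forall>I. I \<subseteq> E \<longrightarrow> (I \<in> indeps (space_matroid E Z) \<longleftrightarrow> f ` I \<in> indeps (space_matroid F Y))) \<longleftrightarrow>
     (\<forall>z. z \<subseteq> E \<longrightarrow> (z \<in> Z \<longleftrightarrow> f ` z \<in> Y))" if f: "bij_betw f E F" for f
  proof -
    \<comment> \<open>Pulling \<open>Y\<close> back along \<open>f\<close> puts both spaces on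
      \<open>E\<close>, where equal independent sets mean equal spaces.\<close>
    let ?Y = "{z. z \<subseteq> E \<and> f ` z \<in> Y}"
    have inj: "inj_on f E" and im: "f ` E = F" using f by (auto simp: bij_betw_def)
    have Yf: "Y \<subseteq> Pow F" "{} \<in> Y" "\<And>x y. x \<in> Y \<Longrightarrow> y \<in> Y \<Longrightarrow> sym_diff x y \<in> Y"
      using Y unfolding cycle_space_def by blast+
    have Y': "cycle_space E ?Y"
      unfolding cycle_space_def
    proof (intro conjI ballI)
      show "finite E" using Z unfolding cycle_space_def by blast
      show "{} \<in> ?Y" using Yf by simp
      fix x y assume xy: "x \<in> ?Y" "y \<in> ?Y"
      then have "f ` (x - y) = f ` x - f ` y" "f ` (y - x) = f ` y - f ` x"
        by (auto intro!: inj_on_image_set_diff[OF inj])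
      then have "f ` sym_diff x y = sym_diff (f ` x) (f ` y)" by (simp add: image_Un)
      moreover have "sym_diff (f ` x) (f ` y) \<in> Y" using xy by (intro Yf(3)) simp_all
      moreover have "sym_diff x y \<subseteq> E" using xy by auto
      ultimately show "sym_diff x y \<in> ?Y" by simp
    qed auto
    have ac: "acyclic_in Y (f ` I) \<longleftrightarrow> acyclic_in ?Y I" if "I \<subseteq> E" for I
    proof
      assume "acyclic_in Y (f ` I)"
      then show "acyclic_in ?Y I" 
        unfolding acyclic_in_def by (metis (no_types, lifting) image_is_empty image_mono mem_Collect_eq)
    next
      assume a: "acyclic_in ?Y I"
      show "acyclic_in Y (f ` I)" unfolding acyclic_in_def
      proof (intro ballI impI)
        fix y assume y: "y \<in> Y" "y \<subseteq> f ` I"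
        then obtain z where z: "z \<subseteq> I" "y = f ` z" by (auto simp: subset_image_iff)
        then have "z \<in> ?Y" using y that by auto
        then show "y = {}" using a z unfolding acyclic_in_def by auto
      qed
    qed
    have fI: "f ` I \<subseteq> F" if "I \<subseteq> E" for I using that im by blast
    have "(\<forall>I. I \<subseteq> E \<longrightarrow> (I \<in> indeps (space_matroid E Z) \<longleftrightarrow> f ` I \<in> indeps (space_matroid F Y))) \<longleftrightarrow>
      (\<forall>I. I \<subseteq> E \<longrightarrow> (acyclic_in Z I \<longleftrightarrow> acyclic_in ?Y I))"
      unfolding indeps_space_matroid using ac fI by (metis (no_types, lifting))
    also have "\<dots> \<longleftrightarrow> Z = ?Y"
      using cycle_space_subset_if_same_acyclic[OF Z Y'] cycle_space_subset_if_same_acyclic[OF Y' Z] by blast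
    also have "\<dots> \<longleftrightarrow> (\<forall>z. z \<subseteq> E \<longrightarrow> (z \<in> Z \<longleftrightarrow> f ` z \<in> Y))"
      unfolding set_eq_iff mem_Collect_eq using cycle_spaceD(3)[OF Z] by meson
    finally show ?thesis .
  qed
  then show ?thesis unfolding isomorphic_def ground_space_matroid
    by (intro ex_cong1 conj_cong refl)
qed

section \<open>Linkings and base-orderability of gammoids\<close>

text \<open>The intended \<open>f v\<close> is the vertex after \<open>v\<close> on its path, or
  \<open>v\<close> itself if no path uses \<open>v\<close>. Paths end in \<open>T\<close>, where
  \<open>f\<close> is unconstrained, and start in \<open>I\<close>, which \<open>f\<close> has to
  miss.\<close>

definition linkable :: "'v set \<Rightarrow> 'v set \<Rightarrow> ('v \<times> 'v) set \<Rightarrow> 'v set \<Rightarrow> bool" where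
  "linkable V T R I \<longleftrightarrow> I \<subseteq> V \<and>
     (\<exists>f. inj_on f (V - T) \<and> (\<forall>v\<in>V - T. f v \<in> V - I \<and> (f v = v \<or> (v, f v) \<in> R)))"

lemma linkable_mono: "linkable V T R I \<Longrightarrow> J \<subseteq> I \<Longrightarrow> linkable V T R J"
  unfolding linkable_def by (meson Diff_iff subset_trans subsetD)

lemma set_vwalk_arcs: "set (vwalk_arcs p) = {(p ! k, p ! Suc k) | k. Suc k < length p}"
proof (induction p rule: vwalk_arcs.induct)
  case (3 x y xs)
  have "{(p ! k, p ! Suc k) | k. Suc k < length p} =
      insert (x, y) {((y # xs) ! k, (y # xs) ! Suc k) | k. Suc k < length (y # xs)}"
    if "p = x # y # xs" for p
  proof (intro set_eqI iffI)
    fix e assume "e \<in> {(p ! k, p ! Suc k) | k. Suc k < length p}"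
    then obtain k where k: "Suc k < length p" "e = (p ! k, p ! Suc k)" by blast
    then show "e \<in> insert (x, y) {((y # xs) ! k, (y # xs) ! Suc k) | k. Suc k < length (y # xs)}"
      using that by (cases k) auto
  next
    fix e assume "e \<in> insert (x, y) {((y # xs) ! k, (y # xs) ! Suc k) | k. Suc k < length (y # xs)}"
    then consider "e = (x, y)" | k where "Suc k < length (y # xs)" "e = ((y # xs) ! k, (y # xs) ! Suc k)"
      by blast
    then show "e \<in> {(p ! k, p ! Suc k) | k. Suc k < length p}"
    proof cases
      case 1
      then show ?thesis using that by (intro CollectI exI[of _ 0]) auto
    next
      case (2 k)
      then show ?thesis using that by (intro CollectI exI[of _ "Suc k"]) auto
    qed
  qed
  then show ?case using 3 by simp
qed auto

text \<open>A vertex with a successor on some path moves to it, all others stay. Disjointness of the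
  paths makes this injective, and the first vertex of a path is nobody's successor, so
  \<open>I\<close> is missed.\<close>

lemma linked_into_imp_linkable:
  assumes "linked_into D I T" "I \<subseteq> verts D"
  shows "linkable (verts D) T (arcs_ends D) I"
proof -
  obtain P where P: "\<And>v. v \<in> I \<Longrightarrow> vpath (P v) D \<and> hd (P v) = v \<and> last (P v) \<in> T"
    and disj: "\<And>v w. v \<in> I \<Longrightarrow> w \<in> I \<Longrightarrow> v \<noteq> w \<Longrightarrow> set (P v) \<inter> set (P w) = {}"
    using assms unfolding linked_into_def by metis
  have dist: "distinct (P u)" "P u \<noteq> []" "set (P u) \<subseteq> verts D" "set (vwalk_arcs (P u)) \<subseteq> arcs_ends D"
    if "u \<in> I" for u using P[OF that] unfolding vpath_def vwalk_def by auto
  define N where "N x y \<longleftrightarrow> (\<exists>u\<in>I. (x, y) \<in> set (vwalk_arcs (P u)))" for x y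
  have same: "u = u'" if "u \<in> I" "u' \<in> I" "x \<in> set (P u)" "x \<in> set (P u')" for u u' x
    using disj that by blast
  have inP: "x \<in> set (P u)" "y \<in> set (P u)" "y \<noteq> u"
    if "u \<in> I" "(x, y) \<in> set (vwalk_arcs (P u))" for x y u
  proof -
    obtain k where k: "x = P u ! k" "y = P u ! Suc k" "Suc k < length (P u)"
      using \<open>(x, y) \<in> _\<close> unfolding set_vwalk_arcs by blast
    then show "x \<in> set (P u)" "y \<in> set (P u)" by auto
    have "u = P u ! 0" using P[OF \<open>u \<in> I\<close>] dist(2)[OF \<open>u \<in> I\<close>] by (metis hd_conv_nth)
    then show "y \<noteq> u" using k dist(1)[OF \<open>u \<in> I\<close>]
      by (metis Zero_not_Suc length_greater_0_conv length_pos_if_in_set nth_eq_iff_index_eq nth_mem)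
  qed
  have uniq_r: "y = y'" if N: "N x y" "N x y'" for x y y'
  proof -
    obtain u u' where u: "u \<in> I" "u' \<in> I" "(x, y) \<in> set (vwalk_arcs (P u))" "(x, y') \<in> set (vwalk_arcs (P u'))"
      using N unfolding N_def by blast
    then have "u = u'" using same inP by blast
    then obtain k k' where "x = P u ! k" "y = P u ! Suc k" "Suc k < length (P u)"
       "x = P u ! k'" "y' = P u ! Suc k'" "Suc k' < length (P u)"
      using u unfolding set_vwalk_arcs by blast
    then show ?thesis using dist(1)[OF u(1)] by (metis Suc_lessD nth_eq_iff_index_eq)
  qed
  have uniq_l: "x = x'" if N: "N x y" "N x' y" for x x' y
  proof -
    obtain u u' where u: "u \<in> I" "u' \<in> I" "(x, y) \<in> set (vwalk_arcs (P u))" "(x', y) \<in> set (vwalk_arcs (P u'))"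
      using N unfolding N_def by blast
    then have "u = u'" using same inP by blast
    then obtain k k' where "x = P u ! k" "y = P u ! Suc k" "Suc k < length (P u)"
       "x' = P u ! k'" "y = P u ! Suc k'" "Suc k' < length (P u)"
      using u unfolding set_vwalk_arcs by blast
    then show ?thesis using dist(1)[OF u(1)] by (metis Suc_inject nth_eq_iff_index_eq)
  qed
  have ex: "\<exists>y. N x y" if x: "u \<in> I" "x \<in> set (P u)" "x \<notin> T" for u x
  proof -
    obtain k where k: "k < length (P u)" "x = P u ! k" using x(2) by (metis in_set_conv_nth)
    have "k \<noteq> length (P u) - 1" using k x P[OF x(1)] dist(2)[OF x(1)] by (metis last_conv_nth)
    then have "(x, P u ! Suc k) \<in> set (vwalk_arcs (P u))"
      using k unfolding set_vwalk_arcs by (intro CollectI exI[of _ k]) auto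
    then show ?thesis using x(1) unfolding N_def by blast
  qed
  have self: "v \<in> set (P v)" if "v \<in> I" for v using P[OF that] dist(2)[OF that] by (metis hd_in_set)
  define f where "f v = (if \<exists>y. N v y then SOME y. N v y else v)" for v
  have f1: "N v (f v)" if "\<exists>y. N v y" for v using that unfolding f_def by (simp add: someI_ex)
  have f2: "f v = v" if "\<not> (\<exists>y. N v y)" for v using that unfolding f_def by presburger
  \<comment> \<open>A moved vertex lands in \<open>T\<close> or on a vertex that moves on, never on
    a stationary vertex outside \<open>T\<close>. This excludes collisions between moved and
    stationary vertices.\<close>
  have tgt: "\<exists>w. N y w" if "N v y" "y \<notin> T" for v y
    using that ex inP unfolding N_def by blast
  have "inj_on f (verts D - T)"
  proof (rule inj_onI)
    fix v w assume vw: "v \<in> verts D - T" "w \<in> verts D - T" "f v = f w"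
    show "v = w"
    proof (cases "\<exists>y. N v y"; cases "\<exists>y. N w y")
      assume "\<exists>y. N v y" "\<exists>y. N w y"
      then show ?thesis using f1 vw(3) uniq_l by metis
    next
      assume a: "\<exists>y. N v y" "\<not> (\<exists>y. N w y)"
      then have "N v w" using f1[of v] f2[of w] vw(3) by simp
      then show ?thesis using tgt vw a by blast
    next
      assume a: "\<not> (\<exists>y. N v y)" "\<exists>y. N w y"
      then have "N w v" using f1[of w] f2[of v] vw(3) by simp
      then show ?thesis using tgt vw a by blast
    next
      assume "\<not> (\<exists>y. N v y)" "\<not> (\<exists>y. N w y)"
      then show ?thesis using f2 vw(3) by metis
    qed
  qed
  moreover have "f v \<in> verts D - I \<and> (f v = v \<or> (v, f v) \<in> arcs_ends D)" if v: "v \<in> verts D - T" for v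
  proof (cases "\<exists>y. N v y")
    case True
    then obtain u where u: "u \<in> I" "(v, f v) \<in> set (vwalk_arcs (P u))" using f1[of v] unfolding N_def by blast
    have "f v \<notin> I"
    proof
      assume "f v \<in> I"
      then have "f v = u" using same u inP(2)[OF u] self by blast
      then show False using inP(3)[OF u] by simp
    qed
    then show ?thesis using u inP(2)[OF u] dist[OF u(1)] by blast
  next
    case False
    then have "v \<notin> I" using ex self v by blast
    then show ?thesis using f2[OF False] v by simp
  qed
  ultimately show ?thesis using assms unfolding linkable_def by blast
qed

text \<open>The path of \<open>i\<close> is its orbit under \<open>f\<close>. Orbits cannot run into
  a start, since \<open>f\<close> misses \<open>I\<close>, and cannot merge, since \<open>f\<close>
  is injective; an orbit that never reached \<open>T\<close> would therefore be infinite.\<close>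

lemma linkable_imp_linked_into:
  assumes "linkable (verts D) T (arcs_ends D) I" and fin: "finite (verts D)"
  shows "linked_into D I T"
proof -
  let ?W = "verts D - T"
  obtain f where inj: "inj_on f ?W" and fV: "\<And>v. v \<in> ?W \<Longrightarrow> f v \<in> verts D - I"
    and arc: "\<And>v. v \<in> ?W \<Longrightarrow> f v = v \<or> (v, f v) \<in> arcs_ends D" and I: "I \<subseteq> verts D"
    using assms unfolding linkable_def by blast
  \<comment> \<open>Cancel \<open>f\<close> on both sides until one orbit is back at its starting
    point, which is not a value of \<open>f\<close> on \<open>?W\<close>.\<close>
  have uniq: "a = b \<and> i = j"
    if "i \<in> I" "j \<in> I" "\<And>k. k < a \<Longrightarrow> (f ^^ k) i \<in> ?W" "\<And>k. k < b \<Longrightarrow> (f ^^ k) j \<in> ?W"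
      "(f ^^ a) i = (f ^^ b) j" for i j a b
    using that
  proof (induction a arbitrary: b)
    case 0
    then show ?case using fV[of "(f ^^ (b - 1)) j"] by (cases b) auto
  next
    case (Suc a)
    show ?case
    proof (cases b)
      case 0
      then show ?thesis using Suc.prems fV[of "(f ^^ a) i"] by auto
    next
      case (Suc b')
      have "(f ^^ a) i = (f ^^ b') j"
        using Suc.prems(5) inj Suc.prems(3)[of a] Suc.prems(4)[of b'] Suc by (auto dest: inj_onD)
      then show ?thesis using Suc.IH[of b'] Suc.prems Suc by auto
    qed
  qed
  have reach: "\<exists>n. (f ^^ n) i \<in> T" if i: "i \<in> I" for i
  proof (rule ccontr)
    assume no: "\<not> ?thesis"
    have W: "(f ^^ n) i \<in> ?W" for n
    proof (induction n)
      case 0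
      then show ?case using i I no[simplified, rule_format, of 0] by auto
    next
      case (Suc n)
      then show ?case using fV no[simplified, rule_format, of "Suc n"] by auto
    qed
    then have "inj (\<lambda>n. (f ^^ n) i)" by (intro injI) (use uniq i in blast)
    moreover have "range (\<lambda>n. (f ^^ n) i) \<subseteq> verts D" using W by blast
    ultimately show False using fin by (meson infinite_UNIV_nat finite_imageD finite_subset)
  qed
  \<comment> \<open>Each path stops at its first visit to \<open>T\<close>; all earlier vertices lie
    in \<open>?W\<close>, where \<open>f\<close> is controlled.\<close>
  define n where "n i = (LEAST n. (f ^^ n) i \<in> T)" for i
  have nT: "(f ^^ n i) i \<in> T" if "i \<in> I" for i
    unfolding n_def using reach[OF that] by (rule LeastI_ex)
  have V: "(f ^^ k) i \<in> verts D" if "i \<in> I" "k \<le> n i" for i k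
    using that
  proof (induction k)
    case 0
    then show ?case using I by auto
  next
    case (Suc k)
    then have "(f ^^ k) i \<in> verts D" "(f ^^ k) i \<notin> T"
      using not_less_Least[of k "\<lambda>n. (f ^^ n) i \<in> T"] unfolding n_def by auto
    then show ?case using fV by auto
  qed
  have W: "(f ^^ k) i \<in> ?W" if "i \<in> I" "k < n i" for i k
    using V[of i k] that not_less_Least[of k "\<lambda>n. (f ^^ n) i \<in> T"] unfolding n_def by auto
  define P where "P i = map (\<lambda>k. (f ^^ k) i) [0..<Suc (n i)]" for i
  have setP: "set (P i) = {(f ^^ k) i | k. k \<le> n i}" for i
    unfolding P_def by (auto simp del: upt_Suc)
  have nthP: "P i ! k = (f ^^ k) i" if "k \<le> n i" for i k
    unfolding P_def using that by (simp del: upt_Suc)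
  have lenP: "length (P i) = Suc (n i)" for i unfolding P_def by simp
  have uniq': "a = b \<and> i = j" if "i \<in> I" "j \<in> I" "a \<le> n i" "b \<le> n j" "(f ^^ a) i = (f ^^ b) j" for i j a b
    using uniq[OF that(1,2) _ _ that(5)] W that by (meson less_le_trans)
  show ?thesis unfolding linked_into_def
  proof (intro exI[of _ P] conjI ballI impI)
    fix i assume i: "i \<in> I"
    have "P i \<noteq> []" using lenP[of i] by auto
    then show "hd (P i) = i" "last (P i) \<in> T"
      using nT[OF i] nthP[of _ i] lenP[of i] by (auto simp: hd_conv_nth last_conv_nth)
    have "distinct (P i)"
      unfolding distinct_conv_nth using uniq'[OF i i] nthP[of _ i] lenP[of i] by (metis less_Suc_eq_le)
    moreover have "set (P i) \<subseteq> verts D" using V[OF i] setP[of i] by auto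
    moreover have "set (vwalk_arcs (P i)) \<subseteq> arcs_ends D"
    proof
      fix e assume "e \<in> set (vwalk_arcs (P i))"
      then obtain k where k: "Suc k < length (P i)" "e = (P i ! k, P i ! Suc k)"
        unfolding set_vwalk_arcs by blast
      then have e: "k < n i" "e = ((f ^^ k) i, f ((f ^^ k) i))" using nthP[of _ i] lenP[of i] by auto
      \<comment> \<open>This rules out the stationary alternative for \<open>f\<close>, so the step
        really is an arc.\<close>
      have "f ((f ^^ k) i) \<noteq> (f ^^ k) i" using uniq'[OF i i, of "Suc k" k] e(1) by auto
      then show "e \<in> arcs_ends D" using arc[OF W[OF i e(1)]] e(2) by auto
    qed
    ultimately show "vpath (P i) D" using \<open>P i \<noteq> []\<close> unfolding vpath_def vwalk_def by blast
  next
    fix i j assume "i \<in> I" "j \<in> I" "i \<noteq> j"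
    then show "set (P i) \<inter> set (P j) = {}" unfolding setP using uniq'[of i j] by auto
  qed
qed

lemma linked_into_iff_linkable:
  assumes "finite (verts D)" "I \<subseteq> verts D"
  shows "linked_into D I T \<longleftrightarrow> linkable (verts D) T (arcs_ends D) I"
  using assms linked_into_imp_linkable linkable_imp_linked_into by metis

lemma gammoid_iff_linkable:
  "gammoid M \<longleftrightarrow> is_matroid M \<and>
     (\<exists>(V :: nat set) T R \<phi>. finite V \<and> T \<subseteq> V \<and> R \<subseteq> V \<times> V \<and> inj_on \<phi> (ground M) \<and> \<phi> ` ground M \<subseteq> V \<and>
        (\<forall>I\<subseteq>ground M. I \<in> indeps M \<longleftrightarrow> linkable V T R (\<phi> ` I)))"
  (is "_ \<longleftrightarrow> _ \<and> ?R")
proof (intro iffI conjI)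
  assume "gammoid M"
  then obtain D :: "(nat, nat \<times> nat) pre_digraph" and T U \<phi> where
    D: "fin_digraph D" "T \<subseteq> verts D" "U \<subseteq> verts D"
    and \<phi>: "bij_betw \<phi> (ground M) U"
      "\<And>I. I \<subseteq> ground M \<Longrightarrow> I \<in> indeps M \<longleftrightarrow> \<phi> ` I \<in> indeps (restriction (strict_gammoid D T) U)"
    unfolding gammoid_def isomorphic_def by (auto simp: restriction_def)
  interpret fin_digraph D by (rule D)
  have "I \<in> indeps M \<longleftrightarrow> linkable (verts D) T (arcs_ends D) (\<phi> ` I)" if "I \<subseteq> ground M" for I
  proof -
    have "\<phi> ` I \<subseteq> U" using that \<phi>(1) by (auto simp: bij_betw_def)
    then show ?thesis
      using \<phi>(2)[OF that] D linked_into_iff_linkable[of D "\<phi> ` I" T]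
      by (auto simp: restriction_def strict_gammoid_def)
  qed
  moreover have "arcs_ends D \<subseteq> verts D \<times> verts D" by (auto simp: arcs_ends_conv)
  ultimately show ?R
    using D \<phi>(1) by (intro exI[of _ "verts D"] exI[of _ T] exI[of _ "arcs_ends D"] exI[of _ \<phi>])
      (auto simp: bij_betw_def)
next
  assume M: "is_matroid M \<and> ?R"
  then obtain V :: "nat set" and T R \<phi> where VT: "finite V" "T \<subseteq> V" "R \<subseteq> V \<times> V"
    and \<phi>: "inj_on \<phi> (ground M)" "\<phi> ` ground M \<subseteq> V"
      "\<And>I. I \<subseteq> ground M \<Longrightarrow> I \<in> indeps M \<longleftrightarrow> linkable V T R (\<phi> ` I)"
    by auto
  let ?D = "\<lparr> verts = V, arcs = R, tail = fst, head = snd \<rparr>"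
  have D: "fin_digraph ?D"
    using VT finite_subset[OF VT(3)] by unfold_locales auto
  have R: "arcs_ends ?D = R" by (simp add: arcs_ends_conv)
  have "isomorphic M (restriction (strict_gammoid ?D T) (\<phi> ` ground M))"
    unfolding isomorphic_def
  proof (intro exI[of _ \<phi>] conjI allI impI)
    show "bij_betw \<phi> (ground M) (ground (restriction (strict_gammoid ?D T) (\<phi> ` ground M)))"
      using \<phi>(1) by (simp add: bij_betw_def restriction_def)
    fix I assume I: "I \<subseteq> ground M"
    then have "\<phi> ` I \<subseteq> V" "\<phi> ` I \<subseteq> \<phi> ` ground M" using \<phi>(2) by auto
    then show "I \<in> indeps M \<longleftrightarrow> \<phi> ` I \<in> indeps (restriction (strict_gammoid ?D T) (\<phi> ` ground M))"
      using \<phi>(3)[OF I] linked_into_iff_linkable[of ?D "\<phi> ` I" T] VT(1) R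
      by (simp add: restriction_def strict_gammoid_def)
  qed
  then show "gammoid M" unfolding gammoid_def using M D VT(2) \<phi>(2)
    by (intro conjI exI[of _ ?D] exI[of _ T] exI[of _ "\<phi> ` ground M"]) auto
qed (auto simp: gammoid_def)

section \<open>Exchange along alternating chains\<close>

text \<open>Regard \<open>v -- f v\<close> and \<open>v -- g v\<close> as two matchings between
  \<open>W\<close> and the values. Typically \<open>K\<close> consists of the vertices of an
  alternating path from \<open>j\<close> to \<open>k\<close>: replacing \<open>f\<close> by
  \<open>g\<close> on \<open>K\<close> trades \<open>j\<close> for \<open>k\<close> in the image,
  and, for \<open>k\<close> not in the image of \<open>K\<close> under \<open>f\<close>, the reverse
  replacement trades \<open>k\<close> for \<open>j\<close>.\<close>

definition exchange_chain :: "'v set \<Rightarrow> ('v \<Rightarrow> 'w) \<Rightarrow> ('v \<Rightarrow> 'w) \<Rightarrow> 'w \<Rightarrow> 'w \<Rightarrow> bool" where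
  "exchange_chain W f g j k \<longleftrightarrow> (\<exists>K\<subseteq>W. j \<in> f ` K \<and> g ` K = insert k (f ` K - {j}))"

lemma exchange_chainE:
  assumes "exchange_chain W f g j k"
  obtains K where "K \<subseteq> W" "j \<in> f ` K" "g ` K = insert k (f ` K - {j})"
  using assms unfolding exchange_chain_def by auto

text \<open>The union of two matchings splits into alternating cycles and paths, and a path starting
  at a value of \<open>f\<close> alone ends at a value of \<open>g\<close> alone. The induction
  walks along such paths, removing one vertex at a time.\<close>

lemma exchange_chains:
  assumes "finite W" "inj_on f W" "inj_on g W"
  shows "\<exists>\<kappa>. bij_betw \<kappa> (f ` W - g ` W) (g ` W - f ` W) \<and>
    (\<forall>j\<in>f ` W - g ` W. exchange_chain W f g j (\<kappa> j))"
  using assms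
proof (induction "card W" arbitrary: W f rule: less_induct)
  case less
  show ?case
  proof (cases "f ` W \<subseteq> g ` W")
    case True
    have "card (f ` W) = card (g ` W)" using less.prems by (simp add: card_image)
    then have "f ` W = g ` W" using True less.prems(1) by (simp add: card_subset_eq)
    then show ?thesis by (simp add: bij_betw_def)
  next
    case False
    then obtain v where v: "v \<in> W" "f v \<notin> g ` W" by blast
    let ?W = "W - {v}"
    have W: "card ?W < card W" "finite ?W" "inj_on g ?W" "inj_on f ?W"
      using less.prems v by (auto simp del: card_Diff_insert intro: card_Diff1_less inj_on_subset)
    have gW: "g ` ?W = g ` W - {g v}" and fW: "f ` ?W = f ` W - {f v}"
      using v less.prems(2,3) by (auto simp: inj_on_def)
    show ?thesis
    proof (cases "g v \<in> f ` W")
      \<comment> \<open>The path is just \<open>f v -- v -- g v\<close>; it is added to the chains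
        found for the remaining vertices.\<close>
      case False
      obtain \<kappa> where \<kappa>: "bij_betw \<kappa> (f ` ?W - g ` ?W) (g ` ?W - f ` ?W)"
        "\<And>j. j \<in> f ` ?W - g ` ?W \<Longrightarrow> exchange_chain ?W f g j (\<kappa> j)"
        using less.hyps[OF W(1,2,4,3)] by blast
      have d1: "f ` W - g ` W = (f ` ?W - g ` ?W) \<union> {f v}" and n1: "f v \<notin> f ` ?W - g ` ?W"
        and d2: "g ` W - f ` W = (g ` ?W - f ` ?W) \<union> {g v}" and n2: "g v \<notin> g ` ?W - f ` ?W"
      proof -
        have diff: "A - B = ((A - {a}) - (B - {b})) \<union> {a}" if "a \<in> A" "a \<notin> B" "b \<notin> A" for A B :: "'b set" and a b
          using that by auto
        show "f ` W - g ` W = (f ` ?W - g ` ?W) \<union> {f v}" "g ` W - f ` W = (g ` ?W - f ` ?W) \<union> {g v}"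
          unfolding gW fW using v False diff[of "f v" "f ` W" "g ` W" "g v"] diff[of "g v" "g ` W" "f ` W" "f v"]
          by blast+
        show "f v \<notin> f ` ?W - g ` ?W" "g v \<notin> g ` ?W - f ` ?W" unfolding gW fW by simp_all
      qed
      let ?k = "\<kappa>(f v := g v)"
      have "bij_betw ?k (f ` ?W - g ` ?W) (g ` ?W - f ` ?W)"
      proof -
        have "?k a = \<kappa> a" if "a \<in> f ` ?W - g ` ?W" for a using n1 that by (metis fun_upd_other)
        then show ?thesis using \<kappa>(1) bij_betw_cong[of "f ` ?W - g ` ?W" ?k \<kappa>] by simp
      qed
      then have "bij_betw ?k (f ` W - g ` W) (g ` W - f ` W)"
        unfolding d1 d2 using notIn_Un_bij_betw[of "f v" _ ?k "g ` ?W - f ` ?W"] n1 n2 by simp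
      moreover have "exchange_chain W f g j (?k j)" if j: "j \<in> f ` W - g ` W" for j
      proof (cases "j = f v")
        case True
        then show ?thesis using v unfolding exchange_chain_def by (intro exI[of _ "{v}"]) auto
      next
        case False
        then have "j \<in> f ` ?W - g ` ?W" using j d1 by blast
        then obtain K where "K \<subseteq> ?W" "j \<in> f ` K" "g ` K = insert (\<kappa> j) (f ` K - {j})"
          using \<kappa>(2) exchange_chainE by metis
        then show ?thesis using False unfolding exchange_chain_def by (intro exI[of _ K]) auto
      qed
      ultimately show ?thesis by (intro exI[of _ ?k]) blast
    next
      case True
      then obtain w where w: "w \<in> W" "f w = g v" by auto
      have wv: "w \<noteq> v" using v w by auto
      \<comment> \<open>The path continues through \<open>w\<close>. Redirecting \<open>w\<close> to
        \<open>f v\<close> bypasses \<open>v\<close>; a chain through \<open>w\<close> gets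
        \<open>v\<close> back below.\<close>
      let ?f = "f(w := f v)"
      have injf: "inj_on ?f ?W" using less.prems(2) v w wv by (auto simp: inj_on_def)
      have fW': "?f ` ?W = f ` W - {g v}"
      proof -
        have "?f ` ?W = insert (f v) (f ` (W - {v} - {w}))" using w wv by auto
        also have "\<dots> = f ` W - {f w}" using v w wv less.prems(2) by (auto simp: inj_on_def)
        finally show ?thesis using w by simp
      qed
      obtain \<kappa> where \<kappa>: "bij_betw \<kappa> (?f ` ?W - g ` ?W) (g ` ?W - ?f ` ?W)"
        "\<And>j. j \<in> ?f ` ?W - g ` ?W \<Longrightarrow> exchange_chain ?W ?f g j (\<kappa> j)"
        using less.hyps[OF W(1,2) injf W(3)] by blast
      have d: "?f ` ?W - g ` ?W = f ` W - g ` W" "g ` ?W - ?f ` ?W = g ` W - f ` W"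
        unfolding gW fW' using v(1) True by auto
      have "exchange_chain W f g j (\<kappa> j)" if j: "j \<in> f ` W - g ` W" for j
      proof -
        obtain K where K: "K \<subseteq> ?W" "j \<in> ?f ` K" "g ` K = insert (\<kappa> j) (?f ` K - {j})"
          using \<kappa>(2)[of j] j d(1) exchange_chainE by metis
        show ?thesis
        proof (cases "w \<in> K")
          case True
          have im: "f ` insert v K = insert (g v) (?f ` K)"
          proof -
            have "?f ` K = insert (f v) (f ` (K - {w}))" using True by auto
            moreover have "f ` insert v K = insert (f v) (insert (f w) (f ` (K - {w})))" using True by auto
            ultimately show ?thesis using w(2) by auto
          qed
          have "g v \<noteq> j" using j v(1) by blast
          then have "g ` insert v K = insert (\<kappa> j) (f ` insert v K - {j})"
            unfolding im using K(3) by auto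
          then show ?thesis using K im v(1) unfolding exchange_chain_def by (intro exI[of _ "insert v K"]) auto
        next
          case False
          then have "?f ` K = f ` K" by auto
          then show ?thesis using K unfolding exchange_chain_def by (intro exI[of _ K]) auto
        qed
      qed
      then show ?thesis using \<kappa>(1) unfolding d by blast
    qed
  qed
qed

lemma exchange_along_chain:
  assumes "inj_on f W" "inj_on g W" "K \<subseteq> W" "j \<in> f ` K" "g ` K = insert k (f ` K - {j})" "k \<notin> f ` W"
  defines "h \<equiv> \<lambda>v. if v \<in> K then g v else f v"
  shows "inj_on h W" "h ` W = insert k (f ` W - {j})"
proof -
  have W: "W = K \<union> (W - K)" using assms(3) by blast
  have fd: "f ` (W - K) = f ` W - f ` K" using assms(1,3) by (meson Diff_subset inj_on_image_set_diff)
  have hK: "h ` K = g ` K" and hd: "h ` (W - K) = f ` (W - K)" by (auto simp: h_def)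
  have "inj_on h K" "inj_on h (W - K)"
    using assms(1-3) by (auto simp: h_def inj_on_def subset_iff)
  moreover have "h ` K \<inter> h ` (W - K) = {}" unfolding hK hd fd assms(5) using assms(6) by auto
  ultimately have "inj_on h (K \<union> (W - K))" unfolding inj_on_Un by auto
  then show "inj_on h W" using W by simp
  have "h ` W = g ` K \<union> (f ` W - f ` K)" by (subst W) (simp only: image_Un hK hd fd)
  also have "\<dots> = insert k (f ` W - {j})"
    unfolding assms(5) using assms(3,4) by auto
  finally show "h ` W = insert k (f ` W - {j})" .
qed

text \<open>Let \<open>f\<close> and \<open>g\<close> belong to \<open>I\<close> and
  \<open>J\<close>. If some \<open>j\<close> in \<open>J - I\<close> is no value of
  \<open>f\<close>, then \<open>f\<close> itself misses it; if the chain from \<open>j\<close> ends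
  outside \<open>I\<close>, exchanging along it gives a function that misses \<open>j\<close> and
  still misses \<open>I\<close>. Were neither ever the case, the chain ends would inject
  \<open>J - I\<close> into \<open>I - J\<close>, against \<open>card I < card J\<close>.\<close>

lemma linkable_augment:
  assumes fin: "finite V" and I: "linkable V T R I" and J: "linkable V T R J" and less: "card I < card J"
  shows "\<exists>x\<in>J - I. linkable V T R (insert x I)"
proof -
  let ?W = "V - T"
  have finI: "finite I" "finite J" and IV: "I \<subseteq> V" "J \<subseteq> V"
    using I J fin finite_subset unfolding linkable_def by auto
  obtain f where f: "inj_on f ?W" "\<And>v. v \<in> ?W \<Longrightarrow> f v \<in> V - I \<and> (f v = v \<or> (v, f v) \<in> R)"
    using I unfolding linkable_def by blast
  obtain g where g: "inj_on g ?W" "\<And>v. v \<in> ?W \<Longrightarrow> g v \<in> V - J \<and> (g v = v \<or> (v, g v) \<in> R)"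
    using J unfolding linkable_def by blast
  obtain \<kappa> where \<kappa>: "bij_betw \<kappa> (f ` ?W - g ` ?W) (g ` ?W - f ` ?W)"
    "\<And>j. j \<in> f ` ?W - g ` ?W \<Longrightarrow> exchange_chain ?W f g j (\<kappa> j)"
    using exchange_chains[OF _ f(1) g(1)] fin by blast
  have gJ: "g ` ?W \<inter> J = {}" using g(2) by blast
  show ?thesis
  proof (cases "\<exists>j\<in>J - I. j \<notin> f ` ?W \<or> \<kappa> j \<notin> I")
    case True
    then obtain j where j: "j \<in> J - I" "j \<notin> f ` ?W \<or> \<kappa> j \<notin> I" by blast
    have "linkable V T R (insert j I)"
    proof (cases "j \<in> f ` ?W")
      case False
      then show ?thesis unfolding linkable_def using f j IV by (intro conjI exI[of _ f]) auto
    next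
      case True
      then have j': "j \<in> f ` ?W - g ` ?W" using gJ j by auto
      then obtain K where K: "K \<subseteq> ?W" "j \<in> f ` K" "g ` K = insert (\<kappa> j) (f ` K - {j})"
        using \<kappa>(2) exchange_chainE by metis
      have kj: "\<kappa> j \<in> g ` ?W - f ` ?W" using bij_betwE[OF \<kappa>(1)] j' by blast
      let ?h = "\<lambda>v. if v \<in> K then g v else f v"
      have h: "inj_on ?h ?W" "?h ` ?W = insert (\<kappa> j) (f ` ?W - {j})"
        using exchange_along_chain[OF f(1) g(1) K] kj by auto
      have "?h v \<in> V - insert j I" if "v \<in> ?W" for v
      proof -
        have "?h v \<in> insert (\<kappa> j) (f ` ?W - {j})" using h(2) that by blast
        moreover have "\<kappa> j \<in> V - insert j I" using kj g(2) j True by auto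
        ultimately show ?thesis using f(2) by auto
      qed
      then show ?thesis unfolding linkable_def using h(1) f(2) g(2) j IV by (intro conjI exI[of _ ?h]) auto
    qed
    then show ?thesis using j by blast
  next
    case False
    then have sub: "J - I \<subseteq> f ` ?W - g ` ?W" "\<kappa> ` (J - I) \<subseteq> I" using gJ by auto
    have "\<kappa> ` (J - I) \<subseteq> g ` ?W" using sub(1) bij_betwE[OF \<kappa>(1)] by blast
    then have "\<kappa> ` (J - I) \<subseteq> I - J" using sub(2) gJ by blast
    moreover have "inj_on \<kappa> (J - I)" using \<kappa>(1) sub(1) unfolding bij_betw_def by (meson inj_on_subset)
    ultimately have "card (J - I) \<le> card (I - J)" using finI by (meson card_inj_on_le finite_Diff)
    then show ?thesis using less finI card_less_sym_Diff[of I J] by simp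
  qed
qed

lemma linkable_self: "T \<subseteq> V \<Longrightarrow> linkable V T R T"
  unfolding linkable_def by (intro conjI exI[of _ id]) auto

lemma card_linkable_le:
  assumes "finite V" "T \<subseteq> V" "linkable V T R I"
  shows "card I \<le> card T"
proof -
  obtain f where f: "inj_on f (V - T)" "f ` (V - T) \<subseteq> V - I" and I: "I \<subseteq> V"
    using assms unfolding linkable_def by blast
  have "card (V - T) \<le> card (V - I)" using f assms(1) by (meson card_inj_on_le finite_Diff)
  then have "card V - card T \<le> card V - card I"
    using I assms by (simp add: card_Diff_subset finite_subset)
  moreover have "card I \<le> card V" "card T \<le> card V" using card_mono[OF assms(1)] I assms(2) by auto
  ultimately show ?thesis by linarith
qed

lemma linkable_extend:
  assumes fin: "finite V" and I: "linkable V T R I" and J: "linkable V T R J" and le: "card I \<le> card J"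
  shows "\<exists>Y\<subseteq>J - I. linkable V T R (I \<union> Y) \<and> card (I \<union> Y) = card J"
  using I le
proof (induction "card J - card I" arbitrary: I)
  case 0
  then show ?case by (intro exI[of _ "{}"]) auto
next
  case (Suc n)
  then have "card I < card J" by linarith
  then obtain x where x: "x \<in> J - I" "linkable V T R (insert x I)"
    using linkable_augment[OF fin Suc.prems(1) J] by auto
  have "finite I" using Suc.prems(1) fin finite_subset unfolding linkable_def by auto
  then have c: "card (insert x I) = Suc (card I)" using x by simp
  have "n = card J - card (insert x I)" "card (insert x I) \<le> card J" using Suc.hyps(2) c by linarith+
  from Suc.hyps(1)[OF this(1) x(2) this(2)]
  obtain Y where "Y \<subseteq> J - insert x I" "linkable V T R (insert x I \<union> Y)" "card (insert x I \<union> Y) = card J"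
    by (elim exE conjE) (rule that)
  then show ?case using x(1) by (intro exI[of _ "insert x Y"]) auto
qed

text \<open>At full size the values of \<open>f\<close> are exactly \<open>V - I\<close> and those
  of \<open>g\<close> exactly \<open>V - J\<close>, so the chains pair \<open>J - I\<close> with
  \<open>I - J\<close>. One and the same \<open>K\<close> serves both exchanges: \<open>g\<close>
  replaces \<open>f\<close> on it, or \<open>f\<close> replaces \<open>g\<close>.\<close>

lemma linkable_bases_orderable:
  assumes fin: "finite V" and T: "T \<subseteq> V"
    and I: "linkable V T R I" "card I = card T" and J: "linkable V T R J" "card J = card T"
  shows "\<exists>\<pi>. bij_betw \<pi> (J - I) (I - J) \<and>
    (\<forall>j\<in>J - I. linkable V T R (insert j (I - {\<pi> j})) \<and> linkable V T R (insert (\<pi> j) (J - {j})))"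
proof -
  let ?W = "V - T"
  have IV: "I \<subseteq> V" "J \<subseteq> V" using I J unfolding linkable_def by auto
  obtain f where f: "inj_on f ?W" "\<And>v. v \<in> ?W \<Longrightarrow> f v \<in> V - I \<and> (f v = v \<or> (v, f v) \<in> R)"
    using I unfolding linkable_def by blast
  obtain g where g: "inj_on g ?W" "\<And>v. v \<in> ?W \<Longrightarrow> g v \<in> V - J \<and> (g v = v \<or> (v, g v) \<in> R)"
    using J unfolding linkable_def by blast
  have c: "card (V - I) = card ?W" "card (V - J) = card ?W"
    using fin IV T I J by (simp_all add: card_Diff_subset finite_subset)
  have fW: "f ` ?W = V - I"
    using f c fin by (intro card_subset_eq) (auto simp: card_image)
  have gW: "g ` ?W = V - J"
    using g c fin by (intro card_subset_eq) (auto simp: card_image)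
  have d: "f ` ?W - g ` ?W = J - I" "g ` ?W - f ` ?W = I - J" unfolding fW gW using IV by auto
  obtain \<kappa> where \<kappa>: "bij_betw \<kappa> (J - I) (I - J)"
    "\<And>j. j \<in> J - I \<Longrightarrow> exchange_chain ?W f g j (\<kappa> j)"
    using exchange_chains[OF _ f(1) g(1)] fin unfolding d by blast
  have "linkable V T R (insert j (I - {\<kappa> j})) \<and> linkable V T R (insert (\<kappa> j) (J - {j}))" if j: "j \<in> J - I" for j
  proof -
    obtain K where K: "K \<subseteq> ?W" "j \<in> f ` K" "g ` K = insert (\<kappa> j) (f ` K - {j})"
      using \<kappa>(2)[OF j] by (rule exchange_chainE)
    have kj: "\<kappa> j \<in> I - J" using \<kappa>(1) j by (auto simp: bij_betw_def)
    have kf: "\<kappa> j \<notin> f ` ?W" and jg: "j \<notin> g ` ?W" unfolding fW gW using kj j by auto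
    have "\<kappa> j \<notin> f ` K" using kf K(1) by auto
    then have K': "\<kappa> j \<in> g ` K" "f ` K = insert j (g ` K - {\<kappa> j})" using K(2,3) by auto
    let ?h = "\<lambda>v. if v \<in> K then g v else f v" and ?k = "\<lambda>v. if v \<in> K then f v else g v"
    have h: "inj_on ?h ?W" "?h ` ?W = insert (\<kappa> j) (f ` ?W - {j})"
      using exchange_along_chain[OF f(1) g(1) K kf] by auto
    have k: "inj_on ?k ?W" "?k ` ?W = insert j (g ` ?W - {\<kappa> j})"
      using exchange_along_chain[OF g(1) f(1) K(1) K' jg] by auto
    have sub: "insert (\<kappa> j) (f ` ?W - {j}) \<subseteq> V - insert j (I - {\<kappa> j})"
      "insert j (g ` ?W - {\<kappa> j}) \<subseteq> V - insert (\<kappa> j) (J - {j})"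
      unfolding fW gW using kj j IV by auto
    have hr: "?h v \<in> V - insert j (I - {\<kappa> j})" "?k v \<in> V - insert (\<kappa> j) (J - {j})" if "v \<in> ?W" for v
    proof -
      have "?h v \<in> ?h ` ?W" "?k v \<in> ?k ` ?W" using that by (blast intro: imageI)+
      then show "?h v \<in> V - insert j (I - {\<kappa> j})" "?k v \<in> V - insert (\<kappa> j) (J - {j})"
        unfolding h(2) k(2) using sub by blast+
    qed
    have "linkable V T R (insert j (I - {\<kappa> j}))"
      unfolding linkable_def using h(1) hr(1) f(2) g(2) j IV by (intro conjI exI[of _ ?h]) auto
    moreover have "linkable V T R (insert (\<kappa> j) (J - {j}))"
      unfolding linkable_def using k(1) hr(2) f(2) g(2) kj IV by (intro conjI exI[of _ ?k]) auto
    ultimately show ?thesis by blast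
  qed
  then show ?thesis using \<kappa>(1) by blast
qed

text \<open>Bases of \<open>S\<close> may be smaller than \<open>T\<close>, so they are first
  extended to full size in the digraph. If the extension of \<open>J\<close> is chosen inside the
  extended image of \<open>I\<close>, maximality of the two bases forces it to be the very set
  \<open>Z\<close> that extends \<open>I\<close>. A common extension leaves \<open>I - J\<close> and
  \<open>J - I\<close> unchanged.\<close>

lemma gammoid_base_orderable:
  assumes M: "gammoid M" and I: "is_basis_of M I S" and J: "is_basis_of M J S"
  shows "\<exists>\<pi>. bij_betw \<pi> (J - I) (I - J) \<and>
    (\<forall>j\<in>J - I. insert j (I - {\<pi> j}) \<in> indeps M \<and> insert (\<pi> j) (J - {j}) \<in> indeps M)"
proof -
  obtain V :: "nat set" and T R \<phi> where fin: "finite V" and T: "T \<subseteq> V"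
    and inj: "inj_on \<phi> (ground M)" and im: "\<phi> ` ground M \<subseteq> V"
    and ind: "\<And>I. I \<subseteq> ground M \<Longrightarrow> I \<in> indeps M \<longleftrightarrow> linkable V T R (\<phi> ` I)"
    using M unfolding gammoid_iff_linkable by auto
  have mat: "finite (ground M)" "indeps M \<subseteq> Pow (ground M)"
    and aug: "\<And>I J. I \<in> indeps M \<Longrightarrow> J \<in> indeps M \<Longrightarrow> card I < card J \<Longrightarrow> \<exists>x\<in>J - I. insert x I \<in> indeps M"
    using M unfolding gammoid_def is_matroid_def by blast+
  have IM: "I \<in> indeps M" "I \<subseteq> S" "I \<subseteq> ground M" and JM: "J \<in> indeps M" "J \<subseteq> S" "J \<subseteq> ground M"
    using I J mat unfolding is_basis_of_def by auto
  have maxI: "insert x I \<notin> indeps M" if "x \<in> J - I" for x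
    using I that JM(2) IM(2) unfolding is_basis_of_def by (metis DiffE insert_iff insert_subset subset_iff subset_insertI)
  have maxJ: "insert x J \<notin> indeps M" if "x \<in> I - J" for x
    using J that JM(2) IM(2) unfolding is_basis_of_def by (metis DiffE insert_iff insert_subset subset_iff subset_insertI)
  have "card I = card J" using aug IM(1) JM(1) maxI maxJ by (metis linorder_neqE_nat)
  moreover have "inj_on \<phi> I" "inj_on \<phi> J" using inj IM JM by (auto intro: inj_on_subset)
  ultimately have cIJ: "card (\<phi> ` I) = card (\<phi> ` J)" by (simp add: card_image)
  have lI: "linkable V T R (\<phi> ` I)" and lJ: "linkable V T R (\<phi> ` J)" using ind IM JM by auto
  obtain Z where Z: "Z \<subseteq> T - \<phi> ` I" "linkable V T R (\<phi> ` I \<union> Z)" "card (\<phi> ` I \<union> Z) = card T"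
    using linkable_extend[OF fin lI linkable_self[OF T]] card_linkable_le[OF fin T lI] by auto
  have finIZ: "finite (\<phi> ` I)" "finite (\<phi> ` J)" "finite Z"
    using Z(1) T fin lI lJ unfolding linkable_def by (auto intro: finite_subset)
  have ZJ: "Z \<inter> \<phi> ` J = {}"
  proof (rule ccontr)
    assume "\<not> ?thesis"
    then obtain x where x: "x \<in> J" "\<phi> x \<in> Z" by blast
    then have "x \<in> J - I" using Z(1) by auto
    moreover have "linkable V T R (\<phi> ` insert x I)" using linkable_mono[OF Z(2)] x by auto
    ultimately show False using maxI ind[of "insert x I"] IM(3) JM(3) by auto
  qed
  obtain Y where Y: "Y \<subseteq> (\<phi> ` I \<union> Z) - \<phi> ` J" "linkable V T R (\<phi> ` J \<union> Y)" "card (\<phi> ` J \<union> Y) = card T"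
    using linkable_extend[OF fin lJ Z(2)] card_linkable_le[OF fin T lJ] Z(3) by auto
  have "Y \<inter> \<phi> ` I = {}"
  proof (rule ccontr)
    assume "\<not> ?thesis"
    then obtain x where x: "x \<in> I" "\<phi> x \<in> Y" by blast
    then have "x \<in> I - J" using Y(1) by auto
    moreover have "linkable V T R (\<phi> ` insert x J)" using linkable_mono[OF Y(2)] x by auto
    ultimately show False using maxJ ind[of "insert x J"] IM(3) JM(3) by auto
  qed
  then have YZ: "Y \<subseteq> Z" using Y(1) by auto
  moreover have "card Y = card Z"
  proof -
    have "card (\<phi> ` J \<union> Y) = card (\<phi> ` J) + card Y"
      using finIZ YZ ZJ by (intro card_Un_disjoint) (auto intro: finite_subset)
    moreover have "card (\<phi> ` I \<union> Z) = card (\<phi> ` I) + card Z"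
      using finIZ Z(1) by (intro card_Un_disjoint) auto
    ultimately show ?thesis using Y(3) Z(3) cIJ by simp
  qed
  ultimately have "Y = Z" using finIZ by (simp add: card_subset_eq)
  let ?I = "\<phi> ` I \<union> Z" and ?J = "\<phi> ` J \<union> Z"
  have IJ: "I - J \<subseteq> ground M" "J - I \<subseteq> ground M" using IM JM by auto
  have d: "?J - ?I = \<phi> ` (J - I)" "?I - ?J = \<phi> ` (I - J)"
  proof -
    have "\<phi> ` (J - I) = \<phi> ` J - \<phi> ` I" "\<phi> ` (I - J) = \<phi> ` I - \<phi> ` J"
      using inj_on_image_set_diff[OF inj] IJ IM JM by auto
    then show "?J - ?I = \<phi> ` (J - I)" "?I - ?J = \<phi> ` (I - J)" using ZJ Z(1) by auto
  qed
  obtain \<kappa> where \<kappa>: "bij_betw \<kappa> (\<phi> ` (J - I)) (\<phi> ` (I - J))"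
    "\<And>j. j \<in> \<phi> ` (J - I) \<Longrightarrow> linkable V T R (insert j (?I - {\<kappa> j})) \<and> linkable V T R (insert (\<kappa> j) (?J - {j}))"
    using linkable_bases_orderable[OF fin T Z(2,3), of ?J] Y(2,3) \<open>Y = Z\<close> unfolding d by auto
  have b1: "bij_betw \<phi> (J - I) (\<phi> ` (J - I))" and b2: "bij_betw \<phi> (I - J) (\<phi> ` (I - J))"
    using inj_on_subset[OF inj IJ(1)] inj_on_subset[OF inj IJ(2)] by (auto simp: bij_betw_def)
  let ?p = "inv_into (I - J) \<phi> \<circ> (\<kappa> \<circ> \<phi>)"
  have bp: "bij_betw ?p (J - I) (I - J)"
    using bij_betw_trans[OF bij_betw_trans[OF b1 \<kappa>(1)] bij_betw_inv_into[OF b2]] .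
  have "insert j (I - {?p j}) \<in> indeps M \<and> insert (?p j) (J - {j}) \<in> indeps M" if j: "j \<in> J - I" for j
  proof -
    have p: "?p j \<in> I - J" using bp j by (auto simp: bij_betw_def)
    have "\<kappa> (\<phi> j) \<in> \<phi> ` (I - J)" using \<kappa>(1) j by (auto simp: bij_betw_def)
    then have e: "\<phi> (?p j) = \<kappa> (\<phi> j)" by (simp add: f_inv_into_f)
    have i1: "\<phi> ` (I - {?p j}) = \<phi> ` I - {\<kappa> (\<phi> j)}"
      using inj_on_image_set_diff[OF inj, of I "{?p j}"] IM p e by auto
    have i2: "\<phi> ` (J - {j}) = \<phi> ` J - {\<phi> j}"
      using inj_on_image_set_diff[OF inj, of J "{j}"] JM j by auto
    have k: "linkable V T R (insert (\<phi> j) (?I - {\<kappa> (\<phi> j)}))" "linkable V T R (insert (\<kappa> (\<phi> j)) (?J - {\<phi> j}))"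
      using \<kappa>(2)[of "\<phi> j"] j by auto
    have "\<phi> ` insert j (I - {?p j}) \<subseteq> insert (\<phi> j) (?I - {\<kappa> (\<phi> j)})"
      unfolding image_insert i1 by auto
    then have "linkable V T R (\<phi> ` insert j (I - {?p j}))" by (rule linkable_mono[OF k(1)])
    moreover have "\<phi> ` insert (?p j) (J - {j}) \<subseteq> insert (\<kappa> (\<phi> j)) (?J - {\<phi> j})"
      unfolding image_insert i2 e by auto
    then have "linkable V T R (\<phi> ` insert (?p j) (J - {j}))" by (rule linkable_mono[OF k(2)])
    moreover have "insert j (I - {?p j}) \<subseteq> ground M" "insert (?p j) (J - {j}) \<subseteq> ground M"
      using IM JM j p by auto
    ultimately show ?thesis using ind by blast
  qed
  then show ?thesis using bp by blast
qed

section \<open>Loops, coloops, parallel and series extensions of gammoids\<close>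

lemma linkable_insert_sink:
  assumes y: "y \<notin> V" and R: "R \<subseteq> V \<times> V" and J: "J \<subseteq> insert y V"
  shows "linkable (insert y V) (insert y T) R J \<longleftrightarrow> linkable V T R (J - {y})"
proof -
  have W: "insert y V - insert y T = V - T - {y}" "V - T - {y} = V - T" using y by auto
  have "f v \<in> insert y V - J \<and> (f v = v \<or> (v, f v) \<in> R) \<longleftrightarrow> f v \<in> V - (J - {y}) \<and> (f v = v \<or> (v, f v) \<in> R)"
    if "v \<in> V - T" for f v
    using that y R by auto
  then have "(\<forall>v\<in>V - T. f v \<in> insert y V - J \<and> (f v = v \<or> (v, f v) \<in> R)) \<longleftrightarrow>
      (\<forall>v\<in>V - T. f v \<in> V - (J - {y}) \<and> (f v = v \<or> (v, f v) \<in> R))" for f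
    by (intro ball_cong refl)
  moreover have "J - {y} \<subseteq> V" using J by auto
  ultimately show ?thesis unfolding linkable_def W using J by auto
qed

text \<open>Either \<open>f\<close> fixes \<open>x\<close>, which requires \<open>x\<close> outside
  \<open>J\<close>, or it sends \<open>x\<close> to some \<open>w\<close> in \<open>N\<close>. In
  the latter case \<open>w\<close> is blocked for all other vertices, which amounts to adding
  \<open>w\<close> to the set to be linked.\<close>

lemma linkable_insert_source:
  assumes x: "x \<notin> V" and T: "T \<subseteq> V" and R: "R \<subseteq> V \<times> V" and N: "N \<subseteq> V" and J: "J \<subseteq> insert x V"
  shows "linkable (insert x V) T (R \<union> {x} \<times> N) J \<longleftrightarrow>
    (x \<notin> J \<and> linkable V T R J) \<or> (\<exists>w\<in>N. w \<notin> J \<and> linkable V T R (insert w (J - {x})))"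
proof
  assume "linkable (insert x V) T (R \<union> {x} \<times> N) J"
  then obtain f where f: "inj_on f (insert x V - T)"
    "\<And>v. v \<in> insert x V - T \<Longrightarrow> f v \<in> insert x V - J \<and> (f v = v \<or> (v, f v) \<in> R \<union> {x} \<times> N)"
    unfolding linkable_def by auto
  have inj: "inj_on f (V - T)" using f(1) by (rule inj_on_subset) auto
  have fV: "f v \<in> V - J \<and> (f v = v \<or> (v, f v) \<in> R)" if "v \<in> V - T" for v
    using f(2)[of v] that x R by auto
  have "x \<in> insert x V - T" using x T by auto
  then have fx: "f x \<in> insert x V - J" "f x = x \<or> f x \<in> N" using f(2)[of x] x R by auto
  have nx: "f v \<noteq> f x" if "v \<in> V - T" for v
  proof
    assume "f v = f x"
    then have "v = x" by (rule inj_onD[OF f(1)]) (use that x T in auto)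
    then show False using that x by auto
  qed
  show "(x \<notin> J \<and> linkable V T R J) \<or> (\<exists>w\<in>N. w \<notin> J \<and> linkable V T R (insert w (J - {x})))"
  proof (cases "f x = x")
    case True
    then have "x \<notin> J" "J \<subseteq> V" using fx J by auto
    then show ?thesis using inj fV unfolding linkable_def by blast
  next
    case False
    then have w: "f x \<in> N" "f x \<notin> J" using fx by auto
    have "f v \<in> V - insert (f x) (J - {x}) \<and> (f v = v \<or> (v, f v) \<in> R)" if "v \<in> V - T" for v
      using fV[OF that] nx[OF that] by auto
    moreover have "insert (f x) (J - {x}) \<subseteq> V" using w N J by auto
    ultimately have "linkable V T R (insert (f x) (J - {x}))" using inj unfolding linkable_def by blast
    then show ?thesis using w by blast
  qed
next
  have W: "insert x V - T = insert x (V - T)" using x T by auto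
  have ext: "linkable (insert x V) T (R \<union> {x} \<times> N) J"
    if L: "linkable V T R K" and JK: "J - {x} \<subseteq> K" and w: "w \<in> insert x V" "w \<notin> J" "w = x \<or> w \<in> N" "w \<in> V \<Longrightarrow> w \<in> K" for w K
  proof -
    obtain f where f: "inj_on f (V - T)" "\<And>v. v \<in> V - T \<Longrightarrow> f v \<in> V - K \<and> (f v = v \<or> (v, f v) \<in> R)"
      using L unfolding linkable_def by auto
    let ?f = "f(x := w)"
    have e: "?f v = f v" if "v \<in> V - T" for v using that x by auto
    have "w \<notin> f ` (V - T)" using f(2) w(4) by auto
    then have "inj_on ?f (insert x (V - T))"
      using f(1) x by (auto simp: inj_on_def)
    moreover have "?f v \<in> insert x V - J \<and> (?f v = v \<or> (v, ?f v) \<in> R \<union> {x} \<times> N)" if "v \<in> insert x (V - T)" for v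
    proof (cases "v = x")
      case True
      then show ?thesis using w(1-3) by auto
    next
      case False
      then have v: "v \<in> V - T" using that by auto
      have "f v \<noteq> x" using f(2)[OF v] x by auto
      then show ?thesis using f(2)[OF v] e[OF v] JK by auto
    qed
    ultimately show ?thesis unfolding linkable_def W using J by blast
  qed
  assume "(x \<notin> J \<and> linkable V T R J) \<or> (\<exists>w\<in>N. w \<notin> J \<and> linkable V T R (insert w (J - {x})))"
  then show "linkable (insert x V) T (R \<union> {x} \<times> N) J"
  proof (elim disjE conjE bexE)
    assume "x \<notin> J" "linkable V T R J"
    then show ?thesis using x by (intro ext[of J x]) auto
  next
    fix w assume "w \<in> N" "w \<notin> J" "linkable V T R (insert w (J - {x}))"
    then show ?thesis using N by (intro ext[of "insert w (J - {x})" w]) auto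
  qed
qed

text \<open>The digraph part of \<open>gammoid_iff_linkable\<close> for a bare independence
  predicate, so that one-element extensions compose without carrying the matroid axioms
  along.\<close>

definition linkage_rep :: "'a set \<Rightarrow> ('a set \<Rightarrow> bool) \<Rightarrow> bool" where
  "linkage_rep E ind \<longleftrightarrow>
     (\<exists>(V :: nat set) T R \<phi>. finite V \<and> T \<subseteq> V \<and> R \<subseteq> V \<times> V \<and> inj_on \<phi> E \<and> \<phi> ` E \<subseteq> V \<and>
        (\<forall>I\<subseteq>E. ind I \<longleftrightarrow> linkable V T R (\<phi> ` I)))"

lemma linkage_repE:
  assumes "linkage_rep E ind"
  obtains V :: "nat set" and T R \<phi> where "finite V" "T \<subseteq> V" "R \<subseteq> V \<times> V" "inj_on \<phi> E" "\<phi> ` E \<subseteq> V"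
    "\<And>I. I \<subseteq> E \<Longrightarrow> ind I \<longleftrightarrow> linkable V T R (\<phi> ` I)"
  using assms unfolding linkage_rep_def by auto

lemma linkage_repI:
  fixes V :: "nat set"
  assumes "finite V" "T \<subseteq> V" "R \<subseteq> V \<times> V" "inj_on \<phi> E" "\<phi> ` E \<subseteq> V"
    "\<And>I. I \<subseteq> E \<Longrightarrow> ind I \<longleftrightarrow> linkable V T R (\<phi> ` I)"
  shows "linkage_rep E ind"
  unfolding linkage_rep_def using assms by (intro exI[of _ V] exI[of _ T] exI[of _ R] exI[of _ \<phi>]) auto

lemma linkage_rep_empty: "ind {} \<Longrightarrow> linkage_rep {} ind"
  by (rule linkage_repI[of "{}" "{}" "{}"]) (auto simp: linkable_def)

lemma linkage_rep_loop:
  assumes rep: "linkage_rep E ind" and e: "e \<notin> E"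
    and ind': "\<And>I. I \<subseteq> insert e E \<Longrightarrow> ind' I \<longleftrightarrow> e \<notin> I \<and> ind I"
  shows "linkage_rep (insert e E) ind'"
proof -
  obtain V :: "nat set" and T R \<phi> where r: "finite V" "T \<subseteq> V" "R \<subseteq> V \<times> V" "inj_on \<phi> E" "\<phi> ` E \<subseteq> V"
    "\<And>I. I \<subseteq> E \<Longrightarrow> ind I \<longleftrightarrow> linkable V T R (\<phi> ` I)"
    using rep by (rule linkage_repE) blast
  obtain x where x: "x \<notin> V" using r(1) ex_new_if_finite infinite_UNIV_nat by blast
  let ?\<phi> = "\<phi>(e := x)"
  have im: "?\<phi> ` I = \<phi> ` I" if "e \<notin> I" for I using that by auto
  show ?thesis
  \<comment> \<open>A vertex outside \<open>T\<close> without outgoing arcs reaches nothing. The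
    empty product only gives the arc set the shape that \<open>linkable_insert_source\<close>
    expects.\<close>
  proof (rule linkage_repI[of "insert x V" T "R \<union> {x} \<times> {}" ?\<phi>])
    show "inj_on ?\<phi> (insert e E)" using r(4,5) e x by (auto simp: inj_on_def)
    fix I assume I: "I \<subseteq> insert e E"
    have sub: "?\<phi> ` I \<subseteq> insert x V" using I r(5) by auto
    have xI: "x \<in> ?\<phi> ` I \<longleftrightarrow> e \<in> I" using I r(5) x by auto
    have "linkable V T R (?\<phi> ` I) \<longleftrightarrow> ind I" if "e \<notin> I"
      using that I im r(6)[of I] by auto
    then show "ind' I \<longleftrightarrow> linkable (insert x V) T (R \<union> {x} \<times> {}) (?\<phi> ` I)"
      unfolding linkable_insert_source[OF x r(2,3) empty_subsetI sub] ind'[OF I] xI by blast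
  qed (use r e in auto)
qed

lemma linkage_rep_coloop:
  assumes rep: "linkage_rep E ind" and e: "e \<notin> E"
    and ind': "\<And>I. I \<subseteq> insert e E \<Longrightarrow> ind' I \<longleftrightarrow> ind (I - {e})"
  shows "linkage_rep (insert e E) ind'"
proof -
  obtain V :: "nat set" and T R \<phi> where r: "finite V" "T \<subseteq> V" "R \<subseteq> V \<times> V" "inj_on \<phi> E" "\<phi> ` E \<subseteq> V"
    "\<And>I. I \<subseteq> E \<Longrightarrow> ind I \<longleftrightarrow> linkable V T R (\<phi> ` I)"
    using rep by (rule linkage_repE) blast
  obtain x where x: "x \<notin> V" using r(1) ex_new_if_finite infinite_UNIV_nat by blast
  let ?\<phi> = "\<phi>(e := x)"
  show ?thesis
  proof (rule linkage_repI[of "insert x V" "insert x T" R ?\<phi>])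
    show "inj_on ?\<phi> (insert e E)" using r(4,5) e x by (auto simp: inj_on_def)
    fix I assume I: "I \<subseteq> insert e E"
    have sub: "?\<phi> ` I \<subseteq> insert x V" using I r(5) by auto
    have im: "?\<phi> ` I - {x} = \<phi> ` (I - {e})" using I r(5) x by auto
    show "ind' I \<longleftrightarrow> linkable (insert x V) (insert x T) R (?\<phi> ` I)"
      unfolding linkable_insert_sink[OF x r(3) sub] ind'[OF I] im using I by (intro r(6)) auto
  qed (use r e in auto)
qed

text \<open>The new vertex has a single arc, to the vertex of \<open>p\<close>, so linking
  \<open>e\<close> blocks exactly what linking \<open>p\<close> would block.\<close>

lemma linkage_rep_parallel:
  assumes rep: "linkage_rep E ind" and e: "e \<notin> E" and p: "p \<in> E"
    and ind': "\<And>I. I \<subseteq> insert e E \<Longrightarrow> ind' I \<longleftrightarrow> (if e \<in> I then p \<notin> I \<and> ind (insert p (I - {e})) else ind I)"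
  shows "linkage_rep (insert e E) ind'"
proof -
  obtain V :: "nat set" and T R \<phi> where r: "finite V" "T \<subseteq> V" "R \<subseteq> V \<times> V" "inj_on \<phi> E" "\<phi> ` E \<subseteq> V"
    "\<And>I. I \<subseteq> E \<Longrightarrow> ind I \<longleftrightarrow> linkable V T R (\<phi> ` I)"
    using rep by (rule linkage_repE) blast
  obtain x where x: "x \<notin> V" using r(1) ex_new_if_finite infinite_UNIV_nat by blast
  let ?\<phi> = "\<phi>(e := x)"
  have N: "{\<phi> p} \<subseteq> V" using p r(5) by auto
  show ?thesis
  proof (rule linkage_repI[of "insert x V" T "R \<union> {x} \<times> {\<phi> p}" ?\<phi>])
    show inj: "inj_on ?\<phi> (insert e E)" using r(4,5) e x by (auto simp: inj_on_def)
    fix I assume I: "I \<subseteq> insert e E"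
    have sub: "?\<phi> ` I \<subseteq> insert x V" using I r(5) by auto
    have xI: "x \<in> ?\<phi> ` I \<longleftrightarrow> e \<in> I" using I r(5) x by auto
    have pI: "\<phi> p \<in> ?\<phi> ` I \<longleftrightarrow> p \<in> I"
      using inj_on_image_mem_iff[OF inj, of p I] I p e by auto
    have im: "?\<phi> ` I - {x} = \<phi> ` (I - {e})" using I r(5) x by auto
    have i1: "linkable V T R (insert (\<phi> p) (?\<phi> ` I - {x})) \<longleftrightarrow> ind (insert p (I - {e}))"
      unfolding im using r(6)[of "insert p (I - {e})"] I p by auto
    have i2: "linkable V T R (?\<phi> ` I) \<longleftrightarrow> ind I" if "e \<notin> I"
    proof -
      have "?\<phi> ` I = \<phi> ` I" using that by auto
      then show ?thesis using r(6)[of I] I that by auto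
    qed
    have i3: "ind I" if "ind (insert p (I - {e}))" "e \<notin> I"
    proof -
      have "insert p (I - {e}) \<subseteq> E" "I \<subseteq> E" using I p that(2) by auto
      moreover have "\<phi> ` I \<subseteq> \<phi> ` insert p (I - {e})" using that(2) by auto
      ultimately show ?thesis using r(6) that(1) linkable_mono by metis
    qed
    show "ind' I \<longleftrightarrow> linkable (insert x V) T (R \<union> {x} \<times> {\<phi> p}) (?\<phi> ` I)"
      unfolding linkable_insert_source[OF x r(2,3) N sub] ind'[OF I] xI bex_simps pI i1
      using i2 i3 pI i1 by auto
  qed (use r e N in auto)
qed

text \<open>Two vertices are new: a sink \<open>y\<close> for \<open>e\<close>, and a source
  \<open>x\<close> that takes over the role of \<open>p\<close> and may step to \<open>y\<close> or
  to the old vertex of \<open>p\<close>. While \<open>e\<close> is absent, \<open>x\<close> can use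
  \<open>y\<close> at no cost; when both are present, \<open>x\<close> has to continue at the old
  vertex.\<close>

lemma linkage_rep_series:
  assumes rep: "linkage_rep E ind" and e: "e \<notin> E" and p: "p \<in> E"
    and ind': "\<And>I. I \<subseteq> insert e E \<Longrightarrow> ind' I \<longleftrightarrow> (if e \<in> I \<and> p \<in> I then ind (I - {e}) else ind (I - {e, p}))"
  shows "linkage_rep (insert e E) ind'"
proof -
  obtain V :: "nat set" and T R \<phi> where r: "finite V" "T \<subseteq> V" "R \<subseteq> V \<times> V" "inj_on \<phi> E" "\<phi> ` E \<subseteq> V"
    "\<And>I. I \<subseteq> E \<Longrightarrow> ind I \<longleftrightarrow> linkable V T R (\<phi> ` I)"
    using rep by (rule linkage_repE) blast
  obtain y where y: "y \<notin> V" using r(1) ex_new_if_finite infinite_UNIV_nat by blast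
  obtain x where x: "x \<notin> insert y V" using r(1) ex_new_if_finite[of "insert y V"] infinite_UNIV_nat by blast
  let ?\<phi> = "\<phi>(p := x, e := y)" and ?V = "insert y V" and ?T = "insert y T"
  have ep: "e \<noteq> p" using e p by auto
  have N: "{\<phi> p, y} \<subseteq> ?V" using p r(5) by auto
  have T': "?T \<subseteq> ?V" and R': "R \<subseteq> ?V \<times> ?V" using r by auto
  show ?thesis
  proof (rule linkage_repI[of "insert x ?V" ?T "R \<union> {x} \<times> {\<phi> p, y}" ?\<phi>])
    show inj: "inj_on ?\<phi> (insert e E)" using r(4,5) e p x y by (auto simp: inj_on_def)
    show "?\<phi> ` insert e E \<subseteq> insert x ?V" using r(5) by auto
    fix I assume I: "I \<subseteq> insert e E"
    let ?J = "\<phi> ` (I - {e, p})"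
    have J: "?J \<subseteq> V" "I - {e, p} \<subseteq> E" using I r(5) by auto
    have sub: "?\<phi> ` I \<subseteq> insert x ?V" using I r(5) by auto
    have im: "?\<phi> ` I = ?J \<union> (if p \<in> I then {x} else {}) \<union> (if e \<in> I then {y} else {})"
      using ep by auto
    have xI: "x \<in> ?\<phi> ` I \<longleftrightarrow> p \<in> I" and yI: "y \<in> ?\<phi> ` I \<longleftrightarrow> e \<in> I"
      unfolding im using J x y by auto
    have "\<phi> p \<notin> ?J"
    proof
      assume "\<phi> p \<in> ?J"
      then obtain q where "\<phi> p = \<phi> q" "q \<in> I - {e, p}" by (rule imageE)
      then show False using inj_onD[OF r(4), of q p] J(2) p by auto
    qed
    then have pI: "\<phi> p \<notin> ?\<phi> ` I" unfolding im using x y p r(5) by auto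
    have sink: "linkable ?V ?T R K \<longleftrightarrow> linkable V T R (K - {y})" if "K \<subseteq> ?V" for K
      using linkable_insert_sink[OF y r(3) that] .
    have J': "?\<phi> ` I - {x} - {y} = ?J" unfolding im using J x y by auto
    have s1: "linkable ?V ?T R (?\<phi> ` I) \<longleftrightarrow> ind (I - {e, p})" if "p \<notin> I"
    proof -
      have "?\<phi> ` I \<subseteq> ?V" unfolding im using that J by auto
      moreover have "?\<phi> ` I - {y} = ?J" unfolding im using that J y by auto
      ultimately show ?thesis using sink r(6)[OF J(2)] by simp
    qed
    have s2: "linkable ?V ?T R (insert y (?\<phi> ` I - {x})) \<longleftrightarrow> ind (I - {e, p})"
    proof -
      have "insert y (?\<phi> ` I - {x}) \<subseteq> ?V" using sub by auto
      moreover have "insert y (?\<phi> ` I - {x}) - {y} = ?J" using J' by auto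
      ultimately show ?thesis using sink r(6)[OF J(2)] by simp
    qed
    have s3: "linkable ?V ?T R (insert (\<phi> p) (?\<phi> ` I - {x})) \<longleftrightarrow> ind (insert p (I - {e}))"
    proof -
      have "insert (\<phi> p) (?\<phi> ` I - {x}) \<subseteq> ?V" using sub N by auto
      moreover have "insert (\<phi> p) (?\<phi> ` I - {x}) - {y} = \<phi> ` insert p (I - {e})" using J' N y p r(5) by auto
      moreover have "insert p (I - {e}) \<subseteq> E" using I p by auto
      ultimately show ?thesis using sink r(6)[of "insert p (I - {e})"] by simp
    qed
    have s4: "ind (I - {e, p})" if "ind (insert p (I - {e}))"
    proof -
      have "insert p (I - {e}) \<subseteq> E" using I p by auto
      moreover have "?J \<subseteq> \<phi> ` insert p (I - {e})" by auto
      ultimately show ?thesis using r(6) J(2) that linkable_mono by metis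
    qed
    have s5: "insert p (I - {e}) = I - {e}" if "p \<in> I" using that ep by auto
    show "ind' I \<longleftrightarrow> linkable (insert x ?V) ?T (R \<union> {x} \<times> {\<phi> p, y}) (?\<phi> ` I)"
      unfolding linkable_insert_source[OF x T' R' N sub] ind'[OF I] xI
      using s1 s2 s3 s4 s5 pI yI by auto
  qed (use r N in auto)
qed

lemma linkage_rep_space_loop:
  assumes "linkage_rep (E - {v}) (acyclic_in {z \<in> Z. v \<notin> z})" "v \<in> E" "{v} \<in> Z"
  shows "linkage_rep E (acyclic_in Z)"
proof -
  have "linkage_rep (insert v (E - {v})) (acyclic_in Z)"
  proof (rule linkage_rep_loop[OF assms(1)])
    fix I
    show "acyclic_in Z I \<longleftrightarrow> v \<notin> I \<and> acyclic_in {z \<in> Z. v \<notin> z} I"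
      using assms(3) unfolding acyclic_in_def by auto
  qed simp
  then show ?thesis using assms(2) by (simp add: insert_absorb)
qed

lemma linkage_rep_space_coloop:
  assumes "linkage_rep (E - {v}) (acyclic_in {z - {v} | z. z \<in> Z})" "v \<in> E" "\<And>z. z \<in> Z \<Longrightarrow> v \<notin> z"
  shows "linkage_rep E (acyclic_in Z)"
proof -
  have Z: "{z - {v} | z. z \<in> Z} = Z" using assms(3) by (auto intro: exI[of _ "_ :: 'a set"]) 
  have "linkage_rep (insert v (E - {v})) (acyclic_in Z)"
  proof (rule linkage_rep_coloop[OF assms(1)[unfolded Z]])
    fix I
    show "acyclic_in Z I \<longleftrightarrow> acyclic_in Z (I - {v})"
      using assms(3) unfolding acyclic_in_def by auto
  qed simp
  then show ?thesis using assms(2) by (simp add: insert_absorb)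
qed

text \<open>Adding the cycle \<open>{v, p}\<close> exchanges \<open>v\<close> and \<open>p\<close>
  in any cycle that contains exactly one of them.\<close>

lemma linkage_rep_space_parallel:
  assumes "linkage_rep (E - {v}) (acyclic_in {z \<in> Z. v \<notin> z})" "v \<in> E" "p \<in> E" "p \<noteq> v" "{v, p} \<in> Z"
    and sd: "\<And>x y. x \<in> Z \<Longrightarrow> y \<in> Z \<Longrightarrow> sym_diff x y \<in> Z"
  shows "linkage_rep E (acyclic_in Z)"
proof -
  let ?Z = "{z \<in> Z. v \<notin> z}"
  have "linkage_rep (insert v (E - {v})) (acyclic_in Z)"
  proof (rule linkage_rep_parallel[OF assms(1), of v p])
    fix I :: "'a set"
    have "acyclic_in Z I \<longleftrightarrow> acyclic_in ?Z I" if "v \<notin> I" using that unfolding acyclic_in_def by auto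
    moreover have "acyclic_in Z I \<longleftrightarrow> p \<notin> I \<and> acyclic_in ?Z (insert p (I - {v}))" if vI: "v \<in> I"
    proof (intro iffI conjI)
      assume a: "acyclic_in Z I"
      then show pI: "p \<notin> I" using acyclic_inD[OF a assms(5)] vI by auto
      show "acyclic_in ?Z (insert p (I - {v}))" unfolding acyclic_in_def
      proof (intro ballI impI)
        fix z assume z: "z \<in> ?Z" "z \<subseteq> insert p (I - {v})"
        show "z = {}"
        proof (cases "p \<in> z")
          case True
          then have "sym_diff z {v, p} = insert v (z - {p})" using z(1) assms(4) by auto
          then have "insert v (z - {p}) \<in> Z" using sd[OF _ assms(5), of z] z(1) by auto
          moreover have "insert v (z - {p}) \<subseteq> I" using z(2) vI by auto
          ultimately show ?thesis using acyclic_inD[OF a] by blast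
        next
          case False
          then have "z \<subseteq> I" using z(2) by auto
          then show ?thesis using acyclic_inD[OF a] z(1) by auto
        qed
      qed
    next
      assume a: "p \<notin> I \<and> acyclic_in ?Z (insert p (I - {v}))"
      show "acyclic_in Z I" unfolding acyclic_in_def
      proof (intro ballI impI)
        fix z assume z: "z \<in> Z" "z \<subseteq> I"
        show "z = {}"
        proof (cases "v \<in> z")
          case True
          have "p \<notin> z" using a z by auto
          then have "sym_diff z {v, p} = insert p (z - {v})" using True by auto
          then have "insert p (z - {v}) \<in> ?Z" using sd[OF z(1) assms(5)] assms(4) by auto
          moreover have "insert p (z - {v}) \<subseteq> insert p (I - {v})" using z(2) by auto
          ultimately show ?thesis using acyclic_inD[of ?Z] a by blast
        next
          case False
          then have "z \<in> ?Z" "z \<subseteq> insert p (I - {v})" using z by auto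
          then show ?thesis using acyclic_inD[of ?Z] a by blast
        qed
      qed
    qed
    ultimately show "acyclic_in Z I \<longleftrightarrow>
       (if v \<in> I then p \<notin> I \<and> acyclic_in ?Z (insert p (I - {v})) else acyclic_in ?Z I)" by auto
  qed (use assms in auto)
  then show ?thesis using assms(2) by (simp add: insert_absorb)
qed

text \<open>Contracting \<open>v\<close> loses nothing: whether a cycle contains \<open>v\<close>
  can be read off from \<open>p\<close>.\<close>

lemma linkage_rep_space_series:
  assumes "linkage_rep (E - {v}) (acyclic_in {z - {v} | z. z \<in> Z})" "v \<in> E" "p \<in> E" "p \<noteq> v"
    and vp: "\<And>z. z \<in> Z \<Longrightarrow> v \<in> z \<longleftrightarrow> p \<in> z"
  shows "linkage_rep E (acyclic_in Z)"
proof -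
  let ?Z = "{z - {v} | z. z \<in> Z}"
  have "linkage_rep (insert v (E - {v})) (acyclic_in Z)"
  proof (rule linkage_rep_series[OF assms(1), of v p])
    fix I :: "'a set"
    have Z: "acyclic_in ?Z J \<longleftrightarrow> (\<forall>z\<in>Z. z - {v} \<subseteq> J \<longrightarrow> z - {v} = {})" for J
      unfolding acyclic_in_def by auto
    have empty: "z - {v} = {} \<longleftrightarrow> z = {}" if "z \<in> Z" for z using vp[OF that] assms(4) by auto
    have "acyclic_in Z I \<longleftrightarrow> acyclic_in ?Z (I - {v})" if "v \<in> I"
    proof -
      have "z - {v} \<subseteq> I - {v} \<longleftrightarrow> z \<subseteq> I" for z using that by auto
      then show ?thesis unfolding Z unfolding acyclic_in_def using empty by auto
    qed
    moreover have "acyclic_in Z I \<longleftrightarrow> acyclic_in ?Z (I - {v, p})" if "\<not> (v \<in> I \<and> p \<in> I)"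
    proof -
      have "z - {v} \<subseteq> I - {v, p} \<longleftrightarrow> z \<subseteq> I" if z: "z \<in> Z" for z
        using \<open>\<not> (v \<in> I \<and> p \<in> I)\<close> vp[OF z] assms(4) by auto
      then show ?thesis unfolding Z unfolding acyclic_in_def using empty by auto
    qed
    ultimately show "acyclic_in Z I \<longleftrightarrow>
       (if v \<in> I \<and> p \<in> I then acyclic_in ?Z (I - {v}) else acyclic_in ?Z (I - {v, p}))" by auto
  qed (use assms in auto)
  then show ?thesis using assms(2) by (simp add: insert_absorb)
qed

section \<open>Bipartite graphs without long induced cycles and dominoes\<close>

definition induced_cycle :: "('a \<Rightarrow> 'a \<Rightarrow> bool) \<Rightarrow> 'a list \<Rightarrow> bool" where
  "induced_cycle adj hs \<longleftrightarrow> distinct hs \<and>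
     (\<forall>i j. i < j \<longrightarrow> j < length hs \<longrightarrow> (adj (hs ! i) (hs ! j) \<longleftrightarrow> j = Suc i \<or> i = 0 \<and> Suc j = length hs))"

definition induced_path :: "('a \<Rightarrow> 'a \<Rightarrow> bool) \<Rightarrow> 'a list \<Rightarrow> bool" where
  "induced_path adj ps \<longleftrightarrow> distinct ps \<and>
     (\<forall>i j. i < j \<longrightarrow> j < length ps \<longrightarrow> (adj (ps ! i) (ps ! j) \<longleftrightarrow> j = Suc i))"

text \<open>In a bipartite graph the three long diagonals are the only possible chords of a hexagon;
  here exactly one of them is present.\<close>

definition is_domino :: "('a \<Rightarrow> 'a \<Rightarrow> bool) \<Rightarrow> 'a \<Rightarrow> 'a \<Rightarrow> 'a \<Rightarrow> 'a \<Rightarrow> 'a \<Rightarrow> 'a \<Rightarrow> bool" where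
  "is_domino adj q0 q1 q2 q3 q4 q5 \<longleftrightarrow>
     adj q0 q1 \<and> adj q1 q2 \<and> adj q2 q3 \<and> adj q3 q4 \<and> adj q4 q5 \<and> adj q5 q0 \<and>
     adj q0 q3 \<and> \<not> adj q1 q4 \<and> \<not> adj q2 q5"

text \<open>For bipartite graphs this is the forbidden-subgraph description of distance-hereditary
  graphs.\<close>

definition domino_hole_free :: "('a \<Rightarrow> 'a \<Rightarrow> bool) \<Rightarrow> 'a set \<Rightarrow> bool" where
  "domino_hole_free adj V \<longleftrightarrow>
     (\<forall>hs. induced_cycle adj hs \<longrightarrow> set hs \<subseteq> V \<longrightarrow> length hs < 6) \<and>
     (\<forall>q0 q1 q2 q3 q4 q5. {q0, q1, q2, q3, q4, q5} \<subseteq> V \<longrightarrow> \<not> is_domino adj q0 q1 q2 q3 q4 q5)"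

lemma domino_hole_free_subset: "domino_hole_free adj V \<Longrightarrow> U \<subseteq> V \<Longrightarrow> domino_hole_free adj U"
  unfolding domino_hole_free_def by (meson subset_trans)

lemma induced_path_Cons:
  assumes "induced_path adj q" "x \<notin> set q" "\<And>j. j < length q \<Longrightarrow> adj x (q ! j) \<longleftrightarrow> j = 0"
  shows "induced_path adj (x # q)"
  unfolding induced_path_def
proof (intro conjI allI impI)
  show "distinct (x # q)" using assms unfolding induced_path_def by simp
  fix i j assume "i < j" "j < length (x # q)"
  then show "adj ((x # q) ! i) ((x # q) ! j) \<longleftrightarrow> j = Suc i"
    using assms unfolding induced_path_def by (cases i; cases j) auto
qed

lemma induced_path_snoc:
  assumes "induced_path adj q" "y \<notin> set q" "\<And>j. j < length q \<Longrightarrow> adj (q ! j) y \<longleftrightarrow> Suc j = length q"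
  shows "induced_path adj (q @ [y])"
  unfolding induced_path_def
proof (intro conjI allI impI)
  show "distinct (q @ [y])" using assms unfolding induced_path_def by simp
  fix i j assume ij: "i < j" "j < length (q @ [y])"
  show "adj ((q @ [y]) ! i) ((q @ [y]) ! j) \<longleftrightarrow> j = Suc i"
  proof (cases "j < length q")
    case True
    then show ?thesis using assms(1) ij unfolding induced_path_def by (simp add: nth_append)
  next
    case False
    then have "j = length q" using ij by simp
    then show ?thesis using assms(3)[of i] ij by (auto simp: nth_append)
  qed
qed

lemma induced_cycle_Cons:
  assumes "induced_path adj q" "v \<notin> set q"
    "\<And>j. j < length q \<Longrightarrow> adj v (q ! j) \<longleftrightarrow> j = 0 \<or> Suc j = length q"
  shows "induced_cycle adj (v # q)"
  unfolding induced_cycle_def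
proof (intro conjI allI impI)
  show "distinct (v # q)" using assms unfolding induced_path_def by simp
  fix i j assume "i < j" "j < length (v # q)"
  then show "adj ((v # q) ! i) ((v # q) ! j) \<longleftrightarrow> j = Suc i \<or> i = 0 \<and> Suc j = length (v # q)"
    using assms unfolding induced_path_def by (cases i; cases j) auto
qed

section \<open>Distance levels from a root\<close>

text \<open>What the argument uses of the distance \<open>d\<close> from \<open>u\<close> inside the
  component \<open>W\<close>. That no edge stays within a level reflects bipartiteness.\<close>

locale bipartite_levels =
  fixes adj :: "'a \<Rightarrow> 'a \<Rightarrow> bool" and W :: "'a set" and u :: 'a and d :: "'a \<Rightarrow> nat"
  assumes sym: "adj v w \<Longrightarrow> adj w v"
    and root: "v \<in> W \<Longrightarrow> d v = 0 \<Longrightarrow> v = u"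
    and parent: "v \<in> W \<Longrightarrow> d v = Suc n \<Longrightarrow> \<exists>w\<in>W. adj v w \<and> d w = n"
    and step: "v \<in> W \<Longrightarrow> w \<in> W \<Longrightarrow> adj v w \<Longrightarrow> d w = Suc (d v) \<or> d v = Suc (d w)"
    and free: "domino_hole_free adj W"
begin

text \<open>Descend from both ends to parents until a common parent appears; the path stays induced
  because edges join consecutive levels only. Level 0 is the root alone, so two distinct vertices
  never get there. The interior is a single common parent or has at least three vertices, which is
  long enough to be closed to a hole.\<close>

lemma path_below:
  assumes "x \<in> W" "y \<in> W" "d x = k" "d y = k" "x \<noteq> y"
  shows "\<exists>ps. induced_path adj (x # ps @ [y]) \<and> (\<forall>v\<in>set ps. v \<in> W \<and> d v < k) \<and>
    ((\<exists>c. ps = [c]) \<or> 3 \<le> length ps)"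
  using assms
proof (induction k arbitrary: x y)
  case 0
  then show ?case using root by blast
next
  case (Suc k)
  have nxy: "\<not> adj x y" using step[of x y] Suc.prems by auto
  show ?case
  proof (cases "\<exists>c\<in>W. adj x c \<and> adj y c \<and> d c = k")
    case True
    then obtain c where c: "c \<in> W" "adj x c" "adj y c" "d c = k" by blast
    have "c \<noteq> y" "x \<noteq> c" using c Suc.prems by auto
    then have "induced_path adj [c, y]"
      unfolding induced_path_def using sym[OF c(3)] by (auto simp: less_Suc_eq)
    then have "induced_path adj [x, c, y]"
      by (rule induced_path_Cons) (use c nxy Suc.prems \<open>x \<noteq> c\<close> in \<open>auto simp: less_Suc_eq\<close>)
    then show ?thesis using c by (intro exI[of _ "[c]"]) auto
  next
    case False
    obtain a where a: "a \<in> W" "adj x a" "d a = k" using parent Suc.prems by blast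
    obtain b where b: "b \<in> W" "adj y b" "d b = k" using parent Suc.prems by blast
    have "a \<noteq> b" using False a b by blast
    then obtain ps where ps: "induced_path adj (a # ps @ [b])" "\<forall>v\<in>set ps. v \<in> W \<and> d v < k"
      "(\<exists>c. ps = [c]) \<or> 3 \<le> length ps"
      using Suc.IH[OF a(1) b(1) a(3) b(3)] by blast
    let ?q = "a # ps @ [b]"
    have low: "d v \<le> k" "v \<in> W" if "v \<in> set ?q" for v using that a b ps(2) by auto
    have cases: "j = 0 \<and> ?q ! j = a \<or> Suc j = length ?q \<and> ?q ! j = b \<and> j \<noteq> 0 \<or> j \<noteq> 0 \<and> Suc j \<noteq> length ?q \<and> ?q ! j \<in> set ps"
      if "j < length ?q" for j
      using that by (cases j) (auto simp: nth_append)
    have far: "\<not> adj z v" if "v \<in> set ps" "z \<in> W" "d z = Suc k" for v z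
      using step[of z v] that ps(2) by auto
    have "induced_path adj (x # ?q)"
    proof (rule induced_path_Cons[OF ps(1)])
      show "x \<notin> set ?q" using low Suc.prems by fastforce
      have "\<not> adj x b" using False b by blast
      then show "adj x (?q ! j) \<longleftrightarrow> j = 0" if "j < length ?q" for j
        using cases[OF that] a far Suc.prems by auto
    qed
    then have "induced_path adj ((x # ?q) @ [y])"
    proof (rule induced_path_snoc)
      show "y \<notin> set (x # ?q)" using low Suc.prems by fastforce
      have "\<not> adj a y" using False a sym by blast
      moreover have "\<not> adj v y" if "v \<in> set ps" for v using far[OF that] Suc.prems sym by blast
      ultimately have "adj (?q ! j) y \<longleftrightarrow> Suc j = length ?q" if "j < length ?q" for j
        using cases[OF that] sym[OF b(2)] by auto
      then show "adj ((x # ?q) ! j) y \<longleftrightarrow> Suc j = length (x # ?q)" if "j < length (x # ?q)" for j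
        using that nxy by (cases j) auto
    qed
    then show ?thesis using ps low by (intro exI[of _ ?q]) fastforce
  qed
qed

text \<open>The child \<open>v\<close> closes the path from \<open>path_below\<close> to an induced
  cycle with \<open>length ps + 3\<close> vertices, so an interior of three or more would give a
  forbidden hole.\<close>

lemma common_parent:
  assumes x: "x \<in> W" "d x = k" and y: "y \<in> W" "d y = k" and xy: "x \<noteq> y"
    and v: "v \<in> W" "adj x v" "adj y v" "d v = Suc k"
  shows "\<exists>c\<in>W. adj x c \<and> adj y c \<and> Suc (d c) = k"
proof -
  obtain ps where ps: "induced_path adj (x # ps @ [y])" "\<And>w. w \<in> set ps \<Longrightarrow> w \<in> W \<and> d w < k"
    "(\<exists>c. ps = [c]) \<or> 3 \<le> length ps"
    using path_below[OF x(1) y(1) x(2) y(2) xy] by blast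
  let ?q = "x # ps @ [y]"
  have "induced_cycle adj (v # ?q)"
  proof (rule induced_cycle_Cons[OF ps(1)])
    show "v \<notin> set ?q" using x y v ps(2) by fastforce
    have far: "\<not> adj v w" if "w \<in> set ps" for w using step[of v w] ps(2)[OF that] v by auto
    show "adj v (?q ! j) \<longleftrightarrow> j = 0 \<or> Suc j = length ?q" if "j < length ?q" for j
      using that far v sym by (cases j) (auto simp: nth_append)
  qed
  moreover have "set (v # ?q) \<subseteq> W" using x y v ps(2) by auto
  ultimately have "length (v # ?q) < 6" using free unfolding domino_hole_free_def by blast
  then have "\<not> 3 \<le> length ps" by simp
  then obtain c where c: "ps = [c]" using ps(3) by blast
  have "induced_path adj [x, c, y]" using ps(1) c by simp
  then have "\<forall>i j. i < j \<longrightarrow> j < 3 \<longrightarrow> (adj ([x, c, y] ! i) ([x, c, y] ! j) \<longleftrightarrow> j = Suc i)"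
    unfolding induced_path_def by (simp add: numeral_3_eq_3)
  from this[rule_format, of 0 1] this[rule_format, of 1 2] have "adj x c" "adj c y" by simp_all
  moreover have "c \<in> W" "d c < k" using ps(2) c by auto
  ultimately show ?thesis using step[of x c] x sym by force
qed

text \<open>If \<open>a\<close> is seen by \<open>x\<close> alone, take a common parent
  \<open>c\<close> of \<open>x\<close> and \<open>y\<close>. Since \<open>x\<close> is a common
  child of \<open>a\<close> and \<open>c\<close>, induction one level down gives these a common
  parent \<open>e\<close>, and the hexagon \<open>x, v, y, c, e, a\<close> has the chord from
  \<open>x\<close> to \<open>c\<close> as its only chord.\<close>

lemma parents_eq:
  assumes "x \<in> W" "y \<in> W" "d x = k" "d y = k" "v \<in> W" "adj x v" "adj y v" "d v = Suc k"
    "a \<in> W" "adj x a" "Suc (d a) = k"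
  shows "adj y a"
  using assms
proof (induction k arbitrary: x y v a rule: less_induct)
  case (less k)
  show ?case
  proof (rule ccontr)
    assume ya: "\<not> adj y a"
    then have "x \<noteq> y" using less.prems by auto
    then obtain c where c: "c \<in> W" "adj x c" "adj y c" "Suc (d c) = k"
      using common_parent less.prems by blast
    have "a \<noteq> c" using ya c by auto
    \<comment> \<open>On level 0 both \<open>a\<close> and \<open>c\<close> would be the
      root.\<close>
    have "d c \<noteq> 0" using root[OF c(1)] root[of a] less.prems(9,11) c(4) \<open>a \<noteq> c\<close> by auto
    then obtain e where e: "e \<in> W" "adj c e" "Suc (d e) = d c" using parent[OF c(1)] by (metis not0_implies_Suc)
    have "adj a e"
      using less.IH[of "d c" c a x e] c e less.prems sym by auto
    moreover have "\<not> adj v e" using step[of v e] e(1,3) c(4) less.prems by auto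
    ultimately have "is_domino adj x v y c e a"
      unfolding is_domino_def using less.prems c e ya sym by blast
    then show False using free less.prems c e unfolding domino_hole_free_def by blast
  qed
qed

text \<open>A parent \<open>e\<close> of the common neighbour \<open>c\<close> is, by
  \<open>parents_eq\<close>, also a parent of the private neighbours \<open>a\<close> and
  \<open>b\<close>, so the hexagon \<open>e, a, v, c, w, b\<close> has the single chord from
  \<open>e\<close> to \<open>c\<close>. Hence neighbourhoods in the level below that meet are
  nested.\<close>

lemma top_level_nested:
  assumes v: "v \<in> W" "d v = m" and w: "w \<in> W" "d w = m"
    and a: "a \<in> W" "adj v a" "\<not> adj w a" "Suc (d a) = m"
    and b: "b \<in> W" "adj w b" "\<not> adj v b" "Suc (d b) = m"
    and c: "c \<in> W" "adj v c" "adj w c" "Suc (d c) = m"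
  shows False
proof -
  have "a \<noteq> b" using a b by auto
  then have "d a \<noteq> 0 \<or> d b \<noteq> 0" using root[OF a(1)] root[OF b(1)] by metis
  then have "d c \<noteq> 0" using a(4) b(4) c(4) by auto
  then obtain e where e: "e \<in> W" "adj c e" "Suc (d e) = d c" using parent[OF c(1)] by (metis not0_implies_Suc)
  have "adj a e" "adj b e"
    using parents_eq[OF c(1) a(1) refl _ v(1) sym[OF c(2)] sym[OF a(2)] _ e]
      parents_eq[OF c(1) b(1) refl _ w(1) sym[OF c(3)] sym[OF b(2)] _ e] a b c v w by auto
  then have "is_domino adj e a v c w b"
    unfolding is_domino_def using a b c e sym by blast
  then show False using free a b c e v w unfolding domino_hole_free_def by blast
qed

end

lemma ex_bipartite_levels:
  assumes sym: "\<And>v w. adj v w \<Longrightarrow> adj w v" and bip: "\<And>v w. adj v w \<Longrightarrow> (v \<in> P) \<noteq> (w \<in> P)"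
    and free: "domino_hole_free adj V" and u: "u \<in> V"
  obtains W d where "bipartite_levels adj W u d" "u \<in> W" "W \<subseteq> V"
    "\<And>v w. v \<in> W \<Longrightarrow> w \<in> V \<Longrightarrow> adj v w \<Longrightarrow> w \<in> W"
proof -
  define R where "R = {(v, w). v \<in> V \<and> w \<in> V \<and> adj v w}"
  define W where "W = {v. \<exists>n. (u, v) \<in> R ^^ n}"
  define d where "d v = (LEAST n. (u, v) \<in> R ^^ n)" for v
  have inV: "v \<in> V" if "(u, v) \<in> R ^^ n" for v n
    using that u by (cases n) (auto simp: R_def)
  \<comment> \<open>The side of a vertex fixes the parity of every walk to it from \<open>u\<close>,
    so adjacent vertices never have equal distance.\<close>
  have par: "(v \<in> P) \<longleftrightarrow> ((u \<in> P) \<noteq> odd n)" if "(u, v) \<in> R ^^ n" for v n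
    using that
  proof (induction n arbitrary: v)
    case (Suc n)
    then obtain w where w: "(u, w) \<in> R ^^ n" "(w, v) \<in> R" by auto
    then show ?case using Suc.IH[OF w(1)] bip[of w v] unfolding R_def by auto
  qed auto
  have dW: "(u, v) \<in> R ^^ d v" if "v \<in> W" for v
    using that unfolding W_def d_def by (auto intro: LeastI_ex)
  have dle: "d v \<le> n" if "(u, v) \<in> R ^^ n" for v n
    unfolding d_def using that by (rule Least_le)
  have closed: "w \<in> W \<and> d w \<le> Suc (d v)" if "v \<in> W" "w \<in> V" "adj v w" for v w
  proof -
    have "(v, w) \<in> R" using that dW inV unfolding R_def by blast
    then have "(u, w) \<in> R ^^ Suc (d v)" using dW[OF that(1)] by auto
    then show ?thesis using dle unfolding W_def by blast
  qed
  have WV: "W \<subseteq> V" using inV dW by blast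
  have "bipartite_levels adj W u d"
  proof
    show "adj v w \<Longrightarrow> adj w v" for v w by (rule sym)
    show "v = u" if "v \<in> W" "d v = 0" for v using dW[OF that(1)] that(2) by simp
    show "domino_hole_free adj W" by (rule domino_hole_free_subset[OF free WV])
    show "\<exists>w\<in>W. adj v w \<and> d w = n" if v: "v \<in> W" "d v = Suc n" for v n
    proof -
      obtain w where w: "(u, w) \<in> R ^^ n" "(w, v) \<in> R" using dW[OF v(1)] v(2) by auto
      then have wW: "w \<in> W" "adj w v" unfolding W_def R_def by auto
      have "d v \<le> Suc (d w)" using closed[OF wW(1) _ wW(2)] v(1) WV by blast
      then have "d w = n" using dle[OF w(1)] v(2) by simp
      then show ?thesis using wW sym by blast
    qed
    show "d w = Suc (d v) \<or> d v = Suc (d w)" if vw: "v \<in> W" "w \<in> W" "adj v w" for v w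
    proof -
      have "d w \<le> Suc (d v)" "d v \<le> Suc (d w)" using closed vw sym WV by blast+
      moreover have "d v \<noteq> d w" using par[OF dW[OF vw(1)]] par[OF dW[OF vw(2)]] bip[OF vw(3)] by auto
      ultimately show ?thesis by linarith
    qed
  qed
  moreover have "u \<in> W" unfolding W_def by (auto intro: exI[of _ 0])
  ultimately show ?thesis using that WV closed by blast
qed

text \<open>Take \<open>v\<close> on the last level with as few neighbours as possible. If it has at
  least two, any two of them are twins: they agree on the level below them by
  \<open>parents_eq\<close>, and a vertex on the last level adjacent to only one of them would, by
  nesting, have a properly smaller neighbourhood than \<open>v\<close>.\<close>

lemma domino_hole_free_reducible:
  assumes fin: "finite V" and ne: "V \<noteq> {}"
    and sym: "\<And>v w. adj v w \<Longrightarrow> adj w v" and bip: "\<And>v w. adj v w \<Longrightarrow> (v \<in> P) \<noteq> (w \<in> P)"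
    and free: "domino_hole_free adj V"
  shows "\<exists>v\<in>V. (\<forall>w\<in>V. \<not> adj v w) \<or>
    (\<exists>p\<in>V. p \<noteq> v \<and> ((\<forall>w\<in>V. adj v w \<longleftrightarrow> w = p) \<or> (\<forall>w\<in>V. adj v w \<longleftrightarrow> adj p w)))"
proof -
  obtain u where u: "u \<in> V" using ne by blast
  obtain W d where L: "bipartite_levels adj W u d" and W: "u \<in> W" "W \<subseteq> V"
    "\<And>v w. v \<in> W \<Longrightarrow> w \<in> V \<Longrightarrow> adj v w \<Longrightarrow> w \<in> W"
    using ex_bipartite_levels[OF sym bip free u] by blast
  interpret bipartite_levels adj W u d by (rule L)
  have finW: "finite W" using W(2) fin finite_subset by blast
  define m where "m = Max (d ` W)"
  have dm: "d v \<le> m" if "v \<in> W" for v using that finW unfolding m_def by simp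
  have "m \<in> d ` W" unfolding m_def using finW W(1) by (intro Max_in) auto
  then have "{v \<in> W. d v = m} \<noteq> {}" by auto
  then obtain v where v: "v \<in> W" "d v = m"
    and min: "\<And>w. w \<in> W \<Longrightarrow> d w = m \<Longrightarrow> card {x \<in> W. adj v x} \<le> card {x \<in> W. adj w x}"
    using ex_min_if_finite[of "(\<lambda>v. card {x \<in> W. adj v x}) ` {v \<in> W. d v = m}"] finW
    by (auto simp: not_less)
  have down: "Suc (d x) = m" if "w \<in> W" "d w = m" "x \<in> W" "adj w x" for w x
    using step[OF that(1,3,4)] dm[OF that(3)] that(2) by auto
  let ?N = "{x \<in> W. adj v x}"
  consider "?N = {}" | x where "?N = {x}" | x y where "x \<in> ?N" "y \<in> ?N" "x \<noteq> y" by blast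
  then show ?thesis
  proof cases
    case 1
    then show ?thesis using W v by blast
  next
    case (2 x)
    have "x \<noteq> v" "x \<in> V" using 2 bip W by auto
    moreover have "\<forall>w\<in>V. adj v w \<longleftrightarrow> w = x" using 2 W v by blast
    ultimately show ?thesis using W v by blast
  next
    case (3 x y)
    have sub: "adj y' w" if xy: "x' \<in> ?N" "y' \<in> ?N" and w: "w \<in> V" "adj x' w" for x' y' w
    proof -
      have x': "x' \<in> W" "Suc (d x') = m" "adj x' v" and y': "y' \<in> W" "Suc (d y') = m" "adj y' v"
        using xy down v sym by auto
      have wW: "w \<in> W" using W(3)[OF x'(1) w] .
      from step[OF x'(1) wW w(2)] show ?thesis
      proof
        assume "d x' = Suc (d w)"
        then have "d y' = d x'" "d v = Suc (d x')" "Suc (d w) = d x'" using x'(2) y'(2) v(2) by linarith+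
        from parents_eq[OF x'(1) y'(1) refl this(1) v(1) x'(3) y'(3) this(2) wW w(2) this(3)]
        show ?thesis .
      next
        assume "d w = Suc (d x')"
        then have dw: "d w = m" using x' by simp
        show ?thesis
        proof (rule ccontr)
          assume n: "\<not> adj y' w"
          then have n': "\<not> adj w y'" using sym by blast
          have "{x \<in> W. adj w x} \<subseteq> ?N"
          proof
            fix b assume b: "b \<in> {x \<in> W. adj w x}"
            show "b \<in> ?N"
            proof (rule ccontr)
              \<comment> \<open>Now \<open>y'\<close> is private to \<open>v\<close>,
                \<open>b\<close> is private to \<open>w\<close>, and \<open>x'\<close> is common to
                both.\<close>
              assume "b \<notin> ?N"
              then show False
                using top_level_nested[OF v wW dw y'(1) _ n' y'(2) _ _ _ _ x'(1) _ _ x'(2), of b]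
                  xy b down[OF wW dw, of b] sym[OF w(2)] by auto
            qed
          qed
          moreover have "y' \<notin> {x \<in> W. adj w x}" using n' by blast
          ultimately have "{x \<in> W. adj w x} \<subset> ?N" using xy by blast
          then have "card {x \<in> W. adj w x} < card ?N" using finW by (intro psubset_card_mono) auto
          then show False using min[OF wW dw] by simp
        qed
      qed
    qed
    have "\<forall>w\<in>V. adj x w \<longleftrightarrow> adj y w" using sub 3 by blast
    moreover have "x \<in> V" "y \<in> V" using 3 W by auto
    ultimately show ?thesis using 3(3) by metis
  qed
qed

section \<open>Fundamental graphs\<close>

text \<open>\<open>P\<close> is a basis and \<open>adj\<close> the bipartite graph joining each element outside \<open>P\<close> to the rest of its
  fundamental circuit.\<close>

definition fundamental_space :: "('a \<Rightarrow> 'a \<Rightarrow> bool) \<Rightarrow> 'a set \<Rightarrow> 'a set \<Rightarrow> 'a set set" where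
  "fundamental_space adj P V =
     {z. z \<subseteq> V \<and> (\<forall>b\<in>V \<inter> P. b \<in> z \<longleftrightarrow> odd (card {e \<in> z - P. adj b e}))}"

lemma odd_card_Int_doubleton:
  assumes "a \<noteq> b"
  shows "odd (card (t \<inter> {a, b})) \<longleftrightarrow> (a \<in> t) \<noteq> (b \<in> t)"
proof -
  have "t \<inter> {a, b} = (if a \<in> t then {a} else {}) \<union> (if b \<in> t then {b} else {})" by auto
  then show ?thesis using assms by simp
qed

lemma odd_card_Int_tripleton:
  assumes "distinct [a, b, c]"
  shows "odd (card (t \<inter> {a, b, c})) \<longleftrightarrow> ((a \<in> t) \<noteq> (b \<in> t)) \<noteq> (c \<in> t)"
proof -
  have "t \<inter> {a, b, c} = (if a \<in> t then {a} else {}) \<union> (if b \<in> t then {b} else {}) \<union> (if c \<in> t then {c} else {})"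
    by auto
  then show ?thesis using assms by (auto simp: card_insert_if)
qed

lemma fundamental_spaceD:
  assumes "z \<in> fundamental_space adj P V"
  shows "z \<subseteq> V" "b \<in> V \<Longrightarrow> b \<in> P \<Longrightarrow> b \<in> z \<longleftrightarrow> odd (card {e \<in> z - P. adj b e})"
  using assms unfolding fundamental_space_def by blast+

lemma fundamental_spaceI:
  assumes "z \<subseteq> V" "\<And>b. b \<in> V \<Longrightarrow> b \<in> P \<Longrightarrow> b \<in> z \<longleftrightarrow> odd (card {e \<in> z - P. adj b e})"
  shows "z \<in> fundamental_space adj P V"
  using assms unfolding fundamental_space_def by blast

lemma cycle_space_fundamental:
  assumes fin: "finite V"
  shows "cycle_space V (fundamental_space adj P V)"
  unfolding cycle_space_def
proof (intro conjI ballI)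
  fix x y assume xy: "x \<in> fundamental_space adj P V" "y \<in> fundamental_space adj P V"
  then have xyV: "x \<subseteq> V" "y \<subseteq> V" unfolding fundamental_space_def by auto
  then have f: "finite x" "finite y" using fin finite_subset by auto
  have "b \<in> sym_diff x y \<longleftrightarrow> odd (card {e \<in> sym_diff x y - P. adj b e})" if b: "b \<in> V \<inter> P" for b
  proof -
    have "{e \<in> sym_diff x y - P. adj b e} = sym_diff {e \<in> x - P. adj b e} {e \<in> y - P. adj b e}" by auto
    then have "odd (card {e \<in> sym_diff x y - P. adj b e}) \<longleftrightarrow>
        odd (card {e \<in> x - P. adj b e}) \<noteq> odd (card {e \<in> y - P. adj b e})"
      using odd_card_sym_diff[of "{e \<in> x - P. adj b e}" "{e \<in> y - P. adj b e}"] f by simp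
    then show ?thesis using xy b unfolding fundamental_space_def by auto
  qed
  then show "sym_diff x y \<in> fundamental_space adj P V"
    using xyV unfolding fundamental_space_def by auto
qed (use fin in \<open>auto simp: fundamental_space_def\<close>)

lemma fundamental_space_delete:
  assumes "v \<notin> P"
  shows "fundamental_space adj P (V - {v}) = {z \<in> fundamental_space adj P V. v \<notin> z}"
proof -
  have "(V - {v}) \<inter> P = V \<inter> P" using assms by auto
  then show ?thesis unfolding fundamental_space_def by auto
qed

text \<open>A cycle is determined by its part outside \<open>P\<close>. A cycle on \<open>K\<close>
  therefore lifts uniquely: the contracted basis elements outside \<open>K\<close> are filled in by
  parity. Thus induced subgraphs of the fundamental graph are minors.\<close>

lemma fundamental_space_induced:
  assumes K: "K \<subseteq> V"
  shows "minor_space (fundamental_space adj P V) (V \<inter> P - K) (V - P - K) = fundamental_space adj P K"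
proof (intro set_eqI iffI)
  fix t assume "t \<in> minor_space (fundamental_space adj P V) (V \<inter> P - K) (V - P - K)"
  then obtain z where z: "z \<in> fundamental_space adj P V" "z \<inter> (V - P - K) = {}" "t = z - (V \<inter> P - K)"
    unfolding minor_space_def by auto
  have "z \<subseteq> V" using fundamental_spaceD(1)[OF z(1)] .
  then have tP: "t - P = z - P" and tK: "t \<subseteq> K" using z(2,3) by auto
  show "t \<in> fundamental_space adj P K"
  proof (rule fundamental_spaceI[OF tK])
    fix b assume b: "b \<in> K" "b \<in> P"
    then have "b \<in> t \<longleftrightarrow> b \<in> z" using z(3) by auto
    then show "b \<in> t \<longleftrightarrow> odd (card {e \<in> t - P. adj b e})"
      unfolding tP using fundamental_spaceD(2)[OF z(1), of b] b K by auto
  qed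
next
  fix t assume t: "t \<in> fundamental_space adj P K"
  define z where "z = t \<union> {b \<in> V \<inter> P - K. odd (card {e \<in> t - P. adj b e})}"
  have tK: "t \<subseteq> K" using fundamental_spaceD(1)[OF t] .
  have zP: "z - P = t - P" unfolding z_def by auto
  have "b \<in> z \<longleftrightarrow> odd (card {e \<in> z - P. adj b e})" if "b \<in> V" "b \<in> P" for b
  proof (cases "b \<in> K")
    case True
    then have "b \<in> z \<longleftrightarrow> b \<in> t" unfolding z_def by auto
    then show ?thesis unfolding zP using fundamental_spaceD(2)[OF t True that(2)] by simp
  next
    case False
    then have "b \<notin> t" using tK by auto
    then show ?thesis unfolding zP using False that unfolding z_def by simp
  qed
  moreover have "z \<subseteq> V" using tK K unfolding z_def by auto
  ultimately have "z \<in> fundamental_space adj P V" by (intro fundamental_spaceI)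
  moreover have "z \<inter> (V - P - K) = {}" "t = z - (V \<inter> P - K)" using tK unfolding z_def by auto
  ultimately show "t \<in> minor_space (fundamental_space adj P V) (V \<inter> P - K) (V - P - K)"
    unfolding minor_space_def by auto
qed

lemma fundamental_space_contract:
  assumes "v \<in> V" "v \<in> P"
  shows "fundamental_space adj P (V - {v}) = {z - {v} | z. z \<in> fundamental_space adj P V}"
proof -
  have *: "V \<inter> P - (V - {v}) = {v}" "V - P - (V - {v}) = {}" using assms by auto
  show ?thesis
    using fundamental_space_induced[of "V - {v}" V adj P] unfolding * minor_space_def by auto
qed

text \<open>An isolated vertex is a coloop if it lies in the basis \<open>P\<close> and a loop
  otherwise. A pendant or twin vertex \<open>v\<close> is in series with \<open>p\<close> if it lies
  in \<open>P\<close> and parallel to \<open>p\<close> otherwise. Contracting \<open>v\<close> in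
  the basis case, and deleting it in the other, removes just this vertex from the graph.\<close>

lemma linkage_rep_fundamental_space:
  assumes "finite V" "domino_hole_free adj V"
    and sym: "\<And>v w. adj v w \<Longrightarrow> adj w v" and bip: "\<And>v w. adj v w \<Longrightarrow> (v \<in> P) \<noteq> (w \<in> P)"
  shows "linkage_rep V (acyclic_in (fundamental_space adj P V))"
  using assms(1,2)
proof (induction "card V" arbitrary: V rule: less_induct)
  case less
  let ?Z = "fundamental_space adj P V"
  show ?case
  proof (cases "V = {}")
    case True
    then show ?thesis by (auto intro: linkage_rep_empty simp: acyclic_in_def)
  next
    case False
    then obtain v where v: "v \<in> V" and red: "(\<forall>w\<in>V. \<not> adj v w) \<or>
      (\<exists>p\<in>V. p \<noteq> v \<and> ((\<forall>w\<in>V. adj v w \<longleftrightarrow> w = p) \<or> (\<forall>w\<in>V. adj v w \<longleftrightarrow> adj p w)))"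
      using domino_hole_free_reducible[OF less.prems(1) _ sym bip less.prems(2)] by blast
    have IH: "linkage_rep (V - {v}) (acyclic_in (fundamental_space adj P (V - {v})))"
    proof (rule less.hyps)
      show "card (V - {v}) < card V" using v less.prems(1) by (rule card_Diff1_less[rotated])
    qed (use less.prems(1) domino_hole_free_subset[OF less.prems(2)] in auto)
    have mem: "b \<in> z \<longleftrightarrow> odd (card {e \<in> z - P. adj b e})" "z \<subseteq> V" if "z \<in> ?Z" "b \<in> V" "b \<in> P" for b z
      using fundamental_spaceD(2)[OF that(1,2,3)] fundamental_spaceD(1)[OF that(1)] by simp_all
    have sd: "sym_diff x y \<in> ?Z" if "x \<in> ?Z" "y \<in> ?Z" for x y
      using cycle_spaceD(4)[OF cycle_space_fundamental[OF less.prems(1)]] that .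
    consider (isolated) "\<forall>w\<in>V. \<not> adj v w"
      | (pendant) p where "p \<in> V" "p \<noteq> v" "\<forall>w\<in>V. adj v w \<longleftrightarrow> w = p"
      \<comment> \<open>The neighbour \<open>w\<close> puts \<open>v\<close> and \<open>p\<close> on
        the same side of the bipartition; if there is none, \<open>v\<close> is isolated.\<close>
      | (twin) p w where "p \<in> V" "p \<noteq> v" "\<forall>w\<in>V. adj v w \<longleftrightarrow> adj p w" "w \<in> V" "adj v w"
      using red by blast
    then show ?thesis
    proof cases
      case isolated
      show ?thesis
      proof (cases "v \<in> P")
        case True
        have "v \<notin> z" if z: "z \<in> ?Z" for z
        proof -
          have N: "{e \<in> z - P. adj v e} = {}" using isolated mem(2)[OF z v True] by auto
          show ?thesis using mem(1)[OF z v True] unfolding N by simp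
        qed
        then show ?thesis
          using linkage_rep_space_coloop[OF IH[unfolded fundamental_space_contract[OF v True]] v] by simp
      next
        case False
        have N: "{e \<in> {v} - P. adj b e} = {}" if "b \<in> V" for b using isolated that sym by auto
        have "{v} \<in> ?Z"
        proof (rule fundamental_spaceI)
          show "b \<in> {v} \<longleftrightarrow> odd (card {e \<in> {v} - P. adj b e})" if "b \<in> V" "b \<in> P" for b
            unfolding N[OF that(1)] using that(2) False by auto
        qed (use v in simp)
        then show ?thesis
          by (rule linkage_rep_space_loop[OF IH[unfolded fundamental_space_delete[OF False]] v])
      qed
    next
      case (pendant p)
      have vp: "(v \<in> P) \<noteq> (p \<in> P)" using bip pendant by auto
      show ?thesis
      proof (cases "v \<in> P")
        case True
        have "v \<in> z \<longleftrightarrow> p \<in> z" if z: "z \<in> ?Z" for z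
        proof -
          have N: "{e \<in> z - P. adj v e} = (if p \<in> z then {p} else {})"
            using pendant mem(2)[OF z v True] vp True by auto
          show ?thesis using mem(1)[OF z v True] unfolding N by simp
        qed
        then show ?thesis
          using linkage_rep_space_series[OF IH[unfolded fundamental_space_contract[OF v True]] v pendant(1,2)] by simp
      next
        case False
        have N: "{e \<in> {v, p} - P. adj b e} = (if b = p then {v} else {})" if "b \<in> V" for b
        proof -
          have "adj b v \<longleftrightarrow> b = p" using pendant(3) that sym by blast
          then show ?thesis using vp False by auto
        qed
        have "{v, p} \<in> ?Z"
        proof (rule fundamental_spaceI)
          show "b \<in> {v, p} \<longleftrightarrow> odd (card {e \<in> {v, p} - P. adj b e})" if "b \<in> V" "b \<in> P" for b
            unfolding N[OF that(1)] using that(2) False by auto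
        qed (use v pendant(1) in simp)
        then show ?thesis
          by (rule linkage_rep_space_parallel[OF IH[unfolded fundamental_space_delete[OF False]] v pendant(1,2) _ sd])
      qed
    next
      case (twin p w)
      have vp: "(v \<in> P) = (p \<in> P)" using bip[of v w] bip[of p w] twin by auto
      show ?thesis
      proof (cases "v \<in> P")
        case True
        have "v \<in> z \<longleftrightarrow> p \<in> z" if z: "z \<in> ?Z" for z
        proof -
          have N: "{e \<in> z - P. adj v e} = {e \<in> z - P. adj p e}"
            using twin(3) mem(2)[OF z v True] by auto
          have "p \<in> P" using vp True by simp
          show ?thesis unfolding mem(1)[OF z v True] mem(1)[OF z twin(1) \<open>p \<in> P\<close>] N ..
        qed
        then show ?thesis
          using linkage_rep_space_series[OF IH[unfolded fundamental_space_contract[OF v True]] v twin(1,2)] by simp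
      next
        case False
        have N: "{e \<in> {v, p} - P. adj b e} = (if adj b v then {v, p} else {})" if "b \<in> V" for b
        proof -
          have "adj b v \<longleftrightarrow> adj b p" using twin(3) that sym by blast
          then show ?thesis using vp False by auto
        qed
        have "{v, p} \<in> ?Z"
        proof (rule fundamental_spaceI)
          show "b \<in> {v, p} \<longleftrightarrow> odd (card {e \<in> {v, p} - P. adj b e})" if "b \<in> V" "b \<in> P" for b
            unfolding N[OF that(1)] using that(2) twin(2) vp False by auto
        qed (use v twin(1) in simp)
        then show ?thesis
          by (rule linkage_rep_space_parallel[OF IH[unfolded fundamental_space_delete[OF False]] v twin(1,2) _ sd])
      qed
    qed
  qed
qed

text \<open>Adding the circuit of an element outside \<open>P\<close> removes that element and
  otherwise changes only the part inside \<open>P\<close>. What is left at the end lies in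
  \<open>P\<close> and is empty.\<close>

lemma cycle_space_subset_if_fundamental_circuits:
  assumes Z: "cycle_space E Z" and Y: "cycle_space E Y"
    and PZ: "\<And>z. z \<in> Z \<Longrightarrow> z \<subseteq> P \<Longrightarrow> z = {}"
    and circ: "\<And>e. e \<in> E - P \<Longrightarrow> \<exists>c. c \<in> Z \<and> c \<in> Y \<and> e \<in> c \<and> c \<subseteq> insert e P"
  shows "Z \<subseteq> Y"
proof
  fix z assume "z \<in> Z"
  then show "z \<in> Y"
  proof (induction "card (z - P)" arbitrary: z rule: less_induct)
    case less
    show ?case
    proof (cases "z \<subseteq> P")
      case True
      then show ?thesis using PZ less.prems cycle_spaceD(2)[OF Y] by auto
    next
      case False
      then obtain e where e: "e \<in> z" "e \<notin> P" by auto
      then obtain c where c: "c \<in> Z" "c \<in> Y" "e \<in> c" "c \<subseteq> insert e P"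
        using circ[of e] cycle_spaceD(3)[OF Z less.prems] by auto
      have "sym_diff z c - P = z - P - {e}" using c e by auto
      moreover have "finite (z - P)" using cycle_spaceD(6)[OF Z less.prems] by simp
      ultimately have "card (sym_diff z c - P) < card (z - P)"
        using e card_Diff1_less[of "z - P" e] by auto
      then have "sym_diff z c \<in> Y" using less.hyps cycle_spaceD(4)[OF Z less.prems c(1)] by blast
      then have "sym_diff (sym_diff z c) c \<in> Y" using cycle_spaceD(4)[OF Y] c(2) by blast
      moreover have "sym_diff (sym_diff z c) c = z" by auto
      ultimately show ?thesis by simp
    qed
  qed
qed

text \<open>\<open>P\<close> is a basis and \<open>c x\<close> the fundamental circuit of
  \<open>x\<close>. Both spaces contain these circuits and no nonempty subset of \<open>P\<close>,
  so each contains the other.\<close>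

lemma ex_fundamental_space:
  assumes Z: "cycle_space E Z"
  obtains adj P where "\<And>v w. adj v w \<Longrightarrow> adj w v" "\<And>v w. adj v w \<Longrightarrow> (v \<in> P) \<noteq> (w \<in> P)"
    "Z = fundamental_space adj P E"
proof -
  obtain P where P: "P \<subseteq> E" "acyclic_in Z P" "\<And>x. x \<in> E - P \<Longrightarrow> \<exists>z\<in>Z. z \<subseteq> insert x P \<and> x \<in> z"
    using ex_maximal_acyclic[OF Z subset_refl] by blast
  then obtain c where c: "\<And>x. x \<in> E - P \<Longrightarrow> c x \<in> Z \<and> c x \<subseteq> insert x P \<and> x \<in> c x" by metis
  define adj where "adj v w \<longleftrightarrow> v \<in> P \<and> w \<in> E - P \<and> v \<in> c w \<or> w \<in> P \<and> v \<in> E - P \<and> w \<in> c v" for v w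
  let ?Y = "fundamental_space adj P E"
  have Y: "cycle_space E ?Y" using cycle_space_fundamental cycle_spaceD(1)[OF Z] by blast
  have cY: "c x \<in> ?Y" if x: "x \<in> E - P" for x
  proof -
    have "{e \<in> c x - P. adj b e} = (if b \<in> c x then {x} else {})" if "b \<in> P" for b
      using c[OF x] x that unfolding adj_def by auto
    then show ?thesis using cycle_spaceD(3)[OF Z, of "c x"] c[OF x] unfolding fundamental_space_def by auto
  qed
  have "z = {}" if "z \<in> ?Y" "z \<subseteq> P" for z
  proof -
    have *: "{e \<in> z - P. adj b e} = {}" for b using that(2) by auto
    have "b \<notin> z" if "b \<in> P" for b
      using fundamental_spaceD(2)[OF \<open>z \<in> ?Y\<close>, of b] that P(1) unfolding * by auto
    then show ?thesis using that(2) by auto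
  qed
  then have "?Y \<subseteq> Z"
    using cycle_space_subset_if_fundamental_circuits[OF Y Z, of P] c cY by blast
  moreover have "Z \<subseteq> ?Y"
    using cycle_space_subset_if_fundamental_circuits[OF Z Y, of P] c cY acyclic_inD[OF P(2)] by blast
  ultimately have "Z = ?Y" by blast
  moreover have "adj v w \<Longrightarrow> adj w v" "adj v w \<Longrightarrow> (v \<in> P) \<noteq> (w \<in> P)" for v w
    unfolding adj_def by auto
  ultimately show ?thesis using that by blast
qed

text \<open>A six-element minor whose cycles are described by \<open>\<phi>\<close> in terms of their characteristic functions along
  the enumeration \<open>k\<close>; only the first six values of the argument of \<open>\<phi>\<close> are meaningful.\<close>

definition has_pattern :: "'a set \<Rightarrow> 'a set set \<Rightarrow> ((nat \<Rightarrow> bool) \<Rightarrow> bool) \<Rightarrow> bool" where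
  "has_pattern E Z \<phi> \<longleftrightarrow>
     (\<exists>C D k. C \<subseteq> E \<and> D \<subseteq> E \<and> C \<inter> D = {} \<and> inj_on k {..<6::nat} \<and> E - C - D = k ` {..<6} \<and>
        (\<forall>z\<subseteq>k ` {..<6}. z \<in> minor_space Z C D \<longleftrightarrow> \<phi> (\<lambda>i. k i \<in> z)))"

lemma has_patternE:
  assumes "has_pattern E Z \<phi>"
  obtains C D k where "C \<subseteq> E" "D \<subseteq> E" "C \<inter> D = {}" "inj_on k {..<6::nat}" "E - C - D = k ` {..<6}"
    "\<And>z. z \<subseteq> k ` {..<6} \<Longrightarrow> z \<in> minor_space Z C D \<longleftrightarrow> \<phi> (\<lambda>i. k i \<in> z)"
  using assms unfolding has_pattern_def by auto

lemma lessThan_6: "{..<6::nat} = {0, 1, 2, 3, 4, 5}"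
  by auto

lemma has_patternI:
  assumes "C \<subseteq> E" "D \<subseteq> E" "C \<inter> D = {}" "distinct [k0, k1, k2, k3, k4, k5]" "E - C - D = {k0, k1, k2, k3, k4, k5}"
    "\<And>z. z \<subseteq> {k0, k1, k2, k3, k4, k5} \<Longrightarrow>
       z \<in> minor_space Z C D \<longleftrightarrow> \<phi> (\<lambda>i. [k0, k1, k2, k3, k4, k5] ! i \<in> z)"
  shows "has_pattern E Z \<phi>"
proof -
  have im: "(!) [k0, k1, k2, k3, k4, k5] ` {..<6} = {k0, k1, k2, k3, k4, k5}"
    unfolding lessThan_6 by (simp add: eval_nat_numeral)
  moreover have "inj_on ((!) [k0, k1, k2, k3, k4, k5]) {..<6}"
    using inj_on_nth[OF assms(4), of "{..<6}"] by auto
  ultimately show ?thesis unfolding has_pattern_def using assms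
    by (intro exI[of _ C] exI[of _ D] exI[of _ "(!) [k0, k1, k2, k3, k4, k5]"]) auto
qed

text \<open>In the edge numbering of \<open>Q1\<close>, the even-degree conditions at the vertices
  0, 1 and 2; the condition at vertex 3 is their sum.\<close>

definition pattern_K4 :: "(nat \<Rightarrow> bool) \<Rightarrow> bool" where
  "pattern_K4 b \<longleftrightarrow> ((b 0 \<noteq> b 1) = b 2) \<and> ((b 0 \<noteq> b 3) = b 4) \<and> ((b 1 \<noteq> b 3) = b 5)"

text \<open>The even-degree conditions at the vertices 1 and 2. The loop is number 5 and stays
  unconstrained wherever it is attached, so \<open>Q3\<close> has this pattern as well.\<close>

definition pattern_Q2 :: "(nat \<Rightarrow> bool) \<Rightarrow> bool" where
  "pattern_Q2 b \<longleftrightarrow> ((b 0 \<noteq> b 1) = b 4) \<and> ((b 2 \<noteq> b 3) = b 4)"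

definition pattern_Q4 :: "(nat \<Rightarrow> bool) \<Rightarrow> bool" where
  "pattern_Q4 b \<longleftrightarrow> ((b 0 \<noteq> b 1) = (b 4 \<noteq> b 5)) \<and> ((b 2 \<noteq> b 3) = (b 4 \<noteq> b 5))"

lemma nth_6_simps:
  "[a, b, c, d, e, f] ! 0 = a" "[a, b, c, d, e, f] ! 1 = b" "[a, b, c, d, e, f] ! 2 = c"
  "[a, b, c, d, e, f] ! 3 = d" "[a, b, c, d, e, f] ! 4 = e" "[a, b, c, d, e, f] ! 5 = f"
  by (simp_all add: eval_nat_numeral)

text \<open>The domino is the fundamental graph of K4 for a spanning path with middle edge
  \<open>q0\<close> and end edges \<open>q2\<close> and \<open>q4\<close>. The enumeration of the
  six elements follows the edge numbering of \<open>Q1\<close>.\<close>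

lemma domino_imp_pattern_K4:
  assumes sym: "\<And>v w. adj v w \<Longrightarrow> adj w v" and bip: "\<And>v w. adj v w \<Longrightarrow> (v \<in> P) \<noteq> (w \<in> P)"
    and dom: "is_domino adj q0 q1 q2 q3 q4 q5" and V: "{q0, q1, q2, q3, q4, q5} \<subseteq> V" and q0: "q0 \<in> P"
  shows "has_pattern V (fundamental_space adj P V) pattern_K4"
proof -
  let ?K = "{q0, q1, q4, q2, q5, q3}"
  have a: "adj q0 q1" "adj q1 q2" "adj q2 q3" "adj q3 q4" "adj q4 q5" "adj q5 q0" "adj q0 q3"
    "\<not> adj q1 q4" "\<not> adj q2 q5" using dom unfolding is_domino_def by auto
  have P: "q0 \<in> P" "q1 \<notin> P" "q2 \<in> P" "q3 \<notin> P" "q4 \<in> P" "q5 \<notin> P"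
    using q0 bip[OF a(1)] bip[OF a(2)] bip[OF a(3)] bip[OF a(4)] bip[OF a(5)] by auto
  have e: "adj q2 q1" "adj q4 q3" "adj q0 q5" "\<not> adj q4 q1"
    using a sym by blast+
  have dist: "distinct [q0, q1, q4, q2, q5, q3]"
    using P a e sym by auto
  have K: "?K \<subseteq> V" using V by auto
  show ?thesis
  proof (rule has_patternI[of "V \<inter> P - ?K" V "V - P - ?K" q0 q1 q4 q2 q5 q3])
    fix z assume z: "z \<subseteq> ?K"
    have KP: "?K \<inter> P = {q0, q2, q4}" using P by auto
    have N: "{e \<in> z - P. adj q0 e} = z \<inter> {q1, q3, q5}" "{e \<in> z - P. adj q2 e} = z \<inter> {q1, q3}"
      "{e \<in> z - P. adj q4 e} = z \<inter> {q3, q5}"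
      using z P a e by auto
    have odd: "odd (card (z \<inter> {q1, q3, q5})) \<longleftrightarrow> ((q1 \<in> z) \<noteq> (q3 \<in> z)) \<noteq> (q5 \<in> z)"
      "odd (card (z \<inter> {q1, q3})) \<longleftrightarrow> (q1 \<in> z) \<noteq> (q3 \<in> z)"
      "odd (card (z \<inter> {q3, q5})) \<longleftrightarrow> (q3 \<in> z) \<noteq> (q5 \<in> z)"
      using dist by (intro odd_card_Int_tripleton odd_card_Int_doubleton; auto)+
    have "z \<in> fundamental_space adj P ?K \<longleftrightarrow>
        (q0 \<in> z \<longleftrightarrow> ((q1 \<in> z) \<noteq> (q3 \<in> z)) \<noteq> (q5 \<in> z)) \<and> (q2 \<in> z \<longleftrightarrow> (q1 \<in> z) \<noteq> (q3 \<in> z)) \<and>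
        (q4 \<in> z \<longleftrightarrow> (q3 \<in> z) \<noteq> (q5 \<in> z))"
      unfolding fundamental_space_def KP mem_Collect_eq ball_simps N odd using z by blast
    also have "\<dots> \<longleftrightarrow> pattern_K4 (\<lambda>i. [q0, q1, q4, q2, q5, q3] ! i \<in> z)"
      unfolding pattern_K4_def nth_6_simps by blast
    finally show "z \<in> minor_space (fundamental_space adj P V) (V \<inter> P - ?K) (V - P - ?K) \<longleftrightarrow>
        pattern_K4 (\<lambda>i. [q0, q1, q4, q2, q5, q3] ! i \<in> z)"
      unfolding fundamental_space_induced[OF K] .
  qed (use K dist in auto)
qed

lemma minor_space_minor_space:
  assumes "D' \<inter> C = {}"
  shows "minor_space (minor_space Z C D) C' D' = minor_space Z (C \<union> C') (D \<union> D')"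
proof (intro set_eqI iffI)
  fix t assume "t \<in> minor_space (minor_space Z C D) C' D'"
  then obtain z where "z \<in> Z" "z \<inter> D = {}" "(z - C) \<inter> D' = {}" "t = z - C - C'"
    unfolding minor_space_def by auto
  moreover have "z \<inter> (D \<union> D') = {}" "z - C - C' = z - (C \<union> C')" using calculation assms by auto
  ultimately show "t \<in> minor_space Z (C \<union> C') (D \<union> D')" unfolding minor_space_def by auto
next
  fix t assume "t \<in> minor_space Z (C \<union> C') (D \<union> D')"
  then obtain z where z: "z \<in> Z" "z \<inter> (D \<union> D') = {}" "t = z - (C \<union> C')"
    unfolding minor_space_def by auto
  then have "z - C \<in> minor_space Z C D" "(z - C) \<inter> D' = {}" "t = z - C - C'"
    unfolding minor_space_def by auto
  then show "t \<in> minor_space (minor_space Z C D) C' D'" unfolding minor_space_def by blast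
qed

text \<open>Contracting all but three consecutive rim elements of a wheel, and deleting the spokes between
  them, leaves the wheel with three spokes, which is K4.\<close>

lemma wheel_imp_pattern_K4:
  fixes b e :: "nat \<Rightarrow> 'a"
  assumes k: "3 \<le> k" and inj: "inj_on b {..<k}" "inj_on e {..<k}"
    and b: "b ` {..<k} \<subseteq> V \<inter> P" and e: "e ` {..<k} \<subseteq> V - P"
    and adj: "\<And>i j. i < k \<Longrightarrow> j < k \<Longrightarrow> adj (b i) (e j) \<longleftrightarrow> j = i \<or> i = Suc j \<or> i = 0 \<and> Suc j = k"
  shows "has_pattern V (fundamental_space adj P V) pattern_K4"
proof -
  define H where "H = b ` {..<k} \<union> e ` {..<k}"
  define prev where "prev i = (if i = 0 then k - 1 else i - 1)" for i
  let ?Y = "fundamental_space adj P H"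
  let ?C = "e ` {3..<k}" and ?D = "b ` {3..<k}" and ?K = "{b 0, b 1, b 2, e 0, e 2, e 1}"
  have HV: "H \<subseteq> V" and HP: "H \<inter> P = b ` {..<k}" using b e unfolding H_def by auto
  have bP: "b i \<in> P" "b i \<in> V" "b i \<in> H" and eP: "e i \<notin> P" "e i \<in> V" "e i \<in> H" if "i < k" for i
    using b e that unfolding H_def by auto
  have be: "b i \<noteq> e j" if "i < k" "j < k" for i j using bP(1)[OF that(1)] eP(1)[OF that(2)] by auto
  have bb: "b i = b j \<longleftrightarrow> i = j" and ee: "e i = e j \<longleftrightarrow> i = j" if "i < k" "j < k" for i j
    using inj that by (auto simp: inj_on_eq_iff)
  have "?C \<subseteq> e ` {..<k}" "?D \<subseteq> b ` {..<k}" by auto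
  then have CH: "?C \<subseteq> H" "?D \<subseteq> H" "?C \<inter> P = {}" "?D \<subseteq> P" using b e unfolding H_def by blast+
  then have CD: "?C \<inter> ?D = {}" by blast
  have eC: "e i \<in> ?C \<longleftrightarrow> 3 \<le> i" and bD: "b i \<in> ?D \<longleftrightarrow> 3 \<le> i" if "i < k" for i
  proof -
    have "{3..<k} \<subseteq> {..<k}" "i \<in> {..<k}" using that by auto
    then show "e i \<in> ?C \<longleftrightarrow> 3 \<le> i" "b i \<in> ?D \<longleftrightarrow> 3 \<le> i"
      using inj_on_image_mem_iff[OF inj(2), of i "{3..<k}"] inj_on_image_mem_iff[OF inj(1), of i "{3..<k}"] that
      by simp_all
  qed
  have bC: "b i \<notin> ?C" and eD: "e i \<notin> ?D" if "i < k" for i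
    using be that by (metis atLeastLessThan_iff imageE)+
  have KC: "?K \<inter> ?C = {}" "?K \<inter> ?D = {}"
    using k eC[of 0] eC[of 1] eC[of 2] bD[of 0] bD[of 1] bD[of 2] bC[of 0] bC[of 1] bC[of 2]
      eD[of 0] eD[of 1] eD[of 2] by auto
  have prev: "prev i < k" "prev i \<noteq> i" if "i < k" for i using that k unfolding prev_def by auto
  have Y: "z \<in> ?Y \<longleftrightarrow> z \<subseteq> H \<and> (\<forall>i<k. b i \<in> z \<longleftrightarrow> (e (prev i) \<in> z) \<noteq> (e i \<in> z))" for z
  proof -
    have oddi: "odd (card {x \<in> z - P. adj (b i) x}) \<longleftrightarrow> (e (prev i) \<in> z) \<noteq> (e i \<in> z)" if z: "z \<subseteq> H" and i: "i < k" for i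
    proof -
      have adj': "adj (b i) (e j) \<longleftrightarrow> j = prev i \<or> j = i" if "j < k" for j
        using adj[OF i that] k unfolding prev_def by auto
      have "{x \<in> z - P. adj (b i) x} = z \<inter> {e (prev i), e i}"
      proof (intro set_eqI iffI)
        fix x assume x: "x \<in> {x \<in> z - P. adj (b i) x}"
        then have "x \<in> H" "x \<notin> b ` {..<k}" using z HP by blast+
        then obtain j where "j < k" "x = e j" unfolding H_def by blast
        then show "x \<in> z \<inter> {e (prev i), e i}" using x adj' by auto
      next
        fix x assume x: "x \<in> z \<inter> {e (prev i), e i}"
        then show "x \<in> {x \<in> z - P. adj (b i) x}"
          using adj'[OF i] adj'[OF prev(1)[OF i]] eP(1)[OF i] eP(1)[OF prev(1)[OF i]] by auto
      qed
      moreover have "e (prev i) \<noteq> e i" using ee[OF prev(1)[OF i] i] prev(2)[OF i] by simp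
      ultimately show ?thesis using odd_card_Int_doubleton[of "e (prev i)" "e i" z] by simp
    qed
    show ?thesis
    proof (cases "z \<subseteq> H")
      case True
      show ?thesis unfolding fundamental_space_def HP mem_Collect_eq ball_simps
        using True oddi[OF True] by blast
    qed (use fundamental_spaceD(1) in blast)
  qed
  have p012: "prev 0 = k - 1" "prev 1 = 0" "prev 2 = 1" unfolding prev_def by auto
  have minor: "t \<in> minor_space ?Y ?C ?D \<longleftrightarrow> (b 0 \<in> t \<longleftrightarrow> (e 2 \<in> t) \<noteq> (e 0 \<in> t)) \<and>
      (b 1 \<in> t \<longleftrightarrow> (e 0 \<in> t) \<noteq> (e 1 \<in> t)) \<and> (b 2 \<in> t \<longleftrightarrow> (e 1 \<in> t) \<noteq> (e 2 \<in> t))" (is "_ \<longleftrightarrow> ?R")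
    if t: "t \<subseteq> ?K" for t
  proof
    assume "t \<in> minor_space ?Y ?C ?D"
    then obtain z where z: "z \<in> ?Y" "z \<inter> ?D = {}" "t = z - ?C" unfolding minor_space_def by auto
    have mem: "b i \<in> z \<longleftrightarrow> (e (prev i) \<in> z) \<noteq> (e i \<in> z)" if "i < k" for i using z(1) that unfolding Y by auto
    \<comment> \<open>A deleted \<open>b i\<close> forces its two neighbours to agree, so
      \<open>e 2\<close>, ..., \<open>e (k - 1)\<close> are all in \<open>z\<close> or all
      outside.\<close>
    have const: "e (2 + i) \<in> z \<longleftrightarrow> e 2 \<in> z" if "2 + i < k" for i
      using that
    proof (induction i)
      case (Suc i)
      have "b (2 + Suc i) \<notin> z" using z(2) Suc.prems by auto
      moreover have "prev (2 + Suc i) = 2 + i" unfolding prev_def by simp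
      ultimately show ?case using mem[OF Suc.prems] Suc by auto
    qed simp
    have last: "e (k - 1) \<in> z \<longleftrightarrow> e 2 \<in> z" 
    proof -
      have "2 + (k - 3) = k - 1" "2 + (k - 3) < k" using k by linarith+
      then show ?thesis using const[of "k - 3"] by metis
    qed
    have tz: "b i \<in> t \<longleftrightarrow> b i \<in> z" "e i \<in> t \<longleftrightarrow> e i \<in> z" if "i < 3" for i
      using z(3) that k bC[of i] eC[of i] by auto
    show ?R using mem[of 0] mem[of 1] mem[of 2] k last tz[of 0] tz[of 1] tz[of 2] unfolding p012 by auto
  next
    assume R: ?R
    \<comment> \<open>Conversely, the contracted rim elements are restored all together, following
      \<open>e 2\<close>.\<close>
    define z where "z = t \<union> (if e 2 \<in> t then ?C else {})"
    have tC: "t \<inter> ?C = {}" and tD: "t \<inter> ?D = {}" using t KC by blast+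
    have ez: "e i \<in> z \<longleftrightarrow> (if i < 3 then e i \<in> t else e 2 \<in> t)" if "i < k" for i
    proof (cases "i < 3")
      case True
      then have "e i \<notin> ?C" using eC[OF that] by auto
      then show ?thesis using True unfolding z_def by auto
    next
      case False
      then have "e i \<in> ?C" using eC[OF that] by auto
      then show ?thesis using False tC unfolding z_def by auto
    qed
    have bz: "b i \<in> z \<longleftrightarrow> b i \<in> t" if "i < k" for i using bC[OF that] unfolding z_def by auto
    have bt: "b i \<notin> t" if "3 \<le> i" "i < k" for i using tD bD[OF that(2)] that(1) by blast
    have "b i \<in> z \<longleftrightarrow> (e (prev i) \<in> z) \<noteq> (e i \<in> z)" if i: "i < k" for i
    proof -
      consider "i = 0" | "i = 1" | "i = 2" | "3 \<le> i" by linarith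
      then show ?thesis
      proof cases
        case 1
        have "e (k - 1) \<in> z \<longleftrightarrow> e 2 \<in> t"
        proof (cases "k = 3")
          case True
          then show ?thesis using ez[of 2] by simp
        next
          case False
          then have "\<not> k - 1 < 3" "k - 1 < k" using k by linarith+
          then show ?thesis using ez[of "k - 1"] by simp
        qed
        then show ?thesis using 1 R bz[OF i] ez[OF i] p012 by simp
      next
        case 2
        then show ?thesis using R bz[OF i] ez[OF i] ez[of 0] k p012 by simp
      next
        case 3
        then show ?thesis using R bz[OF i] ez[OF i] ez[of 1] k p012 by simp
      next
        case 4
        have "e (i - 1) \<in> z \<longleftrightarrow> e 2 \<in> t"
        proof (cases "i = 3")
          case True
          then show ?thesis using ez[of 2] i by simp
        next
          case False
          then have "\<not> i - 1 < 3" "i - 1 < k" using i 4 by linarith+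
          then show ?thesis using ez[of "i - 1"] by simp
        qed
        then show ?thesis using 4 bt[OF 4 i] bz[OF i] ez[OF i] unfolding prev_def by simp
      qed
    qed
    moreover have "z \<subseteq> H" using t bP(3)[of 0] bP(3)[of 1] bP(3)[of 2] eP(3) k unfolding z_def by auto
    ultimately have "z \<in> ?Y" unfolding Y by auto
    moreover have "z \<inter> ?D = {}" using tD CD unfolding z_def by auto
    moreover have "t = z - ?C" using tC unfolding z_def by auto
    ultimately show "t \<in> minor_space ?Y ?C ?D" unfolding minor_space_def by auto
  qed
  have split: "{..<k} = {0, 1, 2} \<union> {3..<k}" using k by auto
  have DC: "?D \<inter> (V \<inter> P - H) = {}" using CH(2) by blast
  have dist: "distinct [b 0, b 1, b 2, e 0, e 2, e 1]" using k be bb ee by auto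
  show ?thesis
  \<comment> \<open>In this order the spokes form the star at vertex 0 of \<open>Q1\<close> and the
    rim elements the opposite triangle.\<close>
  proof (rule has_patternI[of "(V \<inter> P - H) \<union> ?C" V "(V - P - H) \<union> ?D" "b 0" "b 1" "b 2" "e 0" "e 2" "e 1"])
    show "((V \<inter> P - H) \<union> ?C) \<inter> ((V - P - H) \<union> ?D) = {}" using CH CD by blast
    have "H - ?C - ?D = ?K"
    proof -
      have "H = ?K \<union> (?C \<union> ?D)" unfolding H_def split by auto
      moreover have "?K \<inter> (?C \<union> ?D) = {}" using KC by blast
      ultimately show ?thesis by auto
    qed
    moreover have "V - ((V \<inter> P - H) \<union> ?C) - ((V - P - H) \<union> ?D) = H - ?C - ?D" using HV by blast
    ultimately show "V - ((V \<inter> P - H) \<union> ?C) - ((V - P - H) \<union> ?D) = ?K" by simp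
    show "(V \<inter> P - H) \<union> ?C \<subseteq> V" "(V - P - H) \<union> ?D \<subseteq> V" using CH HV by blast+
    fix z assume z: "z \<subseteq> ?K"
    show "z \<in> minor_space (fundamental_space adj P V) ((V \<inter> P - H) \<union> ?C) ((V - P - H) \<union> ?D) \<longleftrightarrow>
        pattern_K4 (\<lambda>i. [b 0, b 1, b 2, e 0, e 2, e 1] ! i \<in> z)"
      unfolding minor_space_minor_space[OF DC, symmetric] fundamental_space_induced[OF HV] minor[OF z]
        pattern_K4_def nth_6_simps by blast
  qed (rule dist)
qed

text \<open>Starting in \<open>P\<close>, the hole alternates between the two sides, and its closing
  edge makes the length even. The even positions are the spokes of a wheel, the odd ones its
  rim.\<close>

lemma hole_imp_pattern_K4:
  assumes sym: "\<And>v w. adj v w \<Longrightarrow> adj w v" and bip: "\<And>v w. adj v w \<Longrightarrow> (v \<in> P) \<noteq> (w \<in> P)"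
    and hole: "induced_cycle adj hs" "6 \<le> length hs" "set hs \<subseteq> V" and h0: "hs ! 0 \<in> P"
  shows "has_pattern V (fundamental_space adj P V) pattern_K4"
proof -
  have dist: "distinct hs" and cyc: "\<And>i j. i < j \<Longrightarrow> j < length hs \<Longrightarrow>
      adj (hs ! i) (hs ! j) \<longleftrightarrow> j = Suc i \<or> i = 0 \<and> Suc j = length hs"
    using hole(1) unfolding induced_cycle_def by blast+
  have alt: "hs ! i \<in> P \<longleftrightarrow> even i" if "i < length hs" for i
    using that
  proof (induction i)
    case (Suc i)
    then show ?case using bip[of "hs ! i" "hs ! Suc i"] cyc[of i "Suc i"] by auto
  qed (use h0 in simp)
  have "adj (hs ! 0) (hs ! (length hs - 1))" using cyc[of 0 "length hs - 1"] hole(2) by auto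
  then have "hs ! (length hs - 1) \<notin> P" using bip[of "hs ! 0"] h0 by simp
  moreover have "length hs - 1 < length hs" using hole(2) by linarith
  ultimately have "odd (length hs - 1)" using alt[of "length hs - 1"] by simp
  then have "even (length hs)" using hole(2) by auto
  then obtain k where k: "length hs = 2 * k" by auto
  then have k3: "3 \<le> k" using hole(2) by simp
  have nth: "hs ! i = hs ! j \<longleftrightarrow> i = j" if "i < 2 * k" "j < 2 * k" for i j
    using nth_eq_iff_index_eq[OF dist] that k by simp
  show ?thesis
  proof (rule wheel_imp_pattern_K4[OF k3, of "\<lambda>i. hs ! (2 * i)" "\<lambda>i. hs ! (2 * i + 1)"])
    show "inj_on (\<lambda>i. hs ! (2 * i)) {..<k}" "inj_on (\<lambda>i. hs ! (2 * i + 1)) {..<k}"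
      by (rule inj_onI; use nth in simp)+
    have V: "hs ! i \<in> V" if "i < length hs" for i using hole(3) that nth_mem by blast
    show "(\<lambda>i. hs ! (2 * i)) ` {..<k} \<subseteq> V \<inter> P" "(\<lambda>i. hs ! (2 * i + 1)) ` {..<k} \<subseteq> V - P"
      using alt V k by auto
    fix i j assume ij: "i < k" "j < k"
    show "adj (hs ! (2 * i)) (hs ! (2 * j + 1)) \<longleftrightarrow> j = i \<or> i = Suc j \<or> i = 0 \<and> Suc j = k"
    proof (cases "i \<le> j")
      case True
      then show ?thesis using cyc[of "2 * i" "2 * j + 1"] ij k by auto
    next
      case False
      have "adj (hs ! (2 * i)) (hs ! (2 * j + 1)) \<longleftrightarrow> adj (hs ! (2 * j + 1)) (hs ! (2 * i))" using sym by blast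
      then show ?thesis using cyc[of "2 * j + 1" "2 * i"] False ij k by auto
    qed
  qed
qed

text \<open>The first and last vertices of a hole lie on different sides, so the hole or its
  reversal starts in \<open>P\<close>, as \<open>hole_imp_pattern_K4\<close> requires.\<close>

lemma induced_cycle_rev:
  assumes sym: "\<And>v w. adj v w \<Longrightarrow> adj w v" and "induced_cycle adj hs"
  shows "induced_cycle adj (rev hs)"
  unfolding induced_cycle_def
proof (intro conjI allI impI)
  have cyc: "\<And>i j. i < j \<Longrightarrow> j < length hs \<Longrightarrow>
      adj (hs ! i) (hs ! j) \<longleftrightarrow> j = Suc i \<or> i = 0 \<and> Suc j = length hs"
    using assms(2) unfolding induced_cycle_def by blast
  show "distinct (rev hs)" using assms(2) unfolding induced_cycle_def by simp
  fix i j assume ij: "i < j" "j < length (rev hs)"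
  let ?i = "length hs - Suc i" and ?j = "length hs - Suc j"
  have "adj (hs ! ?i) (hs ! ?j) \<longleftrightarrow> adj (hs ! ?j) (hs ! ?i)" using sym by blast
  also have "\<dots> \<longleftrightarrow> ?i = Suc ?j \<or> ?j = 0 \<and> Suc ?i = length hs" using cyc[of ?j ?i] ij by auto
  also have "\<dots> \<longleftrightarrow> j = Suc i \<or> i = 0 \<and> Suc j = length hs" using ij by auto
  finally show "adj (rev hs ! i) (rev hs ! j) \<longleftrightarrow> j = Suc i \<or> i = 0 \<and> Suc j = length (rev hs)"
    using ij by (simp add: rev_nth)
qed

lemma domino_hole_free_if_no_pattern_K4:
  assumes sym: "\<And>v w. adj v w \<Longrightarrow> adj w v" and bip: "\<And>v w. adj v w \<Longrightarrow> (v \<in> P) \<noteq> (w \<in> P)"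
    and no: "\<not> has_pattern V (fundamental_space adj P V) pattern_K4"
  shows "domino_hole_free adj V"
  unfolding domino_hole_free_def
proof (intro conjI allI impI)
  fix hs assume hs: "induced_cycle adj hs" "set hs \<subseteq> V"
  show "length hs < 6"
  proof (rule ccontr)
    assume "\<not> ?thesis"
    then have len: "6 \<le> length hs" by simp
    have "adj (hs ! 0) (hs ! (length hs - 1))" using hs(1) len unfolding induced_cycle_def by auto
    moreover have "rev hs ! 0 = hs ! (length hs - 1)" using len rev_nth[of 0 hs] by (cases hs) auto
    ultimately have "hs ! 0 \<in> P \<or> rev hs ! 0 \<in> P" using bip by metis
    then show False
      using hole_imp_pattern_K4[OF sym bip hs(1) len hs(2)]
        hole_imp_pattern_K4[OF sym bip induced_cycle_rev[OF sym hs(1)]] len hs(2) no by auto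
  qed
next
  fix q0 q1 q2 q3 q4 q5 assume V: "{q0, q1, q2, q3, q4, q5} \<subseteq> V"
  show "\<not> is_domino adj q0 q1 q2 q3 q4 q5"
  proof
    assume d: "is_domino adj q0 q1 q2 q3 q4 q5"
    \<comment> \<open>Rotation by three swaps the ends of the chord, one of which lies in
      \<open>P\<close>.\<close>
    then have d': "is_domino adj q3 q4 q5 q0 q1 q2" using sym unfolding is_domino_def by blast
    have "q0 \<in> P \<or> q3 \<in> P" using bip d unfolding is_domino_def by blast
    then show False
      using domino_imp_pattern_K4[OF sym bip d V] domino_imp_pattern_K4[OF sym bip d'] V no by auto
  qed
qed

lemma gammoid_if_no_pattern_K4:
  assumes Z: "cycle_space E Z" and no: "\<not> has_pattern E Z pattern_K4"
  shows "gammoid (space_matroid E Z)"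
proof -
  obtain adj P where sym: "\<And>v w. adj v w \<Longrightarrow> adj w v" and bip: "\<And>v w. adj v w \<Longrightarrow> (v \<in> P) \<noteq> (w \<in> P)"
    and Zeq: "Z = fundamental_space adj P E"
    using ex_fundamental_space[OF Z] by blast
  have "domino_hole_free adj E"
    using domino_hole_free_if_no_pattern_K4[of adj P E] sym bip no Zeq by blast
  then have "linkage_rep E (acyclic_in Z)"
    unfolding Zeq using linkage_rep_fundamental_space[of E adj P] sym bip cycle_spaceD(1)[OF Z] by blast
  then obtain V :: "nat set" and T R \<phi> where r: "finite V" "T \<subseteq> V" "R \<subseteq> V \<times> V" "inj_on \<phi> E" "\<phi> ` E \<subseteq> V"
    "\<And>I. I \<subseteq> E \<Longrightarrow> acyclic_in Z I \<longleftrightarrow> linkable V T R (\<phi> ` I)"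
    by (rule linkage_repE) blast
  then have "\<forall>I\<subseteq>ground (space_matroid E Z). I \<in> indeps (space_matroid E Z) \<longleftrightarrow> linkable V T R (\<phi> ` I)"
    by (auto simp: indeps_space_matroid)
  then show ?thesis
    unfolding gammoid_iff_linkable using is_matroid_space_matroid[OF Z] r(1-5)
    by (intro conjI exI[of _ V] exI[of _ T] exI[of _ R] exI[of _ \<phi>]) auto
qed

section \<open>The minors Q1, ..., Q4\<close>

definition even_subgraphs :: "('v, 'e) mgraph \<Rightarrow> 'e set set" where
  "even_subgraphs G = {S. S \<subseteq> edges G \<and> (\<forall>v\<in>vertices G. sum (inc G v) S = 0)}"

lemma cycle_space_even_subgraphs:
  assumes "finite (edges G)"
  shows "cycle_space (edges G) (even_subgraphs G)"
  unfolding cycle_space_def even_subgraphs_def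
  using assms by (auto simp: sum_sym_diff_bit[OF finite_subset finite_subset])

lemma cycle_matroid_eq_space_matroid:
  assumes G: "finite_mgraph G"
  shows "cycle_matroid G = space_matroid (edges G) (even_subgraphs G)"
proof -
  have "(\<exists>C\<subseteq>F. is_cycle G C) \<longleftrightarrow> \<not> acyclic_in (even_subgraphs G) F" if F: "F \<subseteq> edges G" for F
  proof
    assume "\<exists>C\<subseteq>F. is_cycle G C"
    then obtain C where C: "C \<subseteq> F" "is_cycle G C" by auto
    have "C \<noteq> {}" using C(2) unfolding is_cycle_def by auto
    moreover have "C \<in> even_subgraphs G"
      using C F cycle_inc_sum[OF C(2)] unfolding even_subgraphs_def by auto
    ultimately show "\<not> acyclic_in (even_subgraphs G) F" using C(1) acyclic_inD by metis
  next
    assume "\<not> acyclic_in (even_subgraphs G) F"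
    then obtain S where "S \<in> even_subgraphs G" "S \<subseteq> F" "S \<noteq> {}" unfolding acyclic_in_def by auto
    then show "\<exists>C\<subseteq>F. is_cycle G C"
      using even_edge_set_has_cycle[OF G, of S] unfolding even_subgraphs_def by auto
  qed
  then show ?thesis unfolding cycle_matroid_def space_matroid_def by auto
qed

text \<open>An isomorphism onto \<open>cycle_matroid G\<close> is turned into an enumeration of the
  minor by inverting it, and conversely. The assumption \<open>local\<close> makes
  \<open>\<phi>\<close> blind to values beyond the first six, where the characteristic functions to
  be compared may differ.\<close>

lemma has_minor_space_matroid_iff:
  assumes Z: "cycle_space E Z" and G: "finite_mgraph G" "edges G = {..<6::nat}"
    and even: "\<And>S. S \<subseteq> {..<6} \<Longrightarrow> S \<in> even_subgraphs G \<longleftrightarrow> \<phi> (\<lambda>i. i \<in> S)"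
    and local: "\<And>b b'. (\<And>i. i < 6 \<Longrightarrow> b i = b' i) \<Longrightarrow> \<phi> b = \<phi> b'"
  shows "has_minor (space_matroid E Z) (cycle_matroid G) \<longleftrightarrow> has_pattern E Z \<phi>"
proof -
  have Y: "cycle_space {..<6} (even_subgraphs G)"
    using cycle_space_even_subgraphs[of G] G(2) by simp
  have iso: "isomorphic (deletion (contraction (space_matroid E Z) C) D) (cycle_matroid G) \<longleftrightarrow>
      (\<exists>k. inj_on k {..<6::nat} \<and> E - C - D = k ` {..<6} \<and>
        (\<forall>z\<subseteq>k ` {..<6}. z \<in> minor_space Z C D \<longleftrightarrow> \<phi> (\<lambda>i. k i \<in> z)))" (is "?L \<longleftrightarrow> ?R")
    if C: "C \<subseteq> E" "C \<inter> D = {}" for C D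
  proof -
    let ?K = "E - C - D" and ?M = "minor_space Z C D"
    have "?L \<longleftrightarrow> (\<exists>f. bij_betw f ?K {..<6} \<and> (\<forall>z. z \<subseteq> ?K \<longrightarrow> (z \<in> ?M \<longleftrightarrow> f ` z \<in> even_subgraphs G)))"
      unfolding deletion_contraction_space_matroid[OF Z C] cycle_matroid_eq_space_matroid[OF G(1)] G(2)
      by (rule isomorphic_space_matroid_iff[OF cycle_space_minor[OF Z] Y])
    also have "\<dots> \<longleftrightarrow> ?R"
    proof
      assume "\<exists>f. bij_betw f ?K {..<6} \<and> (\<forall>z. z \<subseteq> ?K \<longrightarrow> (z \<in> ?M \<longleftrightarrow> f ` z \<in> even_subgraphs G))"
      then obtain f where f: "bij_betw f ?K {..<6}" "\<And>z. z \<subseteq> ?K \<Longrightarrow> z \<in> ?M \<longleftrightarrow> f ` z \<in> even_subgraphs G"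
        by auto
      let ?k = "inv_into ?K f"
      have bk: "bij_betw ?k {..<6} ?K" using f(1) by (rule bij_betw_inv_into)
      have "z \<in> ?M \<longleftrightarrow> \<phi> (\<lambda>i. ?k i \<in> z)" if z: "z \<subseteq> ?K" for z
      proof -
        have "f ` z \<subseteq> {..<6}" using z f(1) by (auto simp: bij_betw_def)
        moreover have "i \<in> f ` z \<longleftrightarrow> ?k i \<in> z" if "i < 6" for i
        proof
          assume "i \<in> f ` z"
          then obtain x where "x \<in> z" "i = f x" by auto
          then show "?k i \<in> z" using z f(1) by (auto simp: bij_betw_def inv_into_f_f subset_iff)
        next
          assume "?k i \<in> z"
          moreover have "f (?k i) = i" using f(1) that by (auto simp: bij_betw_def f_inv_into_f)
          ultimately show "i \<in> f ` z" by (metis imageI)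
        qed
        ultimately show ?thesis
          using f(2)[OF z] even[of "f ` z"] local[of "\<lambda>i. i \<in> f ` z" "\<lambda>i. ?k i \<in> z"] by auto
      qed
      then show ?R using bk by (intro exI[of _ ?k]) (auto simp: bij_betw_def)
    next
      assume ?R
      then obtain k where k: "inj_on k {..<6::nat}" "?K = k ` {..<6}"
        "\<And>z. z \<subseteq> k ` {..<6} \<Longrightarrow> z \<in> ?M \<longleftrightarrow> \<phi> (\<lambda>i. k i \<in> z)" by auto
      have bk: "bij_betw k {..<6} ?K" using k by (auto simp: bij_betw_def)
      let ?f = "inv_into {..<6} k"
      have "z \<in> ?M \<longleftrightarrow> ?f ` z \<in> even_subgraphs G" if z: "z \<subseteq> ?K" for z
      proof -
        have "?f ` z \<subseteq> {..<6}" using z bij_betw_inv_into[OF bk] by (auto simp: bij_betw_def)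
        moreover have "k i \<in> z \<longleftrightarrow> i \<in> ?f ` z" if "i < 6" for i
        proof
          assume "k i \<in> z"
          then have "?f (k i) \<in> ?f ` z" by auto
          then show "i \<in> ?f ` z" using k(1) that by (simp add: inv_into_f_f)
        next
          assume "i \<in> ?f ` z"
          then obtain x where x: "x \<in> z" "i = ?f x" by auto
          then have "k i = x" using z k(2) by (auto simp: f_inv_into_f subset_iff)
          then show "k i \<in> z" using x by simp
        qed
        ultimately show ?thesis
          using k(3)[of z] z k(2) even[of "?f ` z"] local[of "\<lambda>i. k i \<in> z" "\<lambda>i. i \<in> ?f ` z"] by auto
      qed
      then show "\<exists>f. bij_betw f ?K {..<6} \<and> (\<forall>z. z \<subseteq> ?K \<longrightarrow> (z \<in> ?M \<longleftrightarrow> f ` z \<in> even_subgraphs G))"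
        using bij_betw_inv_into[OF bk] by (intro exI[of _ ?f]) auto
    qed
    finally show ?thesis .
  qed
  show ?thesis
  proof
    assume "has_minor (space_matroid E Z) (cycle_matroid G)"
    then obtain C D where CD: "C \<subseteq> E" "D \<subseteq> E" "C \<inter> D = {}"
      "isomorphic (deletion (contraction (space_matroid E Z) C) D) (cycle_matroid G)"
      unfolding has_minor_def by auto
    from iso[OF CD(1,3), THEN iffD1, OF CD(4)]
    obtain k where k: "inj_on k {..<6::nat}" "E - C - D = k ` {..<6}"
      "\<forall>z\<subseteq>k ` {..<6}. z \<in> minor_space Z C D \<longleftrightarrow> \<phi> (\<lambda>i. k i \<in> z)"
      by (elim exE conjE) (rule that)
    show "has_pattern E Z \<phi>"
      unfolding has_pattern_def by (intro exI[of _ C] exI[of _ D] exI[of _ k] conjI CD(1-3) k)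
  next
    assume "has_pattern E Z \<phi>"
    then obtain C D k where k: "C \<subseteq> E" "D \<subseteq> E" "C \<inter> D = {}" "inj_on k {..<6::nat}" "E - C - D = k ` {..<6}"
      "\<And>z. z \<subseteq> k ` {..<6} \<Longrightarrow> z \<in> minor_space Z C D \<longleftrightarrow> \<phi> (\<lambda>i. k i \<in> z)"
      by (rule has_patternE) blast
    have "isomorphic (deletion (contraction (space_matroid E Z) C) D) (cycle_matroid G)"
      by (rule iso[OF k(1,3), THEN iffD2]) (use k in \<open>intro exI[of _ k] conjI; simp\<close>)
    then show "has_minor (space_matroid E Z) (cycle_matroid G)"
      unfolding has_minor_def using k(1-3) by (intro exI[of _ C] exI[of _ D]) simp
  qed
qed

lemma has_pattern_permute:
  assumes "has_pattern E Z \<phi>" and p: "distinct p" "length p = 6" "set p \<subseteq> {..<6}"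
    and eq: "\<And>b. \<phi> b \<longleftrightarrow> \<psi> (\<lambda>i. b (p ! i))"
  shows "has_pattern E Z \<psi>"
proof -
  obtain C D k where k: "C \<subseteq> E" "D \<subseteq> E" "C \<inter> D = {}" "inj_on k {..<6::nat}" "E - C - D = k ` {..<6}"
    "\<And>z. z \<subseteq> k ` {..<6} \<Longrightarrow> z \<in> minor_space Z C D \<longleftrightarrow> \<phi> (\<lambda>i. k i \<in> z)"
    using assms(1) by (rule has_patternE) blast
  have "card (set p) = 6" using p by (simp add: distinct_card)
  then have sp: "set p = {..<6}" using p(3) by (intro card_subset_eq) auto
  have bp: "bij_betw ((!) p) {..<6} {..<6}" 
    by (rule bij_betw_nth[OF p(1)]) (simp_all add: p(2) sp)
  let ?k = "\<lambda>i. k (p ! i)"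
  have im: "?k ` {..<6} = k ` {..<6}" using bp by (metis bij_betw_def image_image)
  have "inj_on (k \<circ> (!) p) {..<6}" using bp k(4) by (intro comp_inj_on) (auto simp: bij_betw_def)
  then have "inj_on ?k {..<6}" by (simp add: comp_def)
  moreover have "z \<in> minor_space Z C D \<longleftrightarrow> \<psi> (\<lambda>i. ?k i \<in> z)" if "z \<subseteq> ?k ` {..<6}" for z
    using k(6)[of z] that eq[of "\<lambda>i. k i \<in> z"] unfolding im by auto
  ultimately show ?thesis unfolding has_pattern_def using k(1,2,3,5) im
    by (intro exI[of _ C] exI[of _ D] exI[of _ ?k]) auto
qed

text \<open>Ordered pairs keep the two ends of a loop apart, so the incidence sum can be written
  with one indicator per end and a loop cancels modulo 2.\<close>

definition mgraph_of_pairs :: "nat \<Rightarrow> (nat \<times> nat) list \<Rightarrow> (nat, nat) mgraph" where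
  "mgraph_of_pairs n ps = mgraph_of_list n (map (\<lambda>(u, v). {u, v}) ps)"

lemma finite_mgraph_of_pairs:
  assumes "\<forall>(u, v)\<in>set ps. u < n \<and> v < n"
  shows "finite_mgraph (mgraph_of_pairs n ps)"
proof -
  have "\<exists>u\<in>{..<n}. \<exists>v\<in>{..<n}. (map (\<lambda>(u, v). {u, v}) ps) ! i = {u, v}" if "i < length ps" for i
  proof -
    obtain u v where uv: "ps ! i = (u, v)" by (metis surj_pair)
    then have "u < n" "v < n" using assms nth_mem[OF that] by auto
    then show ?thesis using uv that by auto
  qed
  then show ?thesis unfolding finite_mgraph_def mgraph_of_pairs_def mgraph_of_list_def by auto
qed

lemma even_subgraphs_mgraph_of_pairs:
  assumes "length ps = 6" "S \<subseteq> {..<6}"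
  shows "S \<in> even_subgraphs (mgraph_of_pairs n ps) \<longleftrightarrow>
    (\<forall>v<n. (\<Sum>i\<in>{0, 1, 2, 3, 4, 5}. of_bool (i \<in> S) * (of_bool (v = fst (ps ! i)) + of_bool (v = snd (ps ! i)))) = (0::bit))"
proof -
  let ?G = "mgraph_of_pairs n ps"
  have inc: "inc ?G v i = of_bool (v = fst (ps ! i)) + of_bool (v = snd (ps ! i))" if "i < 6" for v i
    using that assms(1)
    by (intro inc_eq) (simp add: mgraph_of_pairs_def mgraph_of_list_def case_prod_beta)
  have "sum (inc ?G v) S = (\<Sum>i\<in>{..<6}. of_bool (i \<in> S) * (of_bool (v = fst (ps ! i)) + of_bool (v = snd (ps ! i))))" for v
    using assms(2) by (intro sum.mono_neutral_cong_left) (auto simp: inc subset_iff)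
  then show ?thesis using assms unfolding even_subgraphs_def lessThan_6
    by (auto simp: mgraph_of_pairs_def mgraph_of_list_def)
qed

lemma edges_mgraph_of_pairs [simp]: "edges (mgraph_of_pairs n ps) = {..<length ps}"
  by (simp add: mgraph_of_pairs_def mgraph_of_list_def)

lemma Q_eq_mgraph_of_pairs:
  "Q1 = mgraph_of_pairs 4 [(0, 1), (0, 2), (0, 3), (1, 2), (1, 3), (2, 3)]"
  "Q2 = mgraph_of_pairs 3 [(0, 1), (0, 1), (0, 2), (0, 2), (1, 2), (0, 0)]"
  "Q3 = mgraph_of_pairs 3 [(0, 1), (0, 1), (0, 2), (0, 2), (1, 2), (2, 2)]"
  "Q4 = mgraph_of_pairs 3 [(0, 1), (0, 1), (0, 2), (0, 2), (1, 2), (1, 2)]"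
  by (simp_all add: Q1_def Q2_def Q3_def Q4_def mgraph_of_pairs_def)

lemma all_less_3_4:
  "(\<forall>v<3. P v) \<longleftrightarrow> P 0 \<and> P 1 \<and> P (2::nat)" "(\<forall>v<4. P v) \<longleftrightarrow> P 0 \<and> P 1 \<and> P 2 \<and> P (3::nat)"
  by (auto simp: less_Suc_eq numeral_eq_Suc)

lemma even_subgraphs_Q:
  assumes S: "S \<subseteq> {..<6}"
  shows "S \<in> even_subgraphs Q1 \<longleftrightarrow> pattern_K4 (\<lambda>i. i \<in> S)"
    "S \<in> even_subgraphs Q2 \<longleftrightarrow> pattern_Q2 (\<lambda>i. i \<in> S)"
    "S \<in> even_subgraphs Q3 \<longleftrightarrow> pattern_Q2 (\<lambda>i. i \<in> S)"
    "S \<in> even_subgraphs Q4 \<longleftrightarrow> pattern_Q4 (\<lambda>i. i \<in> S)"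
  unfolding Q_eq_mgraph_of_pairs pattern_K4_def pattern_Q2_def pattern_Q4_def
  by (subst even_subgraphs_mgraph_of_pairs[OF _ S], simp, unfold all_less_3_4,
      cases "0 \<in> S"; cases "1 \<in> S"; cases "2 \<in> S"; cases "3 \<in> S"; cases "4 \<in> S"; cases "5 \<in> S";
      simp add: nth_6_simps)+

lemma has_minor_Q_iff:
  assumes Z: "cycle_space E Z"
  shows "has_minor (space_matroid E Z) (cycle_matroid Q1) \<longleftrightarrow> has_pattern E Z pattern_K4"
    "has_minor (space_matroid E Z) (cycle_matroid Q2) \<longleftrightarrow> has_pattern E Z pattern_Q2"
    "has_minor (space_matroid E Z) (cycle_matroid Q3) \<longleftrightarrow> has_pattern E Z pattern_Q2"
    "has_minor (space_matroid E Z) (cycle_matroid Q4) \<longleftrightarrow> has_pattern E Z pattern_Q4"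
proof -
  have fin: "finite_mgraph Q1" "finite_mgraph Q2" "finite_mgraph Q3" "finite_mgraph Q4"
    unfolding Q_eq_mgraph_of_pairs by (rule finite_mgraph_of_pairs, simp)+
  have edges: "edges Q1 = {..<6}" "edges Q2 = {..<6}" "edges Q3 = {..<6}" "edges Q4 = {..<6}"
    unfolding Q_eq_mgraph_of_pairs by simp_all
  have local: "pattern_K4 b = pattern_K4 b'" "pattern_Q2 b = pattern_Q2 b'" "pattern_Q4 b = pattern_Q4 b'"
    if "\<And>i. i < 6 \<Longrightarrow> b i = b' i" for b b'
    unfolding pattern_K4_def pattern_Q2_def pattern_Q4_def by (simp_all add: that)
  show "has_minor (space_matroid E Z) (cycle_matroid Q1) \<longleftrightarrow> has_pattern E Z pattern_K4"
    by (rule has_minor_space_matroid_iff[OF Z fin(1) edges(1) even_subgraphs_Q(1) local(1)])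
  show "has_minor (space_matroid E Z) (cycle_matroid Q2) \<longleftrightarrow> has_pattern E Z pattern_Q2"
    by (rule has_minor_space_matroid_iff[OF Z fin(2) edges(2) even_subgraphs_Q(2) local(2)])
  show "has_minor (space_matroid E Z) (cycle_matroid Q3) \<longleftrightarrow> has_pattern E Z pattern_Q2"
    by (rule has_minor_space_matroid_iff[OF Z fin(3) edges(3) even_subgraphs_Q(3) local(2)])
  show "has_minor (space_matroid E Z) (cycle_matroid Q4) \<longleftrightarrow> has_pattern E Z pattern_Q4"
    by (rule has_minor_space_matroid_iff[OF Z fin(4) edges(4) even_subgraphs_Q(4) local(3)])
qed

lemma pattern_K4_split_imp:
  assumes Z: "cycle_space E Z" and pat: "has_pattern E (split_space Z X) pattern_K4"
  shows "has_pattern E Z pattern_K4 \<or> has_pattern E Z pattern_Q2 \<or> has_pattern E Z pattern_Q4"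
proof -
  obtain C D k where k: "C \<subseteq> E" "D \<subseteq> E" "C \<inter> D = {}" "inj_on k {..<6::nat}" "E - C - D = k ` {..<6}"
    "\<And>z. z \<subseteq> k ` {..<6} \<Longrightarrow> z \<in> minor_space (split_space Z X) C D \<longleftrightarrow> pattern_K4 (\<lambda>i. k i \<in> z)"
    using pat by (rule has_patternE) blast
  let ?Y = "minor_space Z C D" and ?U = "minor_space (split_space Z X) C D"
  have intro: "has_pattern E Z \<phi>" if "\<And>z. z \<subseteq> k ` {..<6} \<Longrightarrow> z \<in> ?Y \<longleftrightarrow> \<phi> (\<lambda>i. k i \<in> z)" for \<phi>
    unfolding has_pattern_def using k(1-5) that
    by (intro exI[of _ C] exI[of _ D] exI[of _ k]) auto
  have sub: "?U \<subseteq> ?Y" unfolding minor_space_def split_space_def by auto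
  note Y = cycle_spaceD[OF cycle_space_minor[OF Z, of C D]]
  show ?thesis
  proof (cases "?Y \<subseteq> ?U")
    case True
    then show ?thesis using intro[of pattern_K4] k(6) sub by blast
  next
    case False
    \<comment> \<open>Every lift of \<open>w\<close> avoiding \<open>D\<close> meets
      \<open>X\<close> in an odd number of elements; adding one makes an odd cycle even. Hence
      \<open>?Y\<close> consists of \<open>?U\<close> and its translate by \<open>w\<close>.\<close>
    then obtain w where w: "w \<in> ?Y" "w \<notin> ?U" by auto
    obtain s where s: "s \<in> Z" "s \<inter> D = {}" "w = s - C" using w(1) unfolding minor_space_def by auto
    have odd_s: "odd (card (s \<inter> X))" using s w(2) unfolding minor_space_def split_space_def by auto
    have wK: "w \<subseteq> k ` {..<6}" using Y(3)[OF w(1)] k(5) by simp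
    have coset: "z \<in> ?Y \<longleftrightarrow> z \<in> ?U \<or> sym_diff z w \<in> ?U" if "z \<subseteq> k ` {..<6}" for z
    proof
      assume "z \<in> ?Y"
      then obtain t where t: "t \<in> Z" "t \<inter> D = {}" "z = t - C" unfolding minor_space_def by auto
      show "z \<in> ?U \<or> sym_diff z w \<in> ?U"
      proof (cases "even (card (t \<inter> X))")
        case True
        then show ?thesis using t unfolding minor_space_def split_space_def by auto
      next
        case False
        have "sym_diff t s \<inter> X = sym_diff (t \<inter> X) (s \<inter> X)" by auto
        moreover have "finite (t \<inter> X)" "finite (s \<inter> X)" using cycle_spaceD(6)[OF Z] t(1) s(1) by auto
        ultimately have "even (card (sym_diff t s \<inter> X))"
          using odd_card_sym_diff[of "t \<inter> X" "s \<inter> X"] odd_s False by simp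
        then have "sym_diff t s \<in> split_space Z X"
          using cycle_spaceD(4)[OF Z t(1) s(1)] unfolding split_space_def by simp
        moreover have "sym_diff t s \<inter> D = {}" "sym_diff z w = sym_diff t s - C" using t s by auto
        ultimately have "sym_diff z w \<in> ?U"
          unfolding minor_space_def mem_Collect_eq by (intro exI[of _ "sym_diff t s"] conjI)
        then show ?thesis ..
      qed
    next
      assume a: "z \<in> ?U \<or> sym_diff z w \<in> ?U"
      have "z \<in> ?Y" if "sym_diff z w \<in> ?U"
      proof -
        have "sym_diff z w \<in> ?Y" using that sub by blast
        then have "sym_diff (sym_diff z w) w \<in> ?Y" by (rule Y(4)[OF _ w(1)])
        moreover have "sym_diff (sym_diff z w) w = z" by auto
        ultimately show ?thesis by simp
      qed
      then show "z \<in> ?Y" using a sub by auto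
    qed
    have Yz: "z \<in> ?Y \<longleftrightarrow> pattern_K4 (\<lambda>i. k i \<in> z) \<or> pattern_K4 (\<lambda>i. (k i \<in> z) \<noteq> (k i \<in> w))"
      if z: "z \<subseteq> k ` {..<6}" for z
    proof -
      have "(\<lambda>i. k i \<in> sym_diff z w) = (\<lambda>i. (k i \<in> z) \<noteq> (k i \<in> w))" by auto
      moreover have "sym_diff z w \<subseteq> k ` {..<6}" using z wK by auto
      ultimately show ?thesis using coset[OF z] k(6)[OF z] k(6)[of "sym_diff z w"] by simp
    qed
    define c where "c i \<longleftrightarrow> k i \<in> w" for i
    define \<psi> where "\<psi> b \<longleftrightarrow> pattern_K4 b \<or> pattern_K4 (\<lambda>i. b i \<noteq> c i)" for b
    have pat\<psi>: "has_pattern E Z \<psi>"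
      using Yz by (intro intro) (simp add: \<psi>_def c_def)
    have perm: "has_pattern E Z \<phi>"
      if "distinct p" "length p = 6" "set p \<subseteq> {..<6}" "\<And>b. \<psi> b \<longleftrightarrow> \<phi> (\<lambda>i. b (p ! i))" for p \<phi>
      using has_pattern_permute[OF pat\<psi> that] .
    \<comment> \<open>The syndrome of \<open>w\<close> for the three degree conditions of K4, which
      fixes its coset. Single edges realise all nonzero syndromes except the one with three true
      entries; that one belongs to the perfect matchings.\<close>
    define s0 s1 s2 where "s0 \<longleftrightarrow> (c 0 \<noteq> c 1) \<noteq> c 2" and "s1 \<longleftrightarrow> (c 0 \<noteq> c 3) \<noteq> c 4" and "s2 \<longleftrightarrow> (c 1 \<noteq> c 3) \<noteq> c 5"
    have \<psi>: "\<psi> b \<longleftrightarrow> pattern_K4 b \<or> ((b 0 \<noteq> b 1) \<noteq> b 2) = s0 \<and> ((b 0 \<noteq> b 3) \<noteq> b 4) = s1 \<and> ((b 1 \<noteq> b 3) \<noteq> b 5) = s2" for b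
      unfolding \<psi>_def pattern_K4_def s0_def s1_def s2_def by argo
    have nz: "s0 \<or> s1 \<or> s2"
    proof -
      have "\<not> pattern_K4 c" using w(2) k(6)[OF wK] unfolding c_def by simp
      then show ?thesis unfolding pattern_K4_def s0_def s1_def s2_def by argo
    qed
    consider "s0 \<and> s1 \<and> \<not> s2" | "s0 \<and> \<not> s1 \<and> s2" | "s0 \<and> \<not> s1 \<and> \<not> s2" | "\<not> s0 \<and> s1 \<and> s2"
      | "\<not> s0 \<and> s1 \<and> \<not> s2" | "\<not> s0 \<and> \<not> s1 \<and> s2" | "s0 \<and> s1 \<and> s2" using nz by argo
    then show ?thesis
    proof cases
      \<comment> \<open>The edge whose syndrome is that of \<open>w\<close> becomes a loop and is
        listed last. As in the contraction of this edge, its four neighbours form two parallel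
        pairs, and the opposite edge stays single. Cases 2 to 6 repeat this for the other
        edges.\<close>
      case 1
      then have "has_pattern E Z pattern_Q2"
        by (intro perm[of "[1, 3, 2, 4, 5, 0]"]) (simp_all only: \<psi> nth_6_simps pattern_K4_def pattern_Q2_def, auto)
      then show ?thesis by simp
    next
      case 2
      then have "has_pattern E Z pattern_Q2"
        by (intro perm[of "[0, 3, 2, 5, 4, 1]"]) (simp_all only: \<psi> nth_6_simps pattern_K4_def pattern_Q2_def, auto)
      then show ?thesis by simp
    next
      case 3
      then have "has_pattern E Z pattern_Q2"
        by (intro perm[of "[0, 4, 1, 5, 3, 2]"]) (simp_all only: \<psi> nth_6_simps pattern_K4_def pattern_Q2_def, auto)
      then show ?thesis by simp
    next
      case 4
      then have "has_pattern E Z pattern_Q2"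
        by (intro perm[of "[0, 1, 4, 5, 2, 3]"]) (simp_all only: \<psi> nth_6_simps pattern_K4_def pattern_Q2_def, auto)
      then show ?thesis by simp
    next
      case 5
      then have "has_pattern E Z pattern_Q2"
        by (intro perm[of "[0, 2, 3, 5, 1, 4]"]) (simp_all only: \<psi> nth_6_simps pattern_K4_def pattern_Q2_def, auto)
      then show ?thesis by simp
    next
      case 6
      then have "has_pattern E Z pattern_Q2"
        by (intro perm[of "[1, 2, 3, 4, 0, 5]"]) (simp_all only: \<psi> nth_6_simps pattern_K4_def pattern_Q2_def, auto)
      then show ?thesis by simp
    next
      \<comment> \<open>Opposite edges of K4 become parallel, and the permutation lists these three
        pairs.\<close>
      case 7
      then have "has_pattern E Z pattern_Q4"
        by (intro perm[of "[0, 5, 1, 4, 2, 3]"]) (simp_all only: \<psi> nth_6_simps pattern_K4_def pattern_Q4_def, auto)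
      then show ?thesis by simp
    qed
  qed
qed

section \<open>Splitting\<close>

lemma minor_space_split_space:
  assumes "X \<inter> C = {}"
  shows "minor_space (split_space Z X) C D = split_space (minor_space Z C D) X"
proof -
  have *: "(z - C) \<inter> X = z \<inter> X" for z using assms by auto
  show ?thesis
  proof (intro set_eqI iffI)
    fix t assume "t \<in> minor_space (split_space Z X) C D"
    then obtain z where "t = z - C" "z \<in> Z" "even (card (z \<inter> X))" "z \<inter> D = {}"
      unfolding minor_space_def split_space_def by blast
    then show "t \<in> split_space (minor_space Z C D) X"
      unfolding minor_space_def split_space_def using * by auto
  next
    fix t assume "t \<in> split_space (minor_space Z C D) X"
    then obtain z where "t = z - C" "z \<in> Z" "even (card (t \<inter> X))" "z \<inter> D = {}"
      unfolding minor_space_def split_space_def by blast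
    then show "t \<in> minor_space (split_space Z X) C D"
      unfolding minor_space_def split_space_def using * by auto
  qed
qed

text \<open>\<open>X\<close> is chosen inside the minor, away from the contracted set, so the
  splitting adds just one parity condition on three of its six elements.\<close>

lemma has_pattern_split:
  assumes Z: "cycle_space E Z" and pat: "has_pattern E Z \<phi>"
    and ijl: "distinct [i, j, l]" "i < 6" "j < 6" "l < 6"
  shows "\<exists>X\<subseteq>E. card X = 3 \<and> has_pattern E (split_space Z X) (\<lambda>b. \<phi> b \<and> ((b i \<noteq> b j) = b l))"
proof -
  obtain C D k where k: "C \<subseteq> E" "D \<subseteq> E" "C \<inter> D = {}" "inj_on k {..<6::nat}" "E - C - D = k ` {..<6}"
    "\<And>z. z \<subseteq> k ` {..<6} \<Longrightarrow> z \<in> minor_space Z C D \<longleftrightarrow> \<phi> (\<lambda>i. k i \<in> z)"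
    using pat by (rule has_patternE) blast
  let ?X = "{k i, k j, k l}"
  have dist: "distinct [k i, k j, k l]" using ijl k(4) by (auto simp: inj_on_def)
  have XK: "?X \<subseteq> k ` {..<6}" using ijl by auto
  have XE: "?X \<inter> C = {}" "?X \<subseteq> E" using XK unfolding k(5)[symmetric] by blast+
  have mem: "z \<in> minor_space (split_space Z ?X) C D \<longleftrightarrow> \<phi> (\<lambda>i. k i \<in> z) \<and> (((k i \<in> z) \<noteq> (k j \<in> z)) = (k l \<in> z))"
    if "z \<subseteq> k ` {..<6}" for z
    unfolding minor_space_split_space[OF XE(1)] using k(6)[OF that] odd_card_Int_tripleton[OF dist, of z]
    unfolding split_space_def by auto
  have "has_pattern E (split_space Z ?X) (\<lambda>b. \<phi> b \<and> ((b i \<noteq> b j) = b l))"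
    unfolding has_pattern_def
    by (rule exI[of _ C], rule exI[of _ D], rule exI[of _ k]) (intro conjI allI impI k(1-5) mem)
  moreover have "card ?X = 3" using dist by simp
  ultimately show ?thesis using XE(2) by blast
qed

text \<open>In each case \<open>X\<close> is to become a vertex star of K4. For K4 itself it is a
  star already, which all cycles meet evenly, so the minor survives unchanged. For
  \<open>pattern_Q2\<close> it consists of the loop and one edge of each parallel pair, for
  \<open>pattern_Q4\<close> of one edge from each of the three parallel pairs.\<close>

lemma ex_split_pattern_K4:
  assumes Z: "cycle_space E Z"
    and pat: "has_pattern E Z pattern_K4 \<or> has_pattern E Z pattern_Q2 \<or> has_pattern E Z pattern_Q4"
  shows "\<exists>X\<subseteq>E. card X = 3 \<and> has_pattern E (split_space Z X) pattern_K4"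
  using pat
proof (elim disjE)
  assume p: "has_pattern E Z pattern_K4"
  obtain X where X: "X \<subseteq> E" "card X = 3"
    "has_pattern E (split_space Z X) (\<lambda>b. pattern_K4 b \<and> ((b 0 \<noteq> b 1) = b 2))"
    using has_pattern_split[OF Z p, of 0 1 2] by auto
  have "has_pattern E (split_space Z X) pattern_K4"
    using X(3) by (rule has_pattern_permute[where p = "[0, 1, 2, 3, 4, 5]"])
      (simp_all only: nth_6_simps pattern_K4_def, auto)
  then show ?thesis using X by blast
next
  assume p: "has_pattern E Z pattern_Q2"
  obtain X where X: "X \<subseteq> E" "card X = 3"
    "has_pattern E (split_space Z X) (\<lambda>b. pattern_Q2 b \<and> ((b 1 \<noteq> b 3) = b 5))"
    using has_pattern_split[OF Z p, of 1 3 5] by auto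
  have "has_pattern E (split_space Z X) pattern_K4"
    using X(3) by (rule has_pattern_permute[where p = "[4, 1, 0, 3, 2, 5]"])
      (simp_all only: nth_6_simps pattern_K4_def pattern_Q2_def, auto)
  then show ?thesis using X by blast
next
  assume p: "has_pattern E Z pattern_Q4"
  obtain X where X: "X \<subseteq> E" "card X = 3"
    "has_pattern E (split_space Z X) (\<lambda>b. pattern_Q4 b \<and> ((b 1 \<noteq> b 3) = b 5))"
    using has_pattern_split[OF Z p, of 1 3 5] by auto
  have "has_pattern E (split_space Z X) pattern_K4"
    using X(3) by (rule has_pattern_permute[where p = "[0, 2, 5, 4, 3, 1]"])
      (simp_all only: nth_6_simps pattern_K4_def pattern_Q4_def, auto)
  then show ?thesis using X by blast
qed

text \<open>For two complementary spanning paths of K4, both end edges of one path can only be exchanged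
  symmetrically with the middle edge of the other one.\<close>

lemma not_gammoid_if_pattern_K4:
  assumes Z: "cycle_space E Z" and pat: "has_pattern E Z pattern_K4"
  shows "\<not> gammoid (space_matroid E Z)"
proof
  assume gam: "gammoid (space_matroid E Z)"
  obtain C D k where k: "C \<subseteq> E" "D \<subseteq> E" "C \<inter> D = {}" "inj_on k {..<6::nat}" "E - C - D = k ` {..<6}"
    "\<And>z. z \<subseteq> k ` {..<6} \<Longrightarrow> z \<in> minor_space Z C D \<longleftrightarrow> pattern_K4 (\<lambda>i. k i \<in> z)"
    using pat by (rule has_patternE) blast
  obtain J where J: "J \<subseteq> C" "acyclic_in Z J" "\<And>x. x \<in> C - J \<Longrightarrow> \<exists>z\<in>Z. z \<subseteq> insert x J \<and> x \<in> z"
    using ex_maximal_acyclic[OF Z k(1)] by blast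
  let ?M = "minor_space Z C D"
  have KCD: "k ` {..<6} \<inter> C = {}" "k ` {..<6} \<inter> D = {}" "k ` {..<6} \<subseteq> E" using k(5) by auto
  have kk: "k i = k j \<longleftrightarrow> i = j" if "i < 6" "j < 6" for i j using k(4) that by (auto simp: inj_on_eq_iff)
  have kJ: "k i \<notin> J" if "i < 6" for i using KCD(1) J(1) that by auto
  have ac: "acyclic_in Z (I \<union> J) \<longleftrightarrow> acyclic_in ?M I" if "I \<subseteq> k ` {..<6}" for I
  proof -
    have "I \<inter> C = {}" "I \<inter> D = {}" using that KCD by auto
    then show ?thesis
      using acyclic_in_Un_basis_iff[OF Z J] acyclic_in_minor_space_delete[OF _ k(3)] by metis
  qed
  have mem: "k ` A \<in> ?M \<longleftrightarrow> pattern_K4 (\<lambda>i. i < 6 \<and> i \<in> A)" if "A \<subseteq> {..<6}" for A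
  proof -
    have "k i \<in> k ` A \<longleftrightarrow> i \<in> A" if "i < 6" for i
      using inj_on_image_mem_iff[OF k(4), of i A] that \<open>A \<subseteq> {..<6}\<close> by simp
    moreover have "k ` A \<subseteq> k ` {..<6}" using that by auto
    ultimately show ?thesis using k(6)[of "k ` A"] unfolding pattern_K4_def by simp
  qed
  have dep: "\<not> acyclic_in Z (k ` B \<union> J)" if "B \<subseteq> {..<6}" "A \<subseteq> B" "A \<noteq> {}" "pattern_K4 (\<lambda>i. i < 6 \<and> i \<in> A)" for A B
  proof -
    have "k ` B \<subseteq> k ` {..<6}" "k ` A \<in> ?M" "k ` A \<subseteq> k ` B" "k ` A \<noteq> {}" using that mem[of A] by auto
    then show ?thesis using ac[of "k ` B"] acyclic_inD[of ?M "k ` B" "k ` A"] by blast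
  qed
  have indep: "acyclic_in Z (k ` B \<union> J)" if B: "B \<subseteq> {..<6}"
    "\<And>b. pattern_K4 b \<Longrightarrow> (\<And>i. i < 6 \<Longrightarrow> i \<notin> B \<Longrightarrow> \<not> b i) \<Longrightarrow> (\<And>i. i < 6 \<Longrightarrow> \<not> b i)" for B
  proof -
    have "acyclic_in ?M (k ` B)" unfolding acyclic_in_def
    proof (intro ballI impI)
      fix z assume z: "z \<in> ?M" "z \<subseteq> k ` B"
      then have zK: "z \<subseteq> k ` {..<6}" using B(1) by auto
      have "k i \<notin> z" if "i < 6" "i \<notin> B" for i
        using inj_on_image_mem_iff[OF k(4), of i B] B(1) that z(2) by auto
      then have "k i \<notin> z" if "i < 6" for i using B(2)[of "\<lambda>i. k i \<in> z"] k(6)[OF zK] z(1) that by blast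
      then show "z = {}" using zK by auto
    qed
    moreover have "k ` B \<subseteq> k ` {..<6}" using B(1) by auto
    ultimately show ?thesis using ac[of "k ` B"] by blast
  qed
  \<comment> \<open>The edges 1, 2, 4 and 0, 3, 5 of \<open>Q1\<close> form complementary spanning
    paths with middle edges 2 and 3. Adjoining the basis \<open>J\<close> of \<open>C\<close> turns
    them into bases of \<open>E - D\<close>, so the exchange takes place in the whole
    matroid.\<close>
  let ?I = "k ` {1, 2, 4} \<union> J" and ?J = "k ` {0, 3, 5} \<union> J" and ?S = "E - D"
  have JE: "J \<subseteq> ?S" using J(1) k(1,3) by auto
  have basis: "is_basis_of (space_matroid E Z) (k ` B \<union> J) ?S"
    if B: "B \<subseteq> {..<6}" "acyclic_in Z (k ` B \<union> J)"
      "\<And>i. i < 6 \<Longrightarrow> i \<notin> B \<Longrightarrow> \<not> acyclic_in Z (k ` insert i B \<union> J)" for B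
    unfolding is_basis_of_space_matroid_iff
  proof (intro conjI ballI)
    have "k ` B \<subseteq> ?S" using image_mono[OF B(1), of k] KCD by blast
    then show "k ` B \<union> J \<subseteq> E" "k ` B \<union> J \<subseteq> ?S" using JE by auto
    show "acyclic_in Z (k ` B \<union> J)" by (rule B(2))
    fix x assume x: "x \<in> ?S \<inter> E - (k ` B \<union> J)"
    show "\<not> acyclic_in Z (insert x (k ` B \<union> J))"
    proof (cases "x \<in> C")
      case True
      then obtain z where "z \<in> Z" "z \<subseteq> insert x J" "x \<in> z" using J(3)[of x] x by auto
      then show ?thesis using acyclic_inD[of Z "insert x (k ` B \<union> J)" z] by auto
    next
      case False
      then have "x \<in> k ` {..<6}" using x k(5) by auto
      then obtain i where "i < 6" "x = k i" by auto
      then show ?thesis using B(3)[of i] x by auto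
    qed
  qed
  have six: "i = 0 \<or> i = 1 \<or> i = 2 \<or> i = 3 \<or> i = 4 \<or> i = 5" if "i < 6" for i :: nat using that by auto
  have "is_basis_of (space_matroid E Z) ?I ?S"
  proof (rule basis)
    show "acyclic_in Z ?I"
    proof (rule indep)
      show "\<not> b i" if "pattern_K4 b" "\<And>i. i < 6 \<Longrightarrow> i \<notin> {1, 2, 4} \<Longrightarrow> \<not> b i" "i < 6" for b i
        using that(1) that(2)[of 0] that(2)[of 3] that(2)[of 5] six[OF that(3)]
        unfolding pattern_K4_def by auto
    qed auto
    fix i :: nat assume "i < 6" "i \<notin> {1, 2, 4}"
    then consider "i = 0" | "i = 3" | "i = 5" using six by auto
    then show "\<not> acyclic_in Z (k ` insert i {1, 2, 4} \<union> J)"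
    proof cases
      case 1
      show ?thesis unfolding 1 by (rule dep[of _ "{0, 2, 4}"]) (auto simp: pattern_K4_def)
    next
      case 2
      show ?thesis unfolding 2 by (rule dep[of _ "{1, 2, 3, 4}"]) (auto simp: pattern_K4_def)
    next
      case 3
      show ?thesis unfolding 3 by (rule dep[of _ "{1, 2, 5}"]) (auto simp: pattern_K4_def)
    qed
  qed auto
  moreover have "is_basis_of (space_matroid E Z) ?J ?S"
  proof (rule basis)
    show "acyclic_in Z ?J"
    proof (rule indep)
      show "\<not> b i" if "pattern_K4 b" "\<And>i. i < 6 \<Longrightarrow> i \<notin> {0, 3, 5} \<Longrightarrow> \<not> b i" "i < 6" for b i
        using that(1) that(2)[of 1] that(2)[of 2] that(2)[of 4] six[OF that(3)]
        unfolding pattern_K4_def by auto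
    qed auto
    fix i :: nat assume "i < 6" "i \<notin> {0, 3, 5}"
    then consider "i = 1" | "i = 2" | "i = 4" using six by auto
    then show "\<not> acyclic_in Z (k ` insert i {0, 3, 5} \<union> J)"
    proof cases
      case 1
      show ?thesis unfolding 1 by (rule dep[of _ "{0, 1, 3}"]) (auto simp: pattern_K4_def)
    next
      case 2
      show ?thesis unfolding 2 by (rule dep[of _ "{0, 2, 3, 5}"]) (auto simp: pattern_K4_def)
    next
      case 3
      show ?thesis unfolding 3 by (rule dep[of _ "{3, 4, 5}"]) (auto simp: pattern_K4_def)
    qed
  qed auto
  ultimately have "\<exists>\<pi>. bij_betw \<pi> (?J - ?I) (?I - ?J) \<and> (\<forall>j\<in>?J - ?I.
      insert j (?I - {\<pi> j}) \<in> indeps (space_matroid E Z) \<and> insert (\<pi> j) (?J - {j}) \<in> indeps (space_matroid E Z))"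
    by (rule gammoid_base_orderable[OF gam])
  then obtain \<pi> where \<pi>: "bij_betw \<pi> (?J - ?I) (?I - ?J)" "\<forall>j\<in>?J - ?I.
      insert j (?I - {\<pi> j}) \<in> indeps (space_matroid E Z) \<and> insert (\<pi> j) (?J - {j}) \<in> indeps (space_matroid E Z)"
    by (elim exE conjE) (rule that)
  have exch: "acyclic_in Z (insert j (?I - {\<pi> j}))" "acyclic_in Z (insert (\<pi> j) (?J - {j}))" if "j \<in> ?J - ?I" for j
    using bspec[OF \<pi>(2) that] unfolding indeps_space_matroid by blast+
  have d: "?J - ?I = {k 0, k 3, k 5}" "?I - ?J = {k 1, k 2, k 4}"
    using kk kJ by auto
  have k05: "k 0 \<in> ?J - ?I" "k 5 \<in> ?J - ?I" unfolding d by auto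
  \<comment> \<open>Exchanging \<open>k 0\<close> with \<open>k 1\<close> would put a triangle into
    the first basis, exchanging it with \<open>k 4\<close> a triangle into the second.\<close>
  have "\<pi> (k 0) = k 2"
  proof (rule ccontr)
    assume "\<pi> (k 0) \<noteq> k 2"
    then have "\<pi> (k 0) = k 1 \<or> \<pi> (k 0) = k 4" using bij_betwE[OF \<pi>(1)] k05 unfolding d by auto
    then show False
    proof
      assume p: "\<pi> (k 0) = k 1"
      have "k ` {0, 2, 4} \<union> J = insert (k 0) (?I - {\<pi> (k 0)})" unfolding p using kk kJ by auto
      moreover have "\<not> acyclic_in Z (k ` {0, 2, 4} \<union> J)"
        by (rule dep[of _ "{0, 2, 4}"]) (auto simp: pattern_K4_def)
      ultimately show False using exch[OF k05(1)] by metis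
    next
      assume p: "\<pi> (k 0) = k 4"
      have "k ` {3, 4, 5} \<union> J = insert (\<pi> (k 0)) (?J - {k 0})" unfolding p using kk kJ by auto
      moreover have "\<not> acyclic_in Z (k ` {3, 4, 5} \<union> J)"
        by (rule dep[of _ "{3, 4, 5}"]) (auto simp: pattern_K4_def)
      ultimately show False using exch[OF k05(1)] by metis
    qed
  qed
  \<comment> \<open>Here the partner \<open>k 1\<close> creates a triangle in the second basis and
    \<open>k 4\<close> one in the first, so both end edges claim the partner
    \<open>k 2\<close>.\<close>
  moreover have "\<pi> (k 5) = k 2"
  proof (rule ccontr)
    assume "\<pi> (k 5) \<noteq> k 2"
    then have "\<pi> (k 5) = k 1 \<or> \<pi> (k 5) = k 4" using bij_betwE[OF \<pi>(1)] k05 unfolding d by auto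
    then show False
    proof
      assume p: "\<pi> (k 5) = k 1"
      have "k ` {0, 1, 3} \<union> J = insert (\<pi> (k 5)) (?J - {k 5})" unfolding p using kk kJ by auto
      moreover have "\<not> acyclic_in Z (k ` {0, 1, 3} \<union> J)"
        by (rule dep[of _ "{0, 1, 3}"]) (auto simp: pattern_K4_def)
      ultimately show False using exch[OF k05(2)] by metis
    next
      assume p: "\<pi> (k 5) = k 4"
      have "k ` {1, 2, 5} \<union> J = insert (k 5) (?I - {\<pi> (k 5)})" unfolding p using kk kJ by auto
      moreover have "\<not> acyclic_in Z (k ` {1, 2, 5} \<union> J)"
        by (rule dep[of _ "{1, 2, 5}"]) (auto simp: pattern_K4_def)
      ultimately show False using exch[OF k05(2)] by metis
    qed
  qed
  ultimately have "k 0 = k 5"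
    using inj_onD[OF bij_betw_imp_inj_on[OF \<pi>(1)] _ k05] by simp
  then show False using kk[of 0 5] by simp
qed

theorem theorem1p4:
  fixes B :: "'a matroid" and A :: "'a gf2_matrix"
  assumes "graphic B" and "represents A B"
  shows "(\<forall>X. X \<subseteq> ground B \<and> 2 \<le> card X \<longrightarrow> binary_gammoid (splitting_matroid B A X)) \<longleftrightarrow>
         (\<forall>Q\<in>{Q1, Q2, Q3, Q4}. \<not> has_minor B (cycle_matroid Q))"
proof -
  let ?E = "ground B" and ?Z = "kernel_space (ground B) A"
  have fin: "finite ?E" using assms(1) unfolding graphic_def is_matroid_def by simp
  have Z: "cycle_space ?E ?Z" by (rule cycle_space_kernel[OF fin])
  have B: "B = space_matroid ?E ?Z"
    using assms(2) column_matroid_eq_space_matroid[OF fin, of A] unfolding represents_def by simp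
  have minors: "(\<exists>Q\<in>{Q1, Q2, Q3, Q4}. has_minor B (cycle_matroid Q)) \<longleftrightarrow>
      has_pattern ?E ?Z pattern_K4 \<or> has_pattern ?E ?Z pattern_Q2 \<or> has_pattern ?E ?Z pattern_Q4"
    using has_minor_Q_iff[OF Z] unfolding B[symmetric] by auto
  have gam: "binary_gammoid (splitting_matroid B A X) \<longleftrightarrow> \<not> has_pattern ?E (split_space ?Z X) pattern_K4" for X
    using binary_splitting_matroid[OF fin, of A X] gammoid_if_no_pattern_K4[OF cycle_space_split[OF Z]]
      not_gammoid_if_pattern_K4[OF cycle_space_split[OF Z]]
    unfolding binary_gammoid_def splitting_matroid_eq[OF fin] by blast
  show ?thesis
  proof
    assume L: "\<forall>X. X \<subseteq> ?E \<and> 2 \<le> card X \<longrightarrow> binary_gammoid (splitting_matroid B A X)"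
    show "\<forall>Q\<in>{Q1, Q2, Q3, Q4}. \<not> has_minor B (cycle_matroid Q)"
    proof (rule ccontr)
      assume "\<not> ?thesis"
      then obtain X where X: "X \<subseteq> ?E" "card X = 3" "has_pattern ?E (split_space ?Z X) pattern_K4"
        using ex_split_pattern_K4[OF Z] minors by blast
      then have "binary_gammoid (splitting_matroid B A X)" using L by simp
      then show False using gam X(3) by blast
    qed
  next
    assume "\<forall>Q\<in>{Q1, Q2, Q3, Q4}. \<not> has_minor B (cycle_matroid Q)"
    then show "\<forall>X. X \<subseteq> ?E \<and> 2 \<le> card X \<longrightarrow> binary_gammoid (splitting_matroid B A X)"
      using pattern_K4_split_imp[OF Z] minors gam by blast
  qed
qed

end
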